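(* Let $h\in L^1(0,T)$, $h\ge0$, and let $f$ be a concave modulus of continuity with $\int_0^\varepsilon\frac{du}{f(u)}=\infty$ for any $\varepsilon>0$. Let $B^1,B^2:[0,T]\times\mathbb{R}^d\times\mathcal{P}_1(\mathbb{R}^d)\to\mathbb{R}^d$ be measurable drifts such that for $i=1,2$: (a) for any $t\in[0,T]$, $B^i_t$ is uniformly continuous on bounded subsets of $\mathbb{R}^d\times\mathcal{P}_1(\mathbb{R}^d)$, and there exists $k^i\in L^1(0,T)$ with $|B^i_t(x,\mu)|\le k^i_t(1+|x|+\|\mu\|_1)$ for all $(t,x,\mu)$; (b) $|B^i_t(x,\mu)-B^i_t(y,\nu)|\le h_t\,f(|x-y|+d_1(\mu,\nu))$ for all $t\in[0,T]$, $x,y\in\mathbb{R}^d$, $\mu,\nu\in\mathcal{P}_1(\mathbb{R}^d)$. Let $\mu^{Y^1},\mu^{Y^2}\in\mathcal{P}_1(C_T)$ be two input laws. Then for $i=1,2$ there exists a unique weak solution, with law $\mu^{X^i}$, to $$X^i_t=\int_0^t B^i_s(X^i_s,\mathcal{L}(X^i_s))\,ds+Y^i_t,\quad t\in[0,T],\qquad\mathcal{L}(Y^i)=\mu^{Y^i}.$$ Furthermore, there exists a continuous, increasing function $M:[0,\infty)\to[0,\infty)$ with $M(0)=0$, only depending on $f$ and $h$, such that $$d_1(\mu^{X^1},\mu^{X^2})\le M\big(d_1(\mu^{Y^1},\mu^{Y^2})+T\,\|B^1-B^2\|_\infty\big).$$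
   Context: $T>0$ is fixed, $C_T:=C([0,T];\mathbb{R}^d)$ with supremum norm. $\mathcal{L}(Z)$ is the law of $Z$. For a separable Banach space $E$, $\mathcal{P}_1(E)$ is the set of Borel probability measures $\mu$ on $E$ with $\|\mu\|_1:=\int\|x\|_E\mu(dx)<\infty$, with the $1$-Wasserstein distance $d_1$. A modulus of continuity is a continuous nondecreasing function $f:[0,\infty)\to[0,\infty)$ with $f(0)=0$ and $f(u)>0$ for $u>0$. $\|B^1-B^2\|_\infty:=\sup_{(s,x,\mu)}|B^1_s(x,\mu)-B^2_s(x,\mu)|\in[0,\infty]$ over $[0,T]\times\mathbb{R}^d\times\mathcal{P}_1(\mathbb{R}^d)$; by convention $M(+\infty)=+\infty$. Weak solution with drift $B$ and input $\mu^Y$: a tuple $(\Omega,\mathcal{F},\mathbb{P};X,Y)$, $(X,Y):\Omega\to C_T\times C_T$ measurable, with (1) $\mathcal{L}(Y)=\mu^Y$; (2) $\sup_{t\in[0,T]}\|\mathcal{L}(X_t)\|_1<\infty$; (3) $\int_0^T|B_t(X_t,\mathcal{L}(X_t))|dt<\infty$ a.s.; (4) a.s. the equation holds for all $t\in[0,T]$. Uniqueness of the weak solution is in law: any two weak solutions with the same input law have the same law $\mathcal{L}(X)=:\mu^X\in\mathcal{P}(C_T)$. *)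

theory Defs
  imports "HOL-Probability.Probability"
begin

section \<open>First moments and the 1-Wasserstein distance\<close>

text \<open>
  A separable Banach space is given as a closed separable subspace \<open>E\<close> of a normed type, with the
  Borel sets of the subspace topology. It is used with \<open>E = UNIV\<close> for $R^d$ and with the path space
  below.
\<close>

definition moment1 :: "'a::real_normed_vector measure \<Rightarrow> ennreal" where
  "moment1 \<mu> = (\<integral>\<^sup>+ x. ennreal (norm x) \<partial>\<mu>)"

definition P1 :: "'a::real_normed_vector set \<Rightarrow> 'a measure set" where
  "P1 E = {\<mu>. prob_space \<mu> \<and> sets \<mu> = sets (restrict_space borel E) \<and> moment1 \<mu> < \<infinity>}"

definition couplings :: "'a measure \<Rightarrow> 'a measure \<Rightarrow> ('a \<times> 'a) measure set" where
  "couplings \<mu> \<nu> = {\<pi>. sets \<pi> = sets (\<mu> \<Otimes>\<^sub>M \<nu>) \<and> distr \<pi> \<mu> fst = \<mu> \<and> distr \<pi> \<nu> snd = \<nu>}"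

text \<open>
  The distance is extended-valued, so that an upper bound on it also asserts finiteness;
  \<open>d1\<close> is its real-valued form, for use on \<open>P1 E\<close>, where the distance is finite.
\<close>

definition wasserstein1 :: "'a::metric_space measure \<Rightarrow> 'a measure \<Rightarrow> ennreal" where
  "wasserstein1 \<mu> \<nu> = (INF \<pi>\<in>couplings \<mu> \<nu>. \<integral>\<^sup>+ z. ennreal (dist (fst z) (snd z)) \<partial>\<pi>)"

definition d1 :: "'a::metric_space measure \<Rightarrow> 'a measure \<Rightarrow> real" where
  "d1 \<mu> \<nu> = enn2real (wasserstein1 \<mu> \<nu>)"

text \<open>The Borel \<open>\<sigma>\<close>-algebra of the metric space \<open>P1 E\<close>, generated by its open sets.\<close>

definition P1_borel :: "'a::real_normed_vector set \<Rightarrow> 'a measure measure" where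
  "P1_borel E = sigma (P1 E)
     {U. U \<subseteq> P1 E \<and> (\<forall>\<mu>\<in>U. \<exists>e>0. \<forall>\<nu>\<in>P1 E. d1 \<mu> \<nu> < e \<longrightarrow> \<nu> \<in> U)}"


section \<open>Path space\<close>

text \<open>
  $C([0,T]; R^d)$ is represented by the bounded continuous functions on the real line that are
  constant to the left of \<open>0\<close> and to the right of \<open>T\<close>. Restriction to \<open>{0..T}\<close> is an isometric
  isomorphism onto $C([0,T]; R^d)$ with the supremum norm.
\<close>

type_synonym 'd path = "real \<Rightarrow>\<^sub>C (real^'d)"

definition C_paths :: "real \<Rightarrow> ('d::finite) path set" where
  "C_paths T = {w. \<forall>t. apply_bcontfun w t = apply_bcontfun w (clamp 0 T t)}"

definition path_borel :: "real \<Rightarrow> ('d::finite) path measure" where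
  "path_borel T = restrict_space borel (C_paths T)"


section \<open>Moduli of continuity and drifts\<close>

definition modulus_of_continuity :: "(real \<Rightarrow> real) \<Rightarrow> bool" where
  "modulus_of_continuity f \<longleftrightarrow>
     continuous_on {0..} f \<and> mono_on {0..} f \<and> f 0 = 0 \<and> (\<forall>u>0. f u > 0)"

text \<open>Drifts matter only on \<open>{0..T} \<times> UNIV \<times> P1 UNIV\<close>; values elsewhere are never used.\<close>

type_synonym 'd drift = "real \<Rightarrow> real^'d \<Rightarrow> (real^'d) measure \<Rightarrow> real^'d"

definition drift_measurable :: "real \<Rightarrow> ('d::finite) drift \<Rightarrow> bool" where
  "drift_measurable T B \<longleftrightarrow>
     (\<lambda>(t, x, \<mu>). B t x \<mu>)
       \<in> borel_measurable (restrict_space borel {0..T} \<Otimes>\<^sub>M borel \<Otimes>\<^sub>M P1_borel UNIV)"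

definition uniformly_continuous_on_bounded_sets ::
    "(real^('d::finite) \<Rightarrow> (real^'d) measure \<Rightarrow> real^'d) \<Rightarrow> bool" where
  "uniformly_continuous_on_bounded_sets F \<longleftrightarrow>
     (\<forall>S \<subseteq> UNIV \<times> P1 UNIV.
        (\<exists>R. \<forall>(x, \<mu>)\<in>S. \<forall>(y, \<nu>)\<in>S. dist x y + d1 \<mu> \<nu> \<le> R) \<longrightarrow>
        (\<forall>\<epsilon>>0. \<exists>\<delta>>0. \<forall>(x, \<mu>)\<in>S. \<forall>(y, \<nu>)\<in>S.
           dist x y + d1 \<mu> \<nu> < \<delta> \<longrightarrow> dist (F x \<mu>) (F y \<nu>) < \<epsilon>))"

definition linear_growth :: "real \<Rightarrow> (real \<Rightarrow> real) \<Rightarrow> ('d::finite) drift \<Rightarrow> bool" where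
  "linear_growth T k B \<longleftrightarrow>
     (\<forall>t\<in>{0..T}. \<forall>x. \<forall>\<mu>\<in>P1 UNIV.
        norm (B t x \<mu>) \<le> k t * (1 + norm x + enn2real (moment1 \<mu>)))"

definition admissible_drift ::
    "real \<Rightarrow> (real \<Rightarrow> real) \<Rightarrow> (real \<Rightarrow> real) \<Rightarrow> ('d::finite) drift \<Rightarrow> bool" where
  "admissible_drift T h f B \<longleftrightarrow>
     drift_measurable T B \<and>
     (\<forall>t\<in>{0..T}. uniformly_continuous_on_bounded_sets (B t)) \<and>
     (\<exists>k. k absolutely_integrable_on {0..T} \<and> linear_growth T k B) \<and>
     (\<forall>t\<in>{0..T}. \<forall>x y. \<forall>\<mu>\<in>P1 UNIV. \<forall>\<nu>\<in>P1 UNIV.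
        norm (B t x \<mu> - B t y \<nu>) \<le> h t * f (norm (x - y) + d1 \<mu> \<nu>))"

definition drift_dist :: "real \<Rightarrow> ('d::finite) drift \<Rightarrow> 'd drift \<Rightarrow> ennreal" where
  "drift_dist T B1 B2 =
     (SUP (t, x, \<mu>)\<in>{0..T} \<times> UNIV \<times> P1 UNIV. ennreal (norm (B1 t x \<mu> - B2 t x \<mu>)))"


section \<open>Weak solutions\<close>

definition law_at ::
    "'w measure \<Rightarrow> ('w \<Rightarrow> ('d::finite) path) \<Rightarrow> real \<Rightarrow> (real^'d) measure" where
  "law_at W X t = distr W borel (\<lambda>\<omega>. apply_bcontfun (X \<omega>) t)"

definition weak_solution ::
    "real \<Rightarrow> 'd drift \<Rightarrow> ('d::finite) path measure \<Rightarrow>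
     'w measure \<Rightarrow> ('w \<Rightarrow> 'd path) \<Rightarrow> ('w \<Rightarrow> 'd path) \<Rightarrow> bool" where
  "weak_solution T B \<mu>Y W X Y \<longleftrightarrow>
     prob_space W \<and>
     (\<lambda>\<omega>. (X \<omega>, Y \<omega>)) \<in> W \<rightarrow>\<^sub>M path_borel T \<Otimes>\<^sub>M path_borel T \<and>
     distr W (path_borel T) Y = \<mu>Y \<and>
     (SUP t\<in>{0..T}. moment1 (law_at W X t)) < \<infinity> \<and>
     (AE \<omega> in W. set_integrable lborel {0..T}
        (\<lambda>t. B t (apply_bcontfun (X \<omega>) t) (law_at W X t))) \<and>
     (AE \<omega> in W. \<forall>t\<in>{0..T}.
        apply_bcontfun (X \<omega>) t =
          (LBINT s:{0..t}. B s (apply_bcontfun (X \<omega>) s) (law_at W X s))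
            + apply_bcontfun (Y \<omega>) t)"

text \<open>
  \<open>\<mu>X\<close> is the law of the \<open>X\<close>-component of a weak solution. A formula cannot quantify over the type of
  sample points, so the sample space is taken on the type of pairs of paths, as for the canonical
  process; the joint law of a solution on any other sample space is again a solution there.
\<close>

definition weak_solution_law ::
    "real \<Rightarrow> 'd drift \<Rightarrow> ('d::finite) path measure \<Rightarrow> 'd path measure \<Rightarrow> bool" where
  "weak_solution_law T B \<mu>Y \<mu>X \<longleftrightarrow>
     (\<exists>(W :: ('d path \<times> 'd path) measure) X Y.
        weak_solution T B \<mu>Y W X Y \<and> distr W (path_borel T) X = \<mu>X)"

definition extend_top :: "(real \<Rightarrow> real) \<Rightarrow> ennreal \<Rightarrow> ennreal" where
  "extend_top M u = (if u = \<infinity> then \<infinity> else ennreal (M (enn2real u)))"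

end

theory Submission
  imports Defs
begin

text \<open>
  Freeze the flow of marginals of a weak solution. What remains is an ordinary equation with additive
  path input, which is solved path by path; hence a weak solution is a measurable function \<open>\<Phi>\<close> of its
  input. Two solutions can therefore be coupled by any coupling of their inputs, without gluing
  measures, and \<open>e t = E |X1 t - X2 t|\<close> dominates the distance of the marginals at time \<open>t\<close>. Concavity
  of \<open>f\<close> gives \<open>e t \<le> a + \<integral> 2 h f(e)\<close> over \<open>[0, t]\<close>, where \<open>a\<close> is the cost of the coupling plus \<open>T\<close>
  times the distance of the drifts. With \<open>G\<close> an antiderivative of \<open>1 / f\<close>, Bihari's inequality bounds
  the right-hand side by \<open>G\<inverse> (G a + 2 \<integral> h)\<close>, and the Osgood condition makes this tend to \<open>0\<close> with \<open>a\<close>.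
  Existence, both for the frozen equation and for the original one, follows by Picard iteration, which
  is controlled by the same scalar inequality.
\<close>

section \<open>Bihari's inequality\<close>

text \<open>The modulus need not be Lipschitz, so the Picard map has no evident contraction
  constant. Its place is taken by a deterministic sequence of majorants: from a solution of
  \<open>q = A + J q\<close>, where \<open>J\<close> is the scalar integral operator, repeated
  application of \<open>J\<close> descends to a solution of \<open>z = J z\<close>, and Bihari's
  inequality with initial value 0 forces its value at \<open>T\<close> to vanish.

  Concavity enters only through \<open>scale\<close>, and this one inequality does three things. It
  limits \<open>f\<close> to linear growth, so that \<open>G\<close> is unbounded above and its
  inverse has a value wherever the bound needs one; it pulls a weight depending on the input path
  out of \<open>f\<close>; and it bounds the mean of \<open>f\<close> without Jensen.

  The measure theory is shaped by the ambient type of bounded continuous functions not being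
  separable. Solution maps are therefore built for every input path as pointwise limits of
  continuous maps, and distances of random paths are made measurable through rational times.\<close>

locale osgood =
  fixes f :: "real \<Rightarrow> real"
  assumes cont: "continuous_on UNIV f"
    and mono: "mono f"
    and zero: "f 0 = 0"
    and nonneg: "0 \<le> f u"
    and pos: "0 < u \<Longrightarrow> 0 < f u"
    and scale: "0 \<le> u \<Longrightarrow> 1 \<le> c \<Longrightarrow> f (c * u) \<le> c * f u"
    and diverges: "(\<integral>\<^sup>+ u\<in>{0<..<1}. ennreal (1 / f u) \<partial>lborel) = \<infinity>"
begin

text \<open>The signed integral of \<open>1 / f\<close> from 1 to \<open>x\<close>: for
  \<open>x\<close> on either side of 1, one of the two intervals has no interior and contributes 0.
  The base point is positive because the integral diverges at 0.\<close>

definition G :: "real \<Rightarrow> real" where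
  "G x = integral {1..x} (\<lambda>u. 1 / f u) - integral {x..1} (\<lambda>u. 1 / f u)"

lemma recip_continuous: "0 < y \<Longrightarrow> continuous_on {y..x} (\<lambda>u. 1 / f u)"
  using pos by (intro continuous_intros continuous_on_subset[OF cont])
    (auto, metis less_irrefl order_less_le_trans)

lemma recip_integrable: "0 < y \<Longrightarrow> (\<lambda>u. 1 / f u) integrable_on {y..x}"
  by (intro integrable_continuous_real recip_continuous)

lemma G_diff:
  assumes "0 < y" "y \<le> x"
  shows "G x - G y = integral {y..x} (\<lambda>u. 1 / f u)"
proof -
  have z: "integral {u..v} (\<lambda>u. 1 / f u) = 0" if "v \<le> u" for u v
    using that by (cases "u = v") auto
  have c: "integral {u..v} (\<lambda>u. 1 / f u) + integral {v..w} (\<lambda>u. 1 / f u)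
      = integral {u..w} (\<lambda>u. 1 / f u)" if "0 < u" "u \<le> v" "v \<le> w" for u v w
    using that by (intro Henstock_Kurzweil_Integration.integral_combine recip_integrable) auto
  consider "1 \<le> y" | "y \<le> 1" "1 \<le> x" | "x \<le> 1" by linarith
  then show ?thesis
    using assms z[of 1 x] z[of 1 y] z[of x 1] z[of y 1] c[of 1 y x] c[of y x 1] c[of y 1 x]
    by cases (auto simp: G_def)
qed

text \<open>\<open>1 / f\<close> is nonincreasing, so its mean over an interval lies between the
  endpoint values. These two bounds do the work that a derivative of \<open>G\<close> would
  do.\<close>

lemma G_diff_bounds:
  assumes "0 < y" "y \<le> x"
  shows "(x - y) / f x \<le> G x - G y" "G x - G y \<le> (x - y) / f y"
proof -
  have 1: "integral {y..x} (\<lambda>u. 1 / f x) \<le> integral {y..x} (\<lambda>u. 1 / f u)"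
    using assms pos monoD[OF mono]
    by (intro integral_le recip_integrable integrable_const_ivl) (auto intro!: frac_le)
  have 2: "integral {y..x} (\<lambda>u. 1 / f u) \<le> integral {y..x} (\<lambda>u. 1 / f y)"
    using assms pos monoD[OF mono]
    by (intro integral_le recip_integrable integrable_const_ivl) (auto intro!: frac_le)
  show "(x - y) / f x \<le> G x - G y" "G x - G y \<le> (x - y) / f y"
    using 1 2 assms by (auto simp: G_diff)
qed

lemma G_strict_mono: "0 < y \<Longrightarrow> y < x \<Longrightarrow> G y < G x"
  using G_diff_bounds(1)[of y x] pos[of x] by (smt (verit) divide_pos_pos)

lemma G_mono: "0 < y \<Longrightarrow> y \<le> x \<Longrightarrow> G y \<le> G x"
  using G_strict_mono[of y x] by (cases "y = x") auto

lemma G_less_iff: "0 < x \<Longrightarrow> 0 < y \<Longrightarrow> G x < G y \<longleftrightarrow> x < y"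
  by (metis G_mono G_strict_mono linorder_not_less)

lemma G_continuous: "continuous_on {0<..} G"
proof -
  have "continuous_on {y..x} G" if "0 < y" "y < x" for x y
  proof -
    have "dist (G u) (G v) \<le> (1 / f y) * dist u v" if u: "u \<in> {y..x}" and v: "v \<in> {y..x}" for u v
    proof -
      have *: "\<bar>G v - G u\<bar> \<le> (1 / f y) * \<bar>v - u\<bar>" if "u \<in> {y..x}" "v \<in> {y..x}" "u \<le> v" for u v
      proof -
        have "G v - G u \<le> (v - u) / f u" using G_diff_bounds(2)[of u v] that \<open>0 < y\<close> by auto
        also have "\<dots> \<le> (v - u) / f y"
          using that \<open>0 < y\<close> monoD[OF mono, of y u] pos[of y] by (intro divide_left_mono) auto
        finally show ?thesis using G_mono[of u v] that \<open>0 < y\<close> by auto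
      qed
      show ?thesis
        using *[of u v] *[of v u] u v by (cases "u \<le> v") (auto simp: dist_real_def abs_minus_commute)
    qed
    then have "(1 / f y)-lipschitz_on {y..x} G"
      using pos[of y] \<open>0 < y\<close> by (intro lipschitz_onI) auto
    then show ?thesis by (rule lipschitz_on_continuous_on)
  qed
  then have *: "continuous_on {y..x} G" if "0 < y" "y < x" for x y using that by blast
  have "continuous (at x) G" if "0 < x" for x
  proof -
    have "x \<in> interior {x/2..2*x}" using that by (simp add: interior_atLeastAtMost_real)
    then show ?thesis using continuous_on_interior[OF *[of "x/2" "2*x"]] that by auto
  qed
  then show ?thesis by (simp add: continuous_at_imp_continuous_on)
qed

text \<open>By \<open>scale\<close>, \<open>f\<close> is at most \<open>2 * 2 ^ n * f 1\<close> at
  the right end of the dyadic block from \<open>2 ^ n\<close> to \<open>2 * 2 ^ n\<close>, so every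
  block contributes at least \<open>1 / (2 * f 1)\<close> to \<open>G\<close>.\<close>

lemma G_unbounded_above: "\<exists>x>0. c < G x"
proof -
  have step: "G (2 ^ n) \<ge> G 1 + real n * (1 / (2 * f 1))" for n
  proof (induction n)
    case (Suc n)
    have "1 \<le> 2 * (2::real) ^ n" using one_le_power[of "2::real" n] by linarith
    then have "f (2 * 2 ^ n) \<le> (2 * 2 ^ n) * f 1" using scale[of 1 "2 * 2 ^ n"] by simp
    then have "(1 / (2 * f 1)) \<le> 2 ^ n / f (2 * 2 ^ n)"
      using pos[of 1] pos[of "2 * 2 ^ n"] by (simp add: field_simps)
    also have "\<dots> \<le> G (2 * 2 ^ n) - G (2 ^ n)"
      using G_diff_bounds(1)[of "2 ^ n" "2 * 2 ^ n"] by simp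
    finally have "G 1 + real n * (1 / (2 * f 1)) + 1 / (2 * f 1) \<le> G (2 * 2 ^ n)" using Suc by linarith
    then show ?case by (simp only: of_nat_Suc ring_distribs power_Suc mult_1)
  qed auto
  obtain n where "(c - G 1) / (1 / (2 * f 1)) < real n" using reals_Archimedean2 by blast
  then have "c - G 1 < real n * (1 / (2 * f 1))"
    using pos[of 1] by (simp add: pos_less_divide_eq)
  then show ?thesis using step[of n] by (intro exI[of _ "2 ^ n"]) auto
qed

text \<open>The Osgood condition in terms of \<open>G\<close>. A lower bound \<open>c\<close> would
  bound the integral of \<open>1 / f\<close> over each interval from \<open>1 / (n + 1)\<close> to 1
  by \<open>G 1 - c\<close>, and by monotone convergence also the integral over the whole unit
  interval.\<close>

lemma G_unbounded_below: "\<exists>x>0. G x < c"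
proof (rule ccontr)
  assume "\<not> ?thesis"
  then have ge: "c \<le> G x" if "0 < x" for x using that by force
  define A where "A n = {1 / real (Suc n)..<1}" for n
  define D where "D = density lborel (\<lambda>u. ennreal (1 / f u))"
  have m: "(\<lambda>u. ennreal (1 / f u)) \<in> borel_measurable lborel"
    using borel_measurable_continuous_onI[OF cont] by measurable
  have A: "incseq A" unfolding A_def incseq_def
    by (auto intro: order_trans[rotated] simp: frac_le)
  have U: "(\<Union>n. A n) = {0<..<1}"
  proof (intro equalityI subsetI)
    fix x :: real assume x: "x \<in> {0<..<1}"
    then obtain n where "1 / real (Suc n) < x" using nat_approx_posE[of x] by auto
    then show "x \<in> (\<Union>n. A n)" using x by (auto simp: A_def intro: less_imp_le)
  next
    fix x :: real assume "x \<in> (\<Union>n. A n)"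
    then obtain n where "1 / real (Suc n) \<le> x" "x < 1" by (auto simp: A_def)
    moreover have "0 < 1 / real (Suc n)" by simp
    ultimately have "0 < x" using order_less_le_trans by blast
    then show "x \<in> {0<..<1}" using \<open>x < 1\<close> by simp
  qed
  have bound: "emeasure D (A n) \<le> ennreal (G 1 - c)" for n
  proof -
    define \<delta> where "\<delta> = 1 / real (Suc n)"
    have \<delta>: "0 < \<delta>" "\<delta> \<le> 1" by (auto simp: \<delta>_def)
    have "((\<lambda>u. 1 / f u) has_integral (G 1 - G \<delta>)) {\<delta>..1}"
      using \<delta> by (simp add: G_diff recip_integrable integrable_integral)
    then have hi: "((\<lambda>u. if u \<in> {\<delta>..1} then 1 / f u else 0) has_integral (G 1 - G \<delta>)) UNIV"
      by (simp only: has_integral_restrict_UNIV)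
    have "emeasure D (A n) = (\<integral>\<^sup>+ u\<in>A n. ennreal (1 / f u) \<partial>lborel)"
      unfolding D_def by (intro emeasure_density m) (auto simp: A_def)
    also have "\<dots> \<le> (\<integral>\<^sup>+ u. ennreal (if u \<in> {\<delta>..1} then 1 / f u else 0) \<partial>lborel)"
      by (intro nn_integral_mono) (auto simp: A_def \<delta>_def indicator_def)
    also have "\<dots> = ennreal (G 1 - G \<delta>)"
    proof (rule nn_integral_has_integral_lborel[OF _ _ hi])
      show "(\<lambda>u. if u \<in> {\<delta>..1} then 1 / f u else 0) \<in> borel_measurable borel"
        using borel_measurable_continuous_onI[OF cont] by measurable
    qed (auto simp: nonneg)
    also have "\<dots> \<le> ennreal (G 1 - c)" using ge[of \<delta>] \<delta> by (intro ennreal_leI) auto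
    finally show ?thesis .
  qed
  have "\<infinity> = emeasure D {0<..<1}"
    unfolding D_def using diverges m by (subst emeasure_density) auto
  also have "\<dots> = (SUP n. emeasure D (A n))"
    unfolding U[symmetric] by (intro SUP_emeasure_incseq[symmetric] A) (auto simp: A_def D_def)
  also have "\<dots> \<le> ennreal (G 1 - c)" by (intro SUP_least bound)
  finally show False by (simp add: top_unique)
qed

lemma G_surj: "\<exists>x>0. G x = c"
proof -
  obtain x where x: "0 < x" "G x < c" using G_unbounded_below by blast
  obtain y where y: "0 < y" "c < G y" using G_unbounded_above by blast
  have "x < y" using x y G_less_iff[of x y] by linarith
  have "continuous_on {x..y} G" using x by (intro continuous_on_subset[OF G_continuous]) auto
  then have "\<exists>z\<ge>x. z \<le> y \<and> G z = c" using x y \<open>x < y\<close> by (intro IVT') auto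
  then obtain z where "x \<le> z" "G z = c" by blast
  then show ?thesis using x by (intro exI[of _ z]) auto
qed

text \<open>The final value of the solution of w' = h f(w) started at \<open>a\<close>, when
  \<open>h\<close> has total mass \<open>H\<close>. Since \<open>G\<close> tends to minus infinity
  at 0, the value at 0 is not covered by the formula and is set to its limit.\<close>

definition M :: "real \<Rightarrow> real \<Rightarrow> real" where
  "M H a = (if a \<le> 0 then 0 else (THE x. 0 < x \<and> G x = G a + H))"

lemma M_0 [simp]: "M H 0 = 0" by (simp add: M_def)

lemma M_pos_G: assumes "0 < a" shows "0 < M H a \<and> G (M H a) = G a + H"
proof -
  obtain x where x: "0 < x" "G x = G a + H" using G_surj by blast
  have "\<exists>!x. 0 < x \<and> G x = G a + H"
  proof (intro ex1I[of _ x])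
    fix y assume "0 < y \<and> G y = G a + H"
    then show "y = x" using x G_less_iff[of x y] G_less_iff[of y x] by auto
  qed (use x in auto)
  from theI'[OF this] show ?thesis using assms by (simp add: M_def)
qed

lemmas M_pos = M_pos_G[THEN conjunct1] and G_M = M_pos_G[THEN conjunct2]

lemma M_nonneg: "0 \<le> M H a"
  using M_pos[of a H] by (cases "a \<le> 0") (auto simp: M_def)

lemma M_less: assumes "0 < a" "a < b" shows "M H a < M H b"
  using G_strict_mono[of a b] assms G_less_iff[of "M H a" "M H b"] M_pos[of a H] M_pos[of b H]
  by (simp add: G_M)

lemma M_strict_mono: "strict_mono_on {0..} (M H)"
proof (rule strict_mono_onI)
  fix a b :: real assume "a \<in> {0..}" "b \<in> {0..}" "a < b"
  then show "M H a < M H b" using M_less[of a b H] M_pos[of b H] by (cases "a = 0") auto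
qed

lemma M_image: assumes "0 < x" shows "\<exists>a>0. M H a = x"
proof -
  obtain a where a: "0 < a" "G a = G x - H" using G_surj by blast
  then have "G (M H a) = G x" by (simp add: G_M)
  then have "M H a = x"
    using G_less_iff[of x "M H a"] G_less_iff[of "M H a" x] M_pos[of a H] a assms by auto
  then show ?thesis using a by blast
qed

text \<open>A monotone function with open range has no jumps, so surjectivity onto the positive
  reals gives continuity there. At 0, surjectivity supplies for each \<open>e\<close> a
  \<open>d\<close> with \<open>M H d = e\<close>, and monotonicity does the rest.\<close>

lemma M_continuous: "continuous_on {0..} (M H)"
proof -
  have im: "M H ` {0<..} = {0<..}"
  proof (intro equalityI subsetI)
    fix x assume "x \<in> {0::real<..}"
    then obtain a where "0 < a" "M H a = x" using M_image[of x H] by auto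
    then show "x \<in> M H ` {0<..}" by (intro image_eqI[of _ _ a]) auto
  qed (auto intro: M_pos)
  have "continuous_on {0<..} (M H)"
  proof (rule continuous_onI_mono)
    show "open (M H ` {0<..})" unfolding im by simp
    fix a b :: real assume "a \<in> {0<..}" "b \<in> {0<..}" "a \<le> b"
    then show "M H a \<le> M H b" using M_less[of a b H] by (cases "a = b") auto
  qed
  then have pos: "continuous (at a) (M H)" if "0 < a" for a
    using that by (simp add: continuous_on_eq_continuous_at)
  have at0: "continuous (at 0 within {0..}) (M H)"
    unfolding continuous_within_eps_delta
  proof (intro allI impI)
    fix e :: real assume "0 < e"
    then obtain d where d: "0 < d" "M H d = e" using M_image by blast
    have "dist (M H x) (M H 0) < e" if "x \<in> {0..}" "dist x 0 < d" for x
      using that d M_nonneg[of H x] M_less[of x d H] \<open>0 < e\<close>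
      by (cases "x = 0") (auto simp: dist_real_def)
    then show "\<exists>d>0. \<forall>x\<in>{0..}. dist x 0 < d \<longrightarrow> dist (M H x) (M H 0) < e" using d by blast
  qed
  show ?thesis unfolding continuous_on_eq_continuous_within
  proof
    fix x :: real assume "x \<in> {0..}"
    then show "continuous (at x within {0..}) (M H)"
      using at0 pos[of x] by (cases "x = 0") (auto intro: continuous_at_imp_continuous_within)
  qed
qed

end

text \<open>Chains the comparison along equidistant points of mesh below \<open>\<delta>\<close>.
  Monotonicity can thus be checked on short intervals only, where ratios of nearby values of a
  continuous function are close to 1.\<close>

lemma decreasing_of_locally_decreasing:
  fixes D :: "real \<Rightarrow> real"
  assumes "0 < \<delta>" "0 \<le> T"
    and loc: "\<And>s t. 0 \<le> s \<Longrightarrow> s \<le> t \<Longrightarrow> t \<le> T \<Longrightarrow> t - s < \<delta> \<Longrightarrow> D t \<le> D s"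
  shows "D T \<le> D 0"
proof -
  obtain n :: nat where "T / \<delta> < real n" using reals_Archimedean2 by blast
  then have n: "T / real (Suc n) < \<delta>" using assms by (simp add: field_simps)
  have "D (T * (real i / real (Suc n))) \<le> D 0" if "i \<le> Suc n" for i
    using that
  proof (induction i)
    case (Suc i)
    have "D (T * (real (Suc i) / real (Suc n))) \<le> D (T * (real i / real (Suc n)))"
    proof (rule loc)
      show "T * (real (Suc i) / real (Suc n)) \<le> T"
        using Suc.prems assms by (intro mult_left_le) auto
      show "T * (real i / real (Suc n)) \<le> T * (real (Suc i) / real (Suc n))"
        using assms by (intro mult_left_mono divide_right_mono) auto
      have "T * (real (Suc i) / real (Suc n)) - T * (real i / real (Suc n)) = T / real (Suc n)"
        by (simp add: diff_divide_distrib[symmetric] right_diff_distrib[symmetric])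
      then show "T * (real (Suc i) / real (Suc n)) - T * (real i / real (Suc n)) < \<delta>"
        using n by simp
    qed (use assms in auto)
    then show ?case using Suc by simp
  qed simp
  from this[of "Suc n"] show ?thesis by simp
qed

section \<open>The scalar integral operator and the comparison bound\<close>

locale osgood_kernel = osgood +
  fixes T :: real and h :: "real \<Rightarrow> real"
  assumes T_pos: "0 < T"
    and h_integrable: "integrable lborel h"
    and h_nonneg: "0 \<le> h s"
    and h_support: "s \<notin> {0..T} \<Longrightarrow> h s = 0"
begin

definition H :: real where "H = (LINT s|lborel. h s)"

text \<open>The integral is over a half line, which equals the integral over \<open>{0..t}\<close>
  because \<open>h\<close> vanishes off \<open>{0..T}\<close>. In this form \<open>J r\<close> is
  monotone on the whole real line, hence Borel, and constant after \<open>T\<close>.\<close>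

definition J :: "(real \<Rightarrow> real) \<Rightarrow> real \<Rightarrow> real" where
  "J r t = (LBINT s:{..t}. h s * f (r s))"

lemma f_measurable [measurable]: "f \<in> borel_measurable borel"
  by (rule borel_measurable_continuous_onI[OF cont])

lemma h_measurable [measurable]: "h \<in> borel_measurable borel"
  using borel_measurable_integrable[OF h_integrable] by simp

lemma H_nonneg: "0 \<le> H"
  unfolding H_def by (intro integral_nonneg_AE) (simp add: h_nonneg)

lemma kernel_le: "x \<le> y \<Longrightarrow> h s * f x \<le> f y * h s"
  using monoD[OF mono, of x y] h_nonneg[of s] by (simp add: mult.commute mult_right_mono)

lemma kernel_integrable:
  assumes [measurable]: "r \<in> borel_measurable borel" and "\<And>s. r s \<le> R"
  shows "integrable lborel (\<lambda>s. h s * f (r s))"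
proof (rule Bochner_Integration.integrable_bound)
  show "integrable lborel (\<lambda>s. f R * h s)" using h_integrable by simp
  show "AE s in lborel. norm (h s * f (r s)) \<le> norm (f R * h s)"
    using assms(2) nonneg h_nonneg
    by (intro AE_I2) (auto simp: abs_mult intro!: kernel_le)
qed measurable

lemma kernel_set_integrable:
  assumes "r \<in> borel_measurable borel" "\<And>s. r s \<le> R" "A \<in> sets borel"
  shows "set_integrable lborel A (\<lambda>s. h s * f (r s))"
  unfolding set_integrable_def real_scaleR_def
  using integrable_mult_indicator[OF _ kernel_integrable[OF assms(1,2)], of A] assms(3) by simp

lemma J_mono:
  assumes "r \<in> borel_measurable borel" "q \<in> borel_measurable borel"
    and "\<And>s. r s \<le> R" "\<And>s. q s \<le> R" "\<And>s. r s \<le> q s" "t \<le> u"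
  shows "J r t \<le> J q u"
  unfolding J_def set_lebesgue_integral_def
  using assms kernel_set_integrable[of r R "{..t}"] kernel_set_integrable[of q R "{..u}"]
  by (intro integral_mono) (auto simp: set_integrable_def indicator_def
      intro!: mult_left_mono monoD[OF mono] h_nonneg mult_nonneg_nonneg nonneg)

lemma J_nonneg: "0 \<le> J r t"
  unfolding J_def set_lebesgue_integral_def
  by (intro integral_nonneg_AE) (auto simp: h_nonneg nonneg)

lemma J_le:
  assumes "r \<in> borel_measurable borel" "\<And>s. r s \<le> R"
  shows "J r t \<le> f R * H"
proof -
  have "J r t \<le> (LINT s|lborel. f R * h s)"
    unfolding J_def set_lebesgue_integral_def
    using assms kernel_set_integrable[of r R "{..t}"]
    by (intro integral_mono) (auto simp: set_integrable_def indicator_def h_integrable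
        intro!: kernel_le h_nonneg mult_nonneg_nonneg nonneg)
  then show ?thesis by (simp add: H_def)
qed

lemma J_le_T:
  assumes "r \<in> borel_measurable borel" "\<And>s. r s \<le> R"
  shows "J r t \<le> J r T"
proof -
  have "J r t \<le> J r (max t T)" using assms by (intro J_mono[of r r R]) auto
  also have "J r (max t T) = J r T"
    unfolding J_def set_lebesgue_integral_def
    by (intro Bochner_Integration.integral_cong)
      (auto simp: indicator_def max_def intro: h_support)
  finally show ?thesis .
qed

lemma J_measurable:
  assumes "r \<in> borel_measurable borel" "\<And>s. r s \<le> R"
  shows "J r \<in> borel_measurable borel"
  using assms J_mono[of r r R] by (intro borel_measurable_mono monoI) auto

lemma J_limit:
  assumes [measurable]: "\<And>n. r n \<in> borel_measurable borel" "q \<in> borel_measurable borel"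
    and R: "\<And>n s. r n s \<le> R" and lim: "\<And>s. (\<lambda>n. r n s) \<longlonglongrightarrow> q s"
  shows "(\<lambda>n. J (r n) t) \<longlonglongrightarrow> J q t"
  unfolding J_def set_lebesgue_integral_def
proof (rule integral_dominated_convergence)
  show "integrable lborel (\<lambda>s. f R * h s)" using h_integrable by simp
  show "AE s in lborel. (\<lambda>n. indicator {..t} s *\<^sub>R (h s * f (r n s))) \<longlonglongrightarrow> indicator {..t} s *\<^sub>R (h s * f (q s))"
    using cont lim
    by (intro AE_I2 tendsto_intros continuous_on_tendsto_compose[OF cont]) auto
  show "AE s in lborel. norm (indicator {..t} s *\<^sub>R (h s * f (r n s))) \<le> f R * h s" for n
    using R nonneg h_nonneg
    by (intro AE_I2) (auto simp: abs_mult indicator_def intro!: kernel_le)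
qed measurable

text \<open>With \<open>w t = a + J e t\<close> and \<open>K\<close> the integral of
  \<open>h\<close>, the hypothesis says that \<open>e\<close> stays below \<open>w\<close>, so an
  increment of \<open>w\<close> is at most \<open>f (w t)\<close> times the increment of
  \<open>K\<close>. Hence \<open>G (w t) - G (w s)\<close> is at most
  \<open>f (w t) / f (w s)\<close> times that of \<open>K\<close>. Nothing is differentiated:
  uniform continuity keeps the ratio below \<open>1 + \<epsilon>\<close> on short intervals, and
  these are chained.\<close>

lemma bihari_pos:
  assumes e [measurable]: "e \<in> borel_measurable borel" and R: "\<And>s. e s \<le> R"
    and a: "0 < a" and le: "\<And>t. t \<in> {0..T} \<Longrightarrow> e t \<le> a + J e t"
  shows "G (a + J e T) \<le> G a + H"
proof -
  define p where "p s = h s * f (e s)" for s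
  define w where "w t = a + J e t" for t
  have int: "set_integrable lborel A p" if "A \<in> sets borel" for A
    unfolding p_def using kernel_set_integrable[OF e R that] .
  have hint: "h integrable_on A" "p integrable_on A" if "A \<in> sets borel" for A
    using integrable_mult_indicator[OF _ h_integrable, of A] that int[OF that]
    by (auto intro!: set_borel_integral_eq_integral(1) simp: set_integrable_def)
  have w: "w t = a + integral {0..t} p" for t
  proof -
    have "J e t = (LBINT s:{0..t}. p s)" unfolding J_def set_lebesgue_integral_def p_def
      by (intro Bochner_Integration.integral_cong) (auto simp: indicator_def intro: h_support)
    then show ?thesis
      unfolding w_def using set_borel_integral_eq_integral(2)[OF int[of "{0..t}"]] by simp
  qed
  have w_mono: "w s \<le> w t" if "s \<le> t" for s t
    unfolding w_def using J_mono[OF e e R R _ that] by simp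
  have w_pos: "a \<le> w t" for t unfolding w_def using J_nonneg by simp
  define K where "K t = integral {0..t} h" for t
  have wK: "w t - w s \<le> f (w t) * (K t - K s)" if "0 \<le> s" "s \<le> t" "t \<le> T" for s t
  proof -
    have "w t - w s = integral {s..t} p"
      using Henstock_Kurzweil_Integration.integral_combine[of 0 s t p] that hint by (simp add: w)
    also have "\<dots> \<le> integral {s..t} (\<lambda>u. f (w t) * h u)"
    proof (rule integral_le)
      fix u assume u: "u \<in> {s..t}"
      have "e u \<le> w t" using le[of u] w_mono[of u t] u that by (simp add: w_def)
      then show "p u \<le> f (w t) * h u" unfolding p_def by (rule kernel_le)
    qed (use hint(2) integrable_cmul[OF hint(1), of "{s..t}" "f (w t)"] in auto)
    also have "\<dots> = f (w t) * (K t - K s)"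
      using Henstock_Kurzweil_Integration.integral_combine[of 0 s t h] that hint
      by (simp add: K_def)
    finally show ?thesis .
  qed
  have K_mono: "K s \<le> K t" if "0 \<le> s" "s \<le> t" for s t
    unfolding K_def using that hint h_nonneg by (intro integral_subset_le) auto
  have KT: "K T = H"
  proof -
    have "H = (LBINT s:{0..T}. h s)" unfolding H_def set_lebesgue_integral_def
      by (intro Bochner_Integration.integral_cong) (auto simp: indicator_def intro: h_support)
    then show ?thesis
      unfolding K_def
      using set_borel_integral_eq_integral(2)[of "{0..T}" h]
        integrable_mult_indicator[OF _ h_integrable, of "{0..T}"] by (simp add: set_integrable_def)
  qed
  have main: "G (w T) \<le> G a + (1 + \<epsilon>) * H" if "0 < \<epsilon>" for \<epsilon>
  proof -
    have "continuous_on {0..T} w"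
      unfolding w using hint by (intro continuous_intros indefinite_integral_continuous_1) auto
    then have "continuous_on {0..T} (\<lambda>t. f (w t))"
      by (intro continuous_on_compose2[OF cont]) auto
    then have "uniformly_continuous_on {0..T} (\<lambda>t. f (w t))"
      by (intro compact_uniformly_continuous) auto
    \<comment> \<open>The tolerance is relative to \<open>f a\<close>, a lower bound for every
      \<open>f (w s)\<close>, so that an additive error becomes the factor
      \<open>1 + \<epsilon>\<close>.\<close>
    moreover have "0 < \<epsilon> * f a" using that pos[OF a] by simp
    ultimately obtain \<delta> where \<delta>: "0 < \<delta>"
      and uc: "\<And>s t. s \<in> {0..T} \<Longrightarrow> t \<in> {0..T} \<Longrightarrow> dist t s < \<delta> \<Longrightarrow> dist (f (w t)) (f (w s)) < \<epsilon> * f a"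
      unfolding uniformly_continuous_on_def by metis
    have "G (w T) - (1 + \<epsilon>) * K T \<le> G (w 0) - (1 + \<epsilon>) * K 0"
    proof (rule decreasing_of_locally_decreasing[OF \<delta>, of T "\<lambda>t. G (w t) - (1 + \<epsilon>) * K t"])
      fix s t :: real assume st: "0 \<le> s" "s \<le> t" "t \<le> T" "t - s < \<delta>"
      have fs: "f a \<le> f (w s)" "0 < f (w s)"
        using monoD[OF mono w_pos] pos[of "w s"] w_pos[of s] a by auto
      have "f (w t) \<le> f (w s) + \<epsilon> * f a"
        using uc[of s t] st by (auto simp: dist_real_def)
      also have "\<dots> \<le> (1 + \<epsilon>) * f (w s)" using fs that by (simp add: algebra_simps)
      finally have ft: "f (w t) / f (w s) \<le> 1 + \<epsilon>" using fs by (simp add: divide_le_eq)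
      have "G (w t) - G (w s) \<le> (w t - w s) / f (w s)"
        using G_diff_bounds(2)[of "w s" "w t"] w_mono st w_pos[of s] a by auto
      also have "\<dots> \<le> f (w t) * (K t - K s) / f (w s)"
        using wK[of s t] st fs by (intro divide_right_mono) auto
      also have "\<dots> = (f (w t) / f (w s)) * (K t - K s)" by simp
      also have "\<dots> \<le> (1 + \<epsilon>) * (K t - K s)"
        using ft K_mono[of s t] st by (intro mult_right_mono) auto
      finally show "G (w t) - (1 + \<epsilon>) * K t \<le> G (w s) - (1 + \<epsilon>) * K s"
        by (simp add: algebra_simps)
    qed (use T_pos in auto)
    then show ?thesis using KT by (simp add: w K_def)
  qed
  have "G (w T) \<le> G a + H"
  proof (rule field_le_epsilon)
    fix \<epsilon> :: real assume \<epsilon>: "0 < \<epsilon>"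
    have "\<epsilon> / (H + 1) * H \<le> \<epsilon>" using H_nonneg \<epsilon> by (simp add: field_simps)
    then show "G (w T) \<le> G a + H + \<epsilon>"
      using main[of "\<epsilon> / (H + 1)"] \<epsilon> H_nonneg by (simp add: algebra_simps)
  qed
  then show ?thesis by (simp add: w_def)
qed

text \<open>The case \<open>a = 0\<close> follows by applying the positive case to every
  \<open>b > 0\<close>: \<open>M H b\<close> takes every positive value, so \<open>J e T\<close> is
  at most any positive number. The bound is for the right-hand side at \<open>T\<close> rather than
  for \<open>e\<close>, since the supremum over time is later controlled by that quantity.\<close>

lemma bihari:
  assumes e: "e \<in> borel_measurable borel" and R: "\<And>s. e s \<le> R"
    and a: "0 \<le> a" and le: "\<And>t. t \<in> {0..T} \<Longrightarrow> e t \<le> a + J e t"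
  shows "a + J e T \<le> M H a"
proof -
  have pos: "b + J e T \<le> M H b" if "0 < b" "a \<le> b" for b
  proof -
    have "G (b + J e T) \<le> G (M H b)"
      unfolding G_M[OF \<open>0 < b\<close>] using le that by (intro bihari_pos[OF e R]) fastforce+
    then show ?thesis
      using G_less_iff[of "M H b" "b + J e T"] M_pos[of b H] that J_nonneg[of e T] by linarith
  qed
  show ?thesis
  proof (cases "a = 0")
    case True
    have "J e T \<le> 0"
    proof (rule field_le_epsilon)
      fix x :: real assume "0 < x"
      then obtain b where "0 < b" "M H b = x" using M_image by blast
      then show "J e T \<le> 0 + x" using pos[of b] True by simp
    qed
    then show ?thesis using True by simp
  qed (use pos[of a] a in auto)
qed


text \<open>Supplies the rate of convergence of Picard iteration. The iterates
  \<open>\<rho> n\<close> increase from 0 and are bounded by Bihari's inequality, so they converge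
  to a solution of \<open>q = A + J q\<close>. As \<open>A\<close> is nonnegative,
  \<open>J q\<close> lies below \<open>q\<close>; the iterates of \<open>J\<close> at
  \<open>q\<close> therefore decrease, and their limit solves \<open>z = J z\<close>, which Bihari's
  inequality with \<open>a = 0\<close> makes vanish at \<open>T\<close>.\<close>

lemma scalar_picard:
  assumes A: "0 \<le> A"
  obtains \<sigma> :: "nat \<Rightarrow> real \<Rightarrow> real" and R where
    "\<And>n. \<sigma> n \<in> borel_measurable borel" "\<And>n s. 0 \<le> \<sigma> n s" "\<And>n s. \<sigma> n s \<le> R"
    "\<And>t. A + J (\<sigma> 0) t \<le> \<sigma> 0 t" "\<And>n t. J (\<sigma> n) t \<le> \<sigma> (Suc n) t"
    "\<And>n t. \<sigma> n t \<le> \<sigma> n T" "(\<lambda>n. \<sigma> n T) \<longlonglongrightarrow> 0"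
proof -
  define \<rho> where "\<rho> n = ((\<lambda>r t. A + J r t) ^^ n) (\<lambda>_. 0)" for n
  have \<rho>_0: "\<rho> 0 t = 0" and \<rho>_Suc: "\<rho> (Suc n) t = A + J (\<rho> n) t" for n t
    by (simp_all add: \<rho>_def)
  have \<rho>_nonneg: "0 \<le> \<rho> n s" for n s
    using A J_nonneg by (cases n) (auto simp: \<rho>_0 \<rho>_Suc)
  have "\<rho> n \<in> borel_measurable borel \<and> (\<exists>R. \<forall>s. \<rho> n s \<le> R)" for n
  proof (induction n)
    case (Suc n)
    then obtain R where [measurable]: "\<rho> n \<in> borel_measurable borel" and R: "\<And>s. \<rho> n s \<le> R" by blast
    have [measurable]: "J (\<rho> n) \<in> borel_measurable borel" by (rule J_measurable[of _ R]) (auto simp: R)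
    have "\<rho> (Suc n) \<in> borel_measurable borel" unfolding \<rho>_Suc[abs_def] by measurable
    moreover have "\<rho> (Suc n) s \<le> A + f R * H" for s
      using J_le[of "\<rho> n" R s] R by (simp add: \<rho>_Suc)
    ultimately show ?case by blast
  qed (auto simp: \<rho>_0[abs_def])
  then have \<rho>_meas [measurable]: "\<rho> n \<in> borel_measurable borel" and \<rho>_bdd: "\<exists>R. \<forall>s. \<rho> n s \<le> R" for n
    by auto
  have \<rho>_step: "\<rho> n s \<le> \<rho> (Suc n) s" for n s
  proof (induction n arbitrary: s)
    case (Suc n)
    obtain R where "\<forall>s. \<rho> (Suc n) s \<le> R" using \<rho>_bdd by blast
    then show ?case unfolding \<rho>_Suc[of "Suc n"] \<rho>_Suc[of n s]
      using Suc.IH order_trans[OF Suc.IH] by (intro add_left_mono J_mono[of _ _ R]) auto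
  qed (simp add: \<rho>_0 \<rho>_nonneg)
  have \<rho>_le: "\<rho> n s \<le> M H A" for n s
  proof -
    obtain R where R: "\<And>s. \<rho> n s \<le> R" using \<rho>_bdd by blast
    have "\<rho> n s \<le> A + J (\<rho> n) s" using \<rho>_step[of n s] by (simp add: \<rho>_Suc)
    also have "\<dots> \<le> A + J (\<rho> n) T" using J_le_T[of "\<rho> n" R s] R by simp
    also have "\<dots> \<le> M H A"
      using \<rho>_step R by (intro bihari[of _ R] A) (auto simp: \<rho>_Suc)
    finally show ?thesis .
  qed
  define q where "q s = lim (\<lambda>n. \<rho> n s)" for s
  have \<rho>_lim: "(\<lambda>n. \<rho> n s) \<longlonglongrightarrow> q s" for s
  proof -
    have "convergent (\<lambda>n. \<rho> n s)"
      using \<rho>_le \<rho>_nonneg \<rho>_step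
      by (intro Bseq_monoseq_convergent BseqI'[of _ "M H A"] incseq_imp_monoseq incseq_SucI) auto
    then show ?thesis by (simp add: q_def convergent_LIMSEQ_iff)
  qed
  have q_meas: "q \<in> borel_measurable borel" by (rule borel_measurable_LIMSEQ_metric[OF \<rho>_meas \<rho>_lim])
  have q_nonneg: "0 \<le> q s" for s by (rule LIMSEQ_le_const[OF \<rho>_lim]) (simp add: \<rho>_nonneg)
  have q_le: "q s \<le> M H A" for s by (rule LIMSEQ_le_const2[OF \<rho>_lim]) (simp add: \<rho>_le)
  have q_eq: "q t = A + J q t" for t
  proof (rule LIMSEQ_unique)
    show "(\<lambda>n. \<rho> (Suc n) t) \<longlonglongrightarrow> q t" using \<rho>_lim by (rule LIMSEQ_Suc)
    show "(\<lambda>n. \<rho> (Suc n) t) \<longlonglongrightarrow> A + J q t"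
      unfolding \<rho>_Suc by (intro tendsto_intros J_limit[OF \<rho>_meas q_meas \<rho>_le \<rho>_lim])
  qed
  \<comment> \<open>Starting at \<open>q\<close> rather than at a constant keeps
    \<open>\<sigma> 0\<close> a majorant including the inhomogeneous term \<open>A\<close>, which
    later absorbs the first Picard step.\<close>
  define \<sigma> where "\<sigma> n = (J ^^ n) q" for n
  have \<sigma>_0: "\<sigma> 0 t = q t" and \<sigma>_Suc: "\<sigma> (Suc n) t = J (\<sigma> n) t" for n t
    by (simp_all add: \<sigma>_def)
  have \<sigma>_meas_le: "\<sigma> n \<in> borel_measurable borel \<and> (\<forall>s. \<sigma> (Suc n) s \<le> \<sigma> n s \<and> \<sigma> n s \<le> M H A)" for n
  proof (induction n)
    case 0
    have "J q s \<le> q s" for s using q_eq[of s] A by linarith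
    then show ?case using q_meas q_le by (simp add: \<sigma>_def)
  next
    case (Suc n)
    then have Suc': "\<sigma> n \<in> borel_measurable borel" "\<And>s. \<sigma> (Suc n) s \<le> \<sigma> n s" "\<And>s. \<sigma> n s \<le> M H A"
      by auto
    have m: "\<sigma> (Suc n) \<in> borel_measurable borel"
      unfolding \<sigma>_Suc[abs_def] using Suc' by (intro J_measurable[of _ "M H A"]) auto
    have le: "\<sigma> (Suc n) s \<le> M H A" for s using Suc'(2,3)[of s] by linarith
    have "\<sigma> (Suc (Suc n)) s \<le> \<sigma> (Suc n) s" for s
      unfolding \<sigma>_Suc[of "Suc n"] \<sigma>_Suc[of n s]
      using m le Suc' by (intro J_mono[of _ _ "M H A"]) auto
    then show ?case using m le by blast
  qed
  then have \<sigma>_meas: "\<sigma> n \<in> borel_measurable borel" and \<sigma>_step: "\<sigma> (Suc n) s \<le> \<sigma> n s"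
    and \<sigma>_le: "\<sigma> n s \<le> M H A" for n s by auto
  have \<sigma>_nonneg: "0 \<le> \<sigma> n s" for n s
    using q_nonneg J_nonneg by (cases n) (auto simp: \<sigma>_0 \<sigma>_Suc)
  define z where "z s = lim (\<lambda>n. \<sigma> n s)" for s
  have \<sigma>_lim: "(\<lambda>n. \<sigma> n s) \<longlonglongrightarrow> z s" for s
  proof -
    have "convergent (\<lambda>n. \<sigma> n s)"
      using \<sigma>_le \<sigma>_nonneg \<sigma>_step
      by (intro Bseq_monoseq_convergent BseqI'[of _ "M H A"] decseq_imp_monoseq decseq_SucI) auto
    then show ?thesis by (simp add: z_def convergent_LIMSEQ_iff)
  qed
  have z_meas: "z \<in> borel_measurable borel" by (rule borel_measurable_LIMSEQ_metric[OF \<sigma>_meas \<sigma>_lim])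
  have z_le: "z s \<le> M H A" for s
    by (rule LIMSEQ_le_const2[OF \<sigma>_lim]) (simp add: \<sigma>_le)
  have z_eq: "z t = J z t" for t
  proof (rule LIMSEQ_unique)
    show "(\<lambda>n. \<sigma> (Suc n) t) \<longlonglongrightarrow> z t" using \<sigma>_lim by (rule LIMSEQ_Suc)
    show "(\<lambda>n. \<sigma> (Suc n) t) \<longlonglongrightarrow> J z t"
      unfolding \<sigma>_Suc by (intro J_limit[OF \<sigma>_meas z_meas \<sigma>_le \<sigma>_lim])
  qed
  have "0 + J z T \<le> M H 0"
    by (rule bihari[OF z_meas z_le]) (simp_all add: z_eq[symmetric])
  then have "z T = 0" using z_eq[of T] J_nonneg[of z T] by simp
  show thesis
  proof (rule that[of \<sigma> "M H A"])
    show "A + J (\<sigma> 0) t \<le> \<sigma> 0 t" for t using q_eq[of t] by (simp add: \<sigma>_def)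
    show "(\<lambda>n. \<sigma> n T) \<longlonglongrightarrow> 0" using \<sigma>_lim[of T] \<open>z T = 0\<close> by simp
    show "\<sigma> n t \<le> \<sigma> n T" for n t
    proof (cases n)
      case 0
      have "q t \<le> q T" unfolding q_eq[of t] q_eq[of T] using J_le_T[OF q_meas q_le] by simp
      then show ?thesis using 0 by (simp add: \<sigma>_0)
    qed (use J_le_T[OF \<sigma>_meas \<sigma>_le] in \<open>simp add: \<sigma>_Suc\<close>)
  qed (auto simp: \<sigma>_meas \<sigma>_nonneg \<sigma>_le \<sigma>_Suc)
qed

end

section \<open>Measurability on path space\<close>

lemma path_borel_to_borel: "X \<in> W \<rightarrow>\<^sub>M path_borel T \<Longrightarrow> X \<in> W \<rightarrow>\<^sub>M borel"
  by (simp add: path_borel_def measurable_restrict_space2_iff)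

lemma space_path_borel: "space (path_borel T) = C_paths T"
  by (simp add: path_borel_def space_restrict_space)

lemma path_borel_measurableI:
  "X \<in> W \<rightarrow>\<^sub>M borel \<Longrightarrow> (\<And>x. x \<in> space W \<Longrightarrow> X x \<in> C_paths T) \<Longrightarrow> X \<in> W \<rightarrow>\<^sub>M path_borel T"
  by (auto simp: path_borel_def measurable_restrict_space2_iff)

text \<open>
  Evaluation is jointly continuous, but the product \<open>\<sigma>\<close>-algebra on the nonseparable space of bounded
  continuous functions may be too small for that; discretising the time argument avoids the issue.
\<close>

lemma joint_evaluation_measurable:
  "(\<lambda>z. apply_bcontfun (snd z) (fst z)) \<in> borel_measurable (borel \<Otimes>\<^sub>M (borel :: ('d::finite) path measure))"
proof (rule borel_measurable_LIMSEQ_metric)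
  fix n :: nat
  have ev: "(\<lambda>w :: 'd path. apply_bcontfun w t) \<in> borel_measurable borel" for t
  proof (rule borel_measurable_continuous_onI)
    have "1-lipschitz_on UNIV (\<lambda>w :: 'd path. apply_bcontfun w t)"
      by (rule lipschitz_onI) (simp_all add: dist_bounded)
    then show "continuous_on UNIV (\<lambda>w :: 'd path. apply_bcontfun w t)"
      by (rule lipschitz_on_continuous_on)
  qed
  show "(\<lambda>z. apply_bcontfun (snd z) (of_int \<lceil>real (Suc n) * fst z\<rceil> / real (Suc n)))
      \<in> borel_measurable (borel \<Otimes>\<^sub>M (borel :: 'd path measure))"
    by (rule measurable_compose_countable[of "\<lambda>i z. apply_bcontfun (snd z) (of_int i / real (Suc n))"])
      (use ev in measurable)
next
  fix z :: "real \<times> 'd path"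
  have "(\<lambda>n. of_int \<lceil>real (Suc n) * fst z\<rceil> / real (Suc n)) \<longlonglongrightarrow> fst z"
  proof (rule tendsto_sandwich[OF always_eventually always_eventually])
    show "\<forall>n. fst z \<le> of_int \<lceil>real (Suc n) * fst z\<rceil> / real (Suc n)"
      by (auto simp del: of_nat_Suc simp: pos_le_divide_eq mult.commute)
    have "of_int \<lceil>real (Suc n) * fst z\<rceil> / real (Suc n) \<le> (real (Suc n) * fst z + 1) / real (Suc n)" for n
      by (intro divide_right_mono of_int_ceiling_le_add_one) auto
    also have "(real (Suc n) * fst z + 1) / real (Suc n) = fst z + inverse (real (Suc n))" for n
      by (simp add: field_simps)
    finally show "\<forall>n. of_int \<lceil>real (Suc n) * fst z\<rceil> / real (Suc n) \<le> fst z + inverse (real (Suc n))"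
      by blast
    show "(\<lambda>n. fst z + inverse (real (Suc n))) \<longlonglongrightarrow> fst z"
      using tendsto_add[OF tendsto_const LIMSEQ_inverse_real_of_nat, of "fst z"] by simp
  qed simp
  then show "(\<lambda>n. apply_bcontfun (snd z) (of_int \<lceil>real (Suc n) * fst z\<rceil> / real (Suc n)))
      \<longlonglongrightarrow> apply_bcontfun (snd z) (fst z)"
    by (intro continuous_on_tendsto_compose[OF continuous_on_apply_bcontfun[of UNIV]]) auto
qed

lemma evaluation_measurable:
  fixes X :: "'w \<Rightarrow> ('d::finite) path"
  assumes "X \<in> W \<rightarrow>\<^sub>M path_borel T" and "S \<in> borel_measurable W"
  shows "(\<lambda>x. apply_bcontfun (X x) (S x)) \<in> borel_measurable W"
proof -
  have "(\<lambda>x. (S x, X x)) \<in> W \<rightarrow>\<^sub>M borel \<Otimes>\<^sub>M borel"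
    using assms path_borel_to_borel by measurable
  from measurable_compose[OF this joint_evaluation_measurable] show ?thesis by simp
qed

text \<open>On a nonseparable space \<open>dist\<close> need not be measurable for the product of
  the Borel sets. By continuity the supremum over all times is a supremum over rational times, which
  turns the event into a countable union of events on evaluations.\<close>

lemma path_dist_measurable:
  fixes X Y :: "'w \<Rightarrow> ('d::finite) path"
  assumes "X \<in> W \<rightarrow>\<^sub>M path_borel T" and "Y \<in> W \<rightarrow>\<^sub>M path_borel T"
  shows "(\<lambda>x. dist (X x) (Y x)) \<in> borel_measurable W"
proof (subst borel_measurable_iff_greater, intro allI)
  fix a :: real
  have ex: "\<exists>q::rat. a < dist (apply_bcontfun u (of_rat q)) (apply_bcontfun v (of_rat q))"
    if "a < dist u v" for u v :: "'d path"
  proof (rule ccontr)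
    assume "\<not> ?thesis"
    then have le: "dist (apply_bcontfun u (of_rat q)) (apply_bcontfun v (of_rat q)) \<le> a" for q :: rat
      by (simp add: not_less)
    have "dist u v \<le> a"
    proof (rule dist_bound)
      fix t :: real
      have "closed {t. dist (apply_bcontfun u t) (apply_bcontfun v t) \<le> a}"
        by (intro closed_Collect_le continuous_intros continuous_on_apply_bcontfun)
      moreover have "\<rat> \<subseteq> {t. dist (apply_bcontfun u t) (apply_bcontfun v t) \<le> a}"
        using le by (auto simp: Rats_def)
      ultimately have "closure \<rat> \<subseteq> {t. dist (apply_bcontfun u t) (apply_bcontfun v t) \<le> a}"
        by (intro closure_minimal)
      then show "dist (apply_bcontfun u t) (apply_bcontfun v t) \<le> a"
        using Rats_closure_real by auto
    qed
    then show False using that by simp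
  qed
  have "{x \<in> space W. a < dist (X x) (Y x)} =
      (\<Union>q::rat. {x \<in> space W. a < dist (apply_bcontfun (X x) (of_rat q)) (apply_bcontfun (Y x) (of_rat q))})"
    using ex dist_bounded by (fastforce intro: order_less_le_trans)
  also have "\<dots> \<in> sets W"
    using evaluation_measurable[OF assms(1), of "\<lambda>_. of_rat _"] evaluation_measurable[OF assms(2), of "\<lambda>_. of_rat _"]
    by (intro sets.countable_UN'' borel_measurable_less) auto
  finally show "{x \<in> space W. a < dist (X x) (Y x)} \<in> sets W" .
qed

section \<open>Paths determined by their values on the time interval\<close>

lemma clamp_Icc: "0 \<le> T \<Longrightarrow> clamp 0 T t \<in> {0..T::real}"
  using clamp_in_interval[of 0 T t] by simp

lemma clamp_id: "t \<in> {0..T::real} \<Longrightarrow> clamp 0 T t = t"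
  using clamp_cancel_cbox[of t 0 T] by simp

lemma C_paths_clamp: "w \<in> C_paths T \<Longrightarrow> apply_bcontfun w (clamp 0 T t) = apply_bcontfun w t"
  unfolding C_paths_def by (metis (mono_tags) mem_Collect_eq)

lemma C_paths_dist_bound:
  assumes "0 \<le> T" "u \<in> C_paths T" "v \<in> C_paths T"
    and "\<And>t. t \<in> {0..T} \<Longrightarrow> dist (apply_bcontfun u t) (apply_bcontfun v t) \<le> b"
  shows "dist u v \<le> b"
  using assms(4)[OF clamp_Icc[OF assms(1)]]
  by (intro dist_bound) (simp add: C_paths_clamp[OF assms(2)] C_paths_clamp[OF assms(3)])

lemma C_paths_eqI:
  assumes "0 \<le> T" "u \<in> C_paths T" "v \<in> C_paths T"
    and "\<And>t. t \<in> {0..T} \<Longrightarrow> apply_bcontfun u t = apply_bcontfun v t"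
  shows "u = v"
  using C_paths_dist_bound[OF assms(1-3), of 0] assms(4) by simp

lemma C_paths_limit:
  assumes "u \<longlonglongrightarrow> v" "\<And>n. u n \<in> C_paths T"
  shows "v \<in> C_paths T"
  unfolding C_paths_def
proof (intro CollectI allI)
  fix t
  have lim: "(\<lambda>n. apply_bcontfun (u n) s) \<longlonglongrightarrow> apply_bcontfun v s" for s
    using tendsto_bcontfun_uniform_limit[OF assms(1)] by (rule tendsto_uniform_limitI) simp
  show "apply_bcontfun v t = apply_bcontfun v (clamp 0 T t)"
    using lim[of t] lim[of "clamp 0 T t"] unfolding C_paths_clamp[OF assms(2)]
    by (rule LIMSEQ_unique)
qed

text \<open>Meaningful when \<open>g\<close> is continuous on \<open>{0..T}\<close>; constancy
  outside the interval then makes the chosen path unique.\<close>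

definition path_of :: "real \<Rightarrow> (real \<Rightarrow> real^'d) \<Rightarrow> ('d::finite) path" where
  "path_of T g = (SOME w. w \<in> C_paths T \<and> (\<forall>t\<in>{0..T}. apply_bcontfun w t = g t))"

lemma path_of:
  assumes "0 \<le> T" "continuous_on {0..T} g"
  shows "path_of T g \<in> C_paths T" and "\<And>t. t \<in> {0..T} \<Longrightarrow> apply_bcontfun (path_of T g) t = g t"
proof -
  obtain w :: "'a path" where w: "\<And>t. apply_bcontfun w t = g (clamp 0 T t)"
    using continuous_on_cbox_bcontfunE[of 0 T g] assms(2) by auto
  have "w \<in> C_paths T \<and> (\<forall>t\<in>{0..T}. apply_bcontfun w t = g t)"
    using clamp_Icc[OF assms(1)] by (auto simp: C_paths_def w clamp_id)
  then have "path_of T g \<in> C_paths T \<and> (\<forall>t\<in>{0..T}. apply_bcontfun (path_of T g) t = g t)"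
    unfolding path_of_def by (rule someI)
  then show "path_of T g \<in> C_paths T" and "\<And>t. t \<in> {0..T} \<Longrightarrow> apply_bcontfun (path_of T g) t = g t"
    by auto
qed

section \<open>Couplings and flows of marginals\<close>

text \<open>Two random variables on one space are a coupling of their laws. Measurability of the
  distance is an explicit hypothesis because on path space it has to come from
  \<open>path_dist_measurable\<close>.\<close>

lemma wasserstein1_le:
  assumes U [measurable]: "U \<in> W \<rightarrow>\<^sub>M N" and V [measurable]: "V \<in> W \<rightarrow>\<^sub>M N"
    and d [measurable]: "(\<lambda>z. dist (fst z) (snd z)) \<in> borel_measurable (N \<Otimes>\<^sub>M N)"
  shows "wasserstein1 (distr W N U) (distr W N V) \<le> (\<integral>\<^sup>+ x. ennreal (dist (U x) (V x)) \<partial>W)"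
proof -
  define \<pi> where "\<pi> = distr W (N \<Otimes>\<^sub>M N) (\<lambda>x. (U x, V x))"
  have s: "sets (distr W N U \<Otimes>\<^sub>M distr W N V) = sets (N \<Otimes>\<^sub>M N)"
    by (intro sets_pair_measure_cong) auto
  have "distr \<pi> (distr W N U) fst = distr W N U" "distr \<pi> (distr W N V) snd = distr W N V"
  proof -
    have "distr \<pi> (distr W N U) fst = distr \<pi> N fst" "distr \<pi> (distr W N V) snd = distr \<pi> N snd"
      by (rule distr_cong; simp)+
    then show "distr \<pi> (distr W N U) fst = distr W N U" "distr \<pi> (distr W N V) snd = distr W N V"
      unfolding \<pi>_def by (simp_all add: distr_distr comp_def)
  qed
  then have "\<pi> \<in> couplings (distr W N U) (distr W N V)"
    using s by (simp add: couplings_def \<pi>_def)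
  then have "wasserstein1 (distr W N U) (distr W N V) \<le> (\<integral>\<^sup>+ z. ennreal (dist (fst z) (snd z)) \<partial>\<pi>)"
    unfolding wasserstein1_def by (rule INF_lower)
  also have "\<dots> = (\<integral>\<^sup>+ x. ennreal (dist (U x) (V x)) \<partial>W)"
    unfolding \<pi>_def by (subst nn_integral_distr) auto
  finally show ?thesis .
qed

text \<open>The two times may differ: with one process this yields continuity of its marginals in
  time, with one time it compares two processes.\<close>

lemma d1_law_le:
  fixes X Y :: "'w \<Rightarrow> ('d::finite) path"
  assumes X: "X \<in> W \<rightarrow>\<^sub>M path_borel T" and Y: "Y \<in> W \<rightarrow>\<^sub>M path_borel T" and e: "0 \<le> e"
    and le: "(\<integral>\<^sup>+ \<omega>. ennreal (dist (apply_bcontfun (X \<omega>) s) (apply_bcontfun (Y \<omega>) t)) \<partial>W) \<le> ennreal e"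
  shows "d1 (law_at W X s) (law_at W Y t) \<le> e"
proof -
  have "wasserstein1 (law_at W X s) (law_at W Y t) \<le> ennreal e"
    unfolding law_at_def
    using wasserstein1_le[of "\<lambda>\<omega>. apply_bcontfun (X \<omega>) s" W borel "\<lambda>\<omega>. apply_bcontfun (Y \<omega>) t"]
      evaluation_measurable[OF X, of "\<lambda>_. s"] evaluation_measurable[OF Y, of "\<lambda>_. t"] le
    by (auto intro: order_trans)
  then show ?thesis unfolding d1_def by (rule enn2real_leI[OF e])
qed

lemma d1_refl:
  assumes "\<mu> \<in> P1 (UNIV :: (real^'d::finite) set)" shows "d1 \<mu> \<mu> = 0"
proof -
  have s: "sets \<mu> = sets borel" using assms by (simp add: P1_def)
  then have "distr \<mu> borel (\<lambda>x. x) = \<mu>" by (intro distr_id2) simp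
  then have "wasserstein1 \<mu> \<mu> \<le> 0"
    using wasserstein1_le[of "\<lambda>x. x" \<mu> borel "\<lambda>x. x"] s by simp
  then show ?thesis by (simp add: d1_def)
qed

text \<open>Integrability of the supremum norm, not merely of each marginal: it is the dominating
  function that makes the marginals continuous in time.\<close>

definition integrable_path :: "real \<Rightarrow> 'w measure \<Rightarrow> ('w \<Rightarrow> ('d::finite) path) \<Rightarrow> bool" where
  "integrable_path T W X \<longleftrightarrow> prob_space W \<and> X \<in> W \<rightarrow>\<^sub>M path_borel T \<and>
     (\<integral>\<^sup>+ \<omega>. ennreal (norm (X \<omega>)) \<partial>W) < \<infinity>"

definition mean_norm :: "'w measure \<Rightarrow> ('w \<Rightarrow> ('d::finite) path) \<Rightarrow> real" where
  "mean_norm W X = enn2real (\<integral>\<^sup>+ \<omega>. ennreal (norm (X \<omega>)) \<partial>W)"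

text \<open>Measurability allows a drift to be composed with the flow, and the uniform moment bound
  makes the result integrable in time. The flow lives on the whole real line, as paths do.\<close>

definition P1_flow :: "(real \<Rightarrow> (real^('d::finite)) measure) \<Rightarrow> real \<Rightarrow> bool" where
  "P1_flow \<mu> C \<longleftrightarrow> \<mu> \<in> borel \<rightarrow>\<^sub>M P1_borel UNIV \<and> (\<forall>t. enn2real (moment1 (\<mu> t)) \<le> C)"

lemma space_P1_borel: "space (P1_borel E) = P1 E"
  unfolding P1_borel_def by (rule space_measure_of) auto

lemma P1_flow_P1: "P1_flow \<mu> C \<Longrightarrow> \<mu> t \<in> P1 UNIV"
  unfolding P1_flow_def using measurable_space[of \<mu> borel "P1_borel UNIV" t]
  by (auto simp: space_P1_borel)

lemma moment1_law_at:
  assumes "X \<in> W \<rightarrow>\<^sub>M path_borel T"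
  shows "moment1 (law_at W X t) = (\<integral>\<^sup>+ \<omega>. ennreal (norm (apply_bcontfun (X \<omega>) t)) \<partial>W)"
  unfolding moment1_def law_at_def
  using evaluation_measurable[OF assms, of "\<lambda>_. t"] by (subst nn_integral_distr) auto

lemma moment1_law_at_le:
  assumes "X \<in> W \<rightarrow>\<^sub>M path_borel T"
  shows "moment1 (law_at W X t) \<le> (\<integral>\<^sup>+ \<omega>. ennreal (norm (X \<omega>)) \<partial>W)"
  unfolding moment1_law_at[OF assms] by (intro nn_integral_mono ennreal_leI norm_bounded)

lemma law_at_P1:
  assumes "integrable_path T W X" shows "law_at W X t \<in> P1 UNIV"
proof -
  interpret prob_space W using assms by (simp add: integrable_path_def)
  have X: "X \<in> W \<rightarrow>\<^sub>M path_borel T" using assms by (simp add: integrable_path_def)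
  have "moment1 (law_at W X t) < \<infinity>"
    using moment1_law_at_le[OF X, of t] assms by (auto simp: integrable_path_def)
  moreover have "prob_space (law_at W X t)"
    unfolding law_at_def using evaluation_measurable[OF X, of "\<lambda>_. t"] by (intro prob_space_distr) auto
  ultimately show ?thesis by (simp add: P1_def law_at_def sets_restrict_space)
qed

text \<open>Pairing the process with itself at two times bounds \<open>d1\<close> of the marginals
  by the mean displacement, which tends to 0 by dominated convergence with bound twice the norm of
  the path. So the marginals are \<open>d1\<close>-continuous in time, and preimages of the open
  generators of \<open>P1_borel\<close> are open.\<close>

lemma law_at_flow:
  assumes X: "integrable_path T W X"
  shows "P1_flow (law_at W X) (mean_norm W X)"
  unfolding P1_flow_def
proof (intro conjI allI)
  have Xm: "X \<in> W \<rightarrow>\<^sub>M path_borel T" and fin: "(\<integral>\<^sup>+ \<omega>. ennreal (norm (X \<omega>)) \<partial>W) < \<infinity>"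
    using X by (auto simp: integrable_path_def)
  note [measurable] = path_borel_to_borel[OF Xm] evaluation_measurable[OF Xm]
  show "enn2real (moment1 (law_at W X t)) \<le> mean_norm W X" for t
    unfolding mean_norm_def using moment1_law_at_le[OF Xm] fin by (intro enn2real_mono) auto
  show "law_at W X \<in> borel \<rightarrow>\<^sub>M P1_borel UNIV"
    unfolding P1_borel_def
  proof (rule measurable_measure_of)
    fix U :: "(real^'b) measure set"
    assume "U \<in> {U. U \<subseteq> P1 UNIV \<and> (\<forall>\<mu>\<in>U. \<exists>e>0. \<forall>\<nu>\<in>P1 UNIV. d1 \<mu> \<nu> < e \<longrightarrow> \<nu> \<in> U)}"
    then have U: "\<And>\<mu>. \<mu> \<in> U \<Longrightarrow> \<exists>e>0. \<forall>\<nu>\<in>P1 UNIV. d1 \<mu> \<nu> < e \<longrightarrow> \<nu> \<in> U" by blast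
    have "closed (- (law_at W X -` U))"
      unfolding closed_sequential_limits
    proof (intro allI impI, elim conjE, rule ccontr)
      fix s t assume s: "\<forall>n. s n \<in> - (law_at W X -` U)" and lim: "s \<longlonglongrightarrow> t"
        and "t \<notin> - (law_at W X -` U)"
      then obtain e where e: "0 < e" "\<And>\<nu>. \<nu> \<in> P1 UNIV \<Longrightarrow> d1 (law_at W X t) \<nu> < e \<Longrightarrow> \<nu> \<in> U"
        using U[of "law_at W X t"] by auto
      have "(\<lambda>n. \<integral>\<^sup>+ \<omega>. ennreal (dist (apply_bcontfun (X \<omega>) t) (apply_bcontfun (X \<omega>) (s n))) \<partial>W)
          \<longlonglongrightarrow> (\<integral>\<^sup>+ \<omega>. 0 \<partial>W)"
      proof (rule nn_integral_dominated_convergence[where w = "\<lambda>\<omega>. 2 * ennreal (norm (X \<omega>))"])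
        show "AE \<omega> in W. ennreal (dist (apply_bcontfun (X \<omega>) t) (apply_bcontfun (X \<omega>) (s n)))
            \<le> 2 * ennreal (norm (X \<omega>))" for n
        proof (rule AE_I2)
          fix \<omega>
          have "dist (apply_bcontfun (X \<omega>) t) (apply_bcontfun (X \<omega>) (s n)) \<le> 2 * norm (X \<omega>)"
            using norm_triangle_ineq4[of "apply_bcontfun (X \<omega>) t" "apply_bcontfun (X \<omega>) (s n)"]
              norm_bounded[of "X \<omega>" t] norm_bounded[of "X \<omega>" "s n"] by (simp add: dist_norm)
          then show "ennreal (dist (apply_bcontfun (X \<omega>) t) (apply_bcontfun (X \<omega>) (s n)))
            \<le> 2 * ennreal (norm (X \<omega>))"
            by (metis ennreal_leI ennreal_mult' ennreal_numeral zero_le_numeral)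
        qed
        show "(\<integral>\<^sup>+ \<omega>. 2 * ennreal (norm (X \<omega>)) \<partial>W) < \<infinity>"
          using fin by (subst nn_integral_cmult) (auto simp: ennreal_mult_less_top)
        show "AE \<omega> in W. (\<lambda>n. ennreal (dist (apply_bcontfun (X \<omega>) t) (apply_bcontfun (X \<omega>) (s n)))) \<longlonglongrightarrow> 0"
        proof (rule AE_I2)
          fix \<omega>
          have "(\<lambda>n. dist (apply_bcontfun (X \<omega>) t) (apply_bcontfun (X \<omega>) (s n)))
              \<longlonglongrightarrow> dist (apply_bcontfun (X \<omega>) t) (apply_bcontfun (X \<omega>) t)"
            by (intro tendsto_intros continuous_on_tendsto_compose[OF continuous_on_apply_bcontfun[of UNIV] lim]) auto
          then show "(\<lambda>n. ennreal (dist (apply_bcontfun (X \<omega>) t) (apply_bcontfun (X \<omega>) (s n)))) \<longlonglongrightarrow> 0"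
            by (simp add: tendsto_ennreal_iff[where x=0, simplified])
        qed
      qed auto
      then have "\<forall>\<^sub>F n in sequentially.
          (\<integral>\<^sup>+ \<omega>. ennreal (dist (apply_bcontfun (X \<omega>) t) (apply_bcontfun (X \<omega>) (s n))) \<partial>W) < ennreal (e / 2)"
        using e(1) by (intro order_tendstoD(2)) auto
      then obtain n where
        "(\<integral>\<^sup>+ \<omega>. ennreal (dist (apply_bcontfun (X \<omega>) t) (apply_bcontfun (X \<omega>) (s n))) \<partial>W) < ennreal (e / 2)"
        by (auto simp: eventually_sequentially)
      then have "d1 (law_at W X t) (law_at W X (s n)) \<le> e / 2"
        using e(1) by (intro d1_law_le[OF Xm Xm]) auto
      then have "d1 (law_at W X t) (law_at W X (s n)) < e" using e(1) by linarith
      then show False using e(2) s law_at_P1[OF X, of "s n"] by auto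
    qed
    then have "open (law_at W X -` U)" by (simp add: open_closed)
    then show "law_at W X -` U \<inter> space borel \<in> sets borel" by simp
  qed (use law_at_P1[OF X] in auto)
qed

lemma P1_path_integrable:
  assumes "\<mu>Y \<in> P1 (C_paths T)" "Y \<in> path_borel T \<rightarrow>\<^sub>M path_borel T"
    and "\<And>y. y \<in> C_paths T \<Longrightarrow> norm (Y y) \<le> C * (1 + norm y)" "0 \<le> C"
  shows "integrable_path T \<mu>Y Y"
  unfolding integrable_path_def
proof (intro conjI)
  have s: "sets \<mu>Y = sets (path_borel T)" using assms by (simp add: P1_def path_borel_def)
  then have sp: "space \<mu>Y = C_paths T" using sets_eq_imp_space_eq[OF s] by (simp add: space_path_borel)
  show "prob_space \<mu>Y" using assms by (simp add: P1_def)
  interpret prob_space \<mu>Y by fact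
  show "Y \<in> \<mu>Y \<rightarrow>\<^sub>M path_borel T" using assms(2) s measurable_cong_sets by blast
  have [measurable]: "(\<lambda>y. y) \<in> \<mu>Y \<rightarrow>\<^sub>M borel"
    by (rule path_borel_to_borel[of _ _ T]) (simp add: s measurable_ident_sets)
  have "(\<integral>\<^sup>+ y. ennreal (norm (Y y)) \<partial>\<mu>Y) \<le> (\<integral>\<^sup>+ y. ennreal C * (1 + ennreal (norm y)) \<partial>\<mu>Y)"
    using assms(3,4) sp
    by (intro nn_integral_mono) (auto simp flip: ennreal_mult ennreal_1 ennreal_plus intro!: ennreal_leI)
  also have "\<dots> = ennreal C * (1 + moment1 \<mu>Y)"
    by (simp add: nn_integral_cmult nn_integral_add moment1_def emeasure_space_1)
  also have "\<dots> < \<infinity>" using assms(1) by (simp add: P1_def ennreal_mult_less_top)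
  finally show "(\<integral>\<^sup>+ y. ennreal (norm (Y y)) \<partial>\<mu>Y) < \<infinity>" .
qed

section \<open>Drifts along a flow of measures\<close>

text \<open>Along a flow of measures the drift is only ever integrated in time, so null sets of times are ignored.\<close>

context osgood_kernel
begin

definition growth_rate :: "('d::finite) drift \<Rightarrow> (real \<Rightarrow> real) \<Rightarrow> bool" where
  "growth_rate B k \<longleftrightarrow> integrable lborel k \<and> (\<forall>s. 0 \<le> k s) \<and>
     (AE s in lborel. s \<in> {0..T} \<longrightarrow>
        (\<forall>x. \<forall>\<mu>\<in>P1 UNIV. norm (B s x \<mu>) \<le> k s * (1 + norm x + enn2real (moment1 \<mu>))))"

definition regular_drift :: "('d::finite) drift \<Rightarrow> bool" where
  "regular_drift B \<longleftrightarrow> drift_measurable T B \<and> (\<exists>k. growth_rate B k) \<and>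
     (AE s in lborel. s \<in> {0..T} \<longrightarrow>
        (\<forall>x y. \<forall>\<mu>\<in>P1 UNIV. \<forall>\<nu>\<in>P1 UNIV.
           norm (B s x \<mu> - B s y \<nu>) \<le> h s * f (norm (x - y) + d1 \<mu> \<nu>)))"

lemma drift_flow_measurable:
  fixes w :: "('d::finite) path"
  assumes B: "drift_measurable T B" and \<mu>: "P1_flow \<mu> C"
  shows "(\<lambda>s. B s (apply_bcontfun w s) (\<mu> s)) \<in> borel_measurable (restrict_space borel {0..T})"
proof -
  have "\<mu> \<in> restrict_space borel {0..T} \<rightarrow>\<^sub>M P1_borel UNIV"
    using \<mu> by (auto simp: P1_flow_def intro: measurable_restrict_space1)
  moreover have "apply_bcontfun w \<in> borel_measurable (restrict_space borel {0..T})"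
    by (intro measurable_restrict_space1 borel_measurable_continuous_onI continuous_on_apply_bcontfun)
  ultimately have "(\<lambda>s. (s, apply_bcontfun w s, \<mu> s))
      \<in> restrict_space borel {0..T} \<rightarrow>\<^sub>M restrict_space borel {0..T} \<Otimes>\<^sub>M borel \<Otimes>\<^sub>M P1_borel UNIV"
    by measurable
  from measurable_compose[OF this B[unfolded drift_measurable_def]] show ?thesis by simp
qed

lemma drift_flow_bound:
  fixes w :: "('d::finite) path"
  assumes k: "growth_rate B k" and \<mu>: "P1_flow \<mu> C"
  shows "AE s in lborel. s \<in> {0..T} \<longrightarrow>
    norm (B s (apply_bcontfun w s) (\<mu> s)) \<le> k s * (1 + norm w + C)"
  using k[unfolded growth_rate_def, THEN conjunct2, THEN conjunct2]
proof eventually_elim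
  case (elim s)
  show ?case
  proof
    assume s: "s \<in> {0..T}"
    have "norm (B s (apply_bcontfun w s) (\<mu> s))
        \<le> k s * (1 + norm (apply_bcontfun w s) + enn2real (moment1 (\<mu> s)))"
      using elim s P1_flow_P1[OF \<mu>] by blast
    also have "\<dots> \<le> k s * (1 + norm w + C)"
      using k \<mu> norm_bounded[of w s] unfolding growth_rate_def P1_flow_def
      by (intro mult_left_mono add_mono) auto
    finally show "norm (B s (apply_bcontfun w s) (\<mu> s)) \<le> k s * (1 + norm w + C)" .
  qed
qed

lemma drift_flow_integrable:
  fixes w :: "('d::finite) path"
  assumes B: "regular_drift B" and \<mu>: "P1_flow \<mu> C" and A: "A \<in> sets borel" "A \<subseteq> {0..T}"
  shows "set_integrable lborel A (\<lambda>s. B s (apply_bcontfun w s) (\<mu> s))"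
proof -
  obtain k where k: "growth_rate B k" using B by (auto simp: regular_drift_def)
  have int: "set_integrable lborel {0..T} (\<lambda>s. B s (apply_bcontfun w s) (\<mu> s))"
    unfolding set_integrable_def
  proof (rule Bochner_Integration.integrable_bound)
    show "integrable lborel (\<lambda>s. k s * (1 + norm w + C))"
      using k by (simp add: growth_rate_def)
    show "(\<lambda>s. indicator {0..T} s *\<^sub>R B s (apply_bcontfun w s) (\<mu> s)) \<in> borel_measurable lborel"
      using drift_flow_measurable[OF _ \<mu>, of B w] B
      by (simp add: regular_drift_def borel_measurable_restrict_space_iff)
    have "0 \<le> C" using \<mu> by (auto simp: P1_flow_def intro: order_trans[OF enn2real_nonneg])
    then have *: "0 \<le> k s * (1 + norm w + C)" for s
      using k by (auto simp: growth_rate_def intro!: mult_nonneg_nonneg)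
    show "AE s in lborel. norm (indicator {0..T} s *\<^sub>R B s (apply_bcontfun w s) (\<mu> s))
        \<le> norm (k s * (1 + norm w + C))"
      using drift_flow_bound[OF k \<mu>, of w]
      by eventually_elim (use * in \<open>auto simp: indicator_def abs_of_nonneg simp del: abs_mult\<close>)
  qed
  show ?thesis by (rule set_integrable_subset[OF int]) (use A in auto)
qed

lemma drift_flow_integral_le:
  fixes w :: "('d::finite) path"
  assumes B: "regular_drift B" and k: "growth_rate B k" and \<mu>: "P1_flow \<mu> C" and t: "t \<in> {0..T}"
  shows "norm (LBINT s:{0..t}. B s (apply_bcontfun w s) (\<mu> s)) \<le> (LINT s|lborel. k s) * (1 + norm w + C)"
proof -
  have int: "set_integrable lborel {0..t} (\<lambda>s. B s (apply_bcontfun w s) (\<mu> s))"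
    using t by (intro drift_flow_integrable[OF B \<mu>]) auto
  have "0 \<le> C" using \<mu> by (auto simp: P1_flow_def intro: order_trans[OF enn2real_nonneg])
  then have *: "0 \<le> k s * (1 + norm w + C)" for s
    using k by (auto simp: growth_rate_def intro!: mult_nonneg_nonneg)
  have "norm (LBINT s:{0..t}. B s (apply_bcontfun w s) (\<mu> s))
      \<le> (LBINT s:{0..t}. norm (B s (apply_bcontfun w s) (\<mu> s)))"
    by (rule set_integral_norm_bound[OF int])
  also have "\<dots> \<le> (LINT s|lborel. k s * (1 + norm w + C))"
    unfolding set_lebesgue_integral_def
  proof (rule integral_mono_AE)
    show "integrable lborel (\<lambda>s. indicator {0..t} s *\<^sub>R norm (B s (apply_bcontfun w s) (\<mu> s)))"
      using set_integrable_norm[OF int] by (simp add: set_integrable_def)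
    show "integrable lborel (\<lambda>s. k s * (1 + norm w + C))"
      using k by (simp add: growth_rate_def)
    show "AE s in lborel. indicator {0..t} s *\<^sub>R norm (B s (apply_bcontfun w s) (\<mu> s))
        \<le> k s * (1 + norm w + C)"
      using drift_flow_bound[OF k \<mu>, of w]
      by eventually_elim (use * t in \<open>auto simp: indicator_def\<close>)
  qed
  also have "\<dots> = (LINT s|lborel. k s) * (1 + norm w + C)" by simp
  finally show ?thesis .
qed

text \<open>The displacement enters through an arbitrary bounded measurable majorant
  \<open>r\<close>, so that a constant, a weighted rate or a sum of a pathwise and a mean distance
  can be supplied as needed.\<close>

lemma drift_flow_integral_diff:
  fixes v w :: "('d::finite) path"
  assumes B: "regular_drift B" and \<mu>: "P1_flow \<mu> C" and \<nu>: "P1_flow \<nu> C'" and t: "t \<in> {0..T}"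
    and r: "r \<in> borel_measurable borel" "\<And>s. r s \<le> R"
    and le: "\<And>s. s \<in> {0..T} \<Longrightarrow>
      dist (apply_bcontfun v s) (apply_bcontfun w s) + d1 (\<mu> s) (\<nu> s) \<le> r s"
  shows "dist (LBINT s:{0..t}. B s (apply_bcontfun v s) (\<mu> s))
      (LBINT s:{0..t}. B s (apply_bcontfun w s) (\<nu> s)) \<le> J r t"
proof -
  let ?b = "\<lambda>s. B s (apply_bcontfun v s) (\<mu> s) - B s (apply_bcontfun w s) (\<nu> s)"
  have int1: "set_integrable lborel {0..t} (\<lambda>s. B s (apply_bcontfun v s) (\<mu> s))"
    using t by (intro drift_flow_integrable[OF B \<mu>]) auto
  have int2: "set_integrable lborel {0..t} (\<lambda>s. B s (apply_bcontfun w s) (\<nu> s))"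
    using t by (intro drift_flow_integrable[OF B \<nu>]) auto
  note int = set_integral_diff[OF int1 int2]
  have "norm (LBINT s:{0..t}. ?b s) \<le> (LBINT s:{0..t}. norm (?b s))"
    by (rule set_integral_norm_bound[OF int(1)])
  also have "\<dots> \<le> J r t"
    unfolding set_lebesgue_integral_def J_def
  proof (rule integral_mono_AE)
    show "integrable lborel (\<lambda>s. indicator {0..t} s *\<^sub>R norm (?b s))"
      using set_integrable_norm[OF int(1)] by (simp add: set_integrable_def)
    show "integrable lborel (\<lambda>s. indicator {..t} s *\<^sub>R (h s * f (r s)))"
      using kernel_set_integrable[OF r, of "{..t}"] by (simp add: set_integrable_def)
    from B have "AE s in lborel. s \<in> {0..T} \<longrightarrow>
        (\<forall>x y. \<forall>\<mu>\<in>P1 UNIV. \<forall>\<nu>\<in>P1 UNIV.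
           norm (B s x \<mu> - B s y \<nu>) \<le> h s * f (norm (x - y) + d1 \<mu> \<nu>))"
      by (simp add: regular_drift_def)
    then show "AE s in lborel. indicator {0..t} s *\<^sub>R norm (?b s) \<le> indicator {..t} s *\<^sub>R (h s * f (r s))"
    proof eventually_elim
      case (elim s)
      show ?case
      proof (cases "s \<in> {0..t}")
        case True
        then have s: "s \<in> {0..T}" using t by auto
        then have "norm (?b s) \<le> h s * f (norm (apply_bcontfun v s - apply_bcontfun w s) + d1 (\<mu> s) (\<nu> s))"
          using elim P1_flow_P1[OF \<mu>] P1_flow_P1[OF \<nu>] by blast
        also have "\<dots> \<le> f (r s) * h s"
          using le[OF s] by (intro kernel_le) (simp add: dist_norm)
        finally show ?thesis using True by (simp add: mult.commute)
      qed (simp add: indicator_def h_nonneg nonneg)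
    qed
  qed
  finally show ?thesis unfolding int(2) dist_norm .
qed

lemma drift_flow_integral_continuous:
  fixes w :: "('d::finite) path"
  assumes B: "regular_drift B" and \<mu>: "P1_flow \<mu> C"
  shows "continuous_on {0..T} (\<lambda>t. LBINT s:{0..t}. B s (apply_bcontfun w s) (\<mu> s))"
proof -
  let ?b = "\<lambda>s. B s (apply_bcontfun w s) (\<mu> s)"
  have "?b integrable_on {0..T}"
    by (intro set_borel_integral_eq_integral(1) drift_flow_integrable[OF B \<mu>]) auto
  then have "continuous_on {0..T} (\<lambda>t. integral {0..t} ?b)"
    by (rule indefinite_integral_continuous_1)
  then show ?thesis
  proof (rule continuous_on_eq)
    show "integral {0..t} ?b = (LBINT s:{0..t}. ?b s)" if "t \<in> {0..T}" for t
      using that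
      by (intro set_borel_integral_eq_integral(2)[symmetric] drift_flow_integrable[OF B \<mu>]) auto
  qed
qed

lemma J_scale:
  assumes q: "q \<in> borel_measurable borel" "\<And>s. 0 \<le> q s" "\<And>s. q s \<le> R" and c: "1 \<le> c"
  shows "J (\<lambda>s. c * q s) t \<le> c * J q t"
proof -
  have [measurable]: "q \<in> borel_measurable borel" by fact
  have "J (\<lambda>s. c * q s) t \<le> (LBINT s:{..t}. c * (h s * f (q s)))"
    unfolding J_def set_lebesgue_integral_def
  proof (rule integral_mono)
    show "integrable lborel (\<lambda>s. indicator {..t} s *\<^sub>R (h s * f (c * q s)))"
      using kernel_set_integrable[of "\<lambda>s. c * q s" "c * R" "{..t}"] q c
      by (simp add: set_integrable_def mult_left_mono)
    show "integrable lborel (\<lambda>s. indicator {..t} s *\<^sub>R (c * (h s * f (q s))))"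
      using set_integrable_mult_right[OF kernel_set_integrable[OF q(1,3), of "{..t}"], of c]
      by (simp add: set_integrable_def)
    show "indicator {..t} s *\<^sub>R (h s * f (c * q s)) \<le> indicator {..t} s *\<^sub>R (c * (h s * f (q s)))" for s
      using scale[OF q(2) c, of s] h_nonneg[of s]
      by (auto simp: indicator_def mult.left_commute[of c] intro!: mult_left_mono)
  qed
  then show ?thesis by (simp add: J_def)
qed

end

section \<open>Strong solutions by Picard iteration\<close>

context osgood_kernel
begin

text \<open>The equation holds for every input path, without an exceptional null set, so the map can
  be composed with the marginals of any coupling of inputs.\<close>

definition strong_solution ::
    "('d::finite) drift \<Rightarrow> 'd path measure \<Rightarrow> ('d path \<Rightarrow> 'd path) \<Rightarrow> bool" where
  "strong_solution B \<mu>Y \<Phi> \<longleftrightarrow>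
     \<Phi> \<in> path_borel T \<rightarrow>\<^sub>M path_borel T \<and> integrable_path T \<mu>Y \<Phi> \<and>
     (\<forall>y\<in>C_paths T. \<forall>t\<in>{0..T}. apply_bcontfun (\<Phi> y) t =
        (LBINT s:{0..t}. B s (apply_bcontfun (\<Phi> y) s) (law_at \<mu>Y \<Phi> s)) + apply_bcontfun y t)"

text \<open>The invariant of the Picard iteration: continuity gives Borel measurability of each
  iterate, and linear growth turns a first moment of the input into one of the iterate.\<close>

definition regular_map :: "(('d::finite) path \<Rightarrow> 'd path) \<Rightarrow> bool" where
  "regular_map \<Psi> \<longleftrightarrow> \<Psi> ` C_paths T \<subseteq> C_paths T \<and> continuous_on (C_paths T) \<Psi> \<and>
     (\<exists>C\<ge>0. \<forall>y\<in>C_paths T. norm (\<Psi> y) \<le> C * (1 + norm y))"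

definition picard_map ::
    "('d::finite) drift \<Rightarrow> 'd path measure \<Rightarrow> ('d path \<Rightarrow> 'd path) \<Rightarrow> 'd path \<Rightarrow> 'd path" where
  "picard_map B \<mu>Y \<Psi> y = path_of T (\<lambda>t.
     (LBINT s:{0..t}. B s (apply_bcontfun (\<Psi> y) s) (law_at \<mu>Y \<Psi> s)) + apply_bcontfun y t)"

lemma regular_map_measurable:
  assumes "regular_map \<Psi>" shows "\<Psi> \<in> path_borel T \<rightarrow>\<^sub>M path_borel T"
proof (rule path_borel_measurableI)
  show "\<Psi> \<in> path_borel T \<rightarrow>\<^sub>M borel"
    using assms unfolding regular_map_def path_borel_def
    by (intro borel_measurable_continuous_on_restrict) auto
qed (use assms in \<open>auto simp: regular_map_def space_path_borel\<close>)

lemma regular_map_integrable: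
  assumes "regular_map \<Psi>" "\<mu>Y \<in> P1 (C_paths T)" shows "integrable_path T \<mu>Y \<Psi>"
proof -
  obtain C where "0 \<le> C" "\<And>y. y \<in> C_paths T \<Longrightarrow> norm (\<Psi> y) \<le> C * (1 + norm y)"
    using assms(1) by (auto simp: regular_map_def)
  then show ?thesis by (intro P1_path_integrable[OF assms(2) regular_map_measurable[OF assms(1)]])
qed

lemma picard_map:
  assumes B: "regular_drift B" and \<mu>Y: "\<mu>Y \<in> P1 (C_paths T)" and \<Psi>: "regular_map \<Psi>"
    and y: "y \<in> C_paths T"
  shows "picard_map B \<mu>Y \<Psi> y \<in> C_paths T"
    and "t \<in> {0..T} \<Longrightarrow> apply_bcontfun (picard_map B \<mu>Y \<Psi> y) t =
      (LBINT s:{0..t}. B s (apply_bcontfun (\<Psi> y) s) (law_at \<mu>Y \<Psi> s)) + apply_bcontfun y t"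
proof -
  have "continuous_on {0..T} (\<lambda>t. LBINT s:{0..t}. B s (apply_bcontfun (\<Psi> y) s) (law_at \<mu>Y \<Psi> s))"
    by (rule drift_flow_integral_continuous[OF B law_at_flow[OF regular_map_integrable[OF \<Psi> \<mu>Y]]])
  then have c: "continuous_on {0..T} (\<lambda>t.
      (LBINT s:{0..t}. B s (apply_bcontfun (\<Psi> y) s) (law_at \<mu>Y \<Psi> s)) + apply_bcontfun y t)"
    by (intro continuous_on_add continuous_on_apply_bcontfun)
  show "picard_map B \<mu>Y \<Psi> y \<in> C_paths T"
    and "t \<in> {0..T} \<Longrightarrow> apply_bcontfun (picard_map B \<mu>Y \<Psi> y) t =
      (LBINT s:{0..t}. B s (apply_bcontfun (\<Psi> y) s) (law_at \<mu>Y \<Psi> s)) + apply_bcontfun y t"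
    unfolding picard_map_def using path_of[OF less_imp_le[OF T_pos] c] by auto
qed

lemma picard_map_regular:
  assumes B: "regular_drift B" and \<mu>Y: "\<mu>Y \<in> P1 (C_paths T)" and \<Psi>: "regular_map \<Psi>"
  shows "regular_map (picard_map B \<mu>Y \<Psi>)"
  unfolding regular_map_def
proof (intro conjI)
  note int = regular_map_integrable[OF \<Psi> \<mu>Y]
  note flow = law_at_flow[OF int]
  define m where "m = mean_norm \<mu>Y \<Psi>"
  have m: "0 \<le> m" by (simp add: m_def mean_norm_def)
  have T: "0 \<le> T" using T_pos by simp
  show "picard_map B \<mu>Y \<Psi> ` C_paths T \<subseteq> C_paths T" using picard_map(1)[OF B \<mu>Y \<Psi>] by auto
  have dist_le: "dist (picard_map B \<mu>Y \<Psi> y) (picard_map B \<mu>Y \<Psi> z) \<le> f (dist (\<Psi> y) (\<Psi> z)) * H + dist y z"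
    if yz: "y \<in> C_paths T" "z \<in> C_paths T" for y z
  proof (rule C_paths_dist_bound[OF T picard_map(1)[OF B \<mu>Y \<Psi> yz(1)] picard_map(1)[OF B \<mu>Y \<Psi> yz(2)]])
    fix t assume t: "t \<in> {0..T}"
    \<comment> \<open>Both integrals are along the same flow, whose \<open>d1\<close> to itself is
      0, so only the displacement of the paths remains.\<close>
    have "dist (LBINT s:{0..t}. B s (apply_bcontfun (\<Psi> y) s) (law_at \<mu>Y \<Psi> s))
        (LBINT s:{0..t}. B s (apply_bcontfun (\<Psi> z) s) (law_at \<mu>Y \<Psi> s)) \<le> J (\<lambda>_. dist (\<Psi> y) (\<Psi> z)) t"
      using d1_refl[OF P1_flow_P1[OF flow]]
      by (intro drift_flow_integral_diff[OF B flow flow t _ order_refl]) (auto simp: dist_bounded)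
    also have "\<dots> \<le> f (dist (\<Psi> y) (\<Psi> z)) * H" by (intro J_le) auto
    finally show "dist (apply_bcontfun (picard_map B \<mu>Y \<Psi> y) t) (apply_bcontfun (picard_map B \<mu>Y \<Psi> z) t)
        \<le> f (dist (\<Psi> y) (\<Psi> z)) * H + dist y z"
      unfolding picard_map(2)[OF B \<mu>Y \<Psi> yz(1) t] picard_map(2)[OF B \<mu>Y \<Psi> yz(2) t]
      using dist_bounded[of y t z] by (intro order_trans[OF dist_triangle_add] add_mono) auto
  qed
  show "continuous_on (C_paths T) (picard_map B \<mu>Y \<Psi>)"
    unfolding continuous_on_def
  proof
    fix z :: "'a path" assume z: "z \<in> C_paths T"
    have "(\<Psi> \<longlongrightarrow> \<Psi> z) (at z within C_paths T)"
      using \<Psi> z by (auto simp: regular_map_def continuous_on_def)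
    then have "((\<lambda>y. f (dist (\<Psi> y) (\<Psi> z)) * H + dist y z) \<longlongrightarrow> f (dist (\<Psi> z) (\<Psi> z)) * H + dist z z)
        (at z within C_paths T)"
      by (intro tendsto_intros continuous_on_tendsto_compose[OF cont]) auto
    then have lim: "((\<lambda>y. f (dist (\<Psi> y) (\<Psi> z)) * H + dist y z) \<longlongrightarrow> 0) (at z within C_paths T)"
      by (simp add: zero)
    have "((\<lambda>y. dist (picard_map B \<mu>Y \<Psi> y) (picard_map B \<mu>Y \<Psi> z)) \<longlongrightarrow> 0) (at z within C_paths T)"
    proof (rule tendsto_sandwich[OF _ _ tendsto_const lim])
      show "\<forall>\<^sub>F y in at z within C_paths T. dist (picard_map B \<mu>Y \<Psi> y) (picard_map B \<mu>Y \<Psi> z)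
          \<le> f (dist (\<Psi> y) (\<Psi> z)) * H + dist y z"
        using dist_le z by (auto simp: eventually_at_filter)
    qed simp
    then show "(picard_map B \<mu>Y \<Psi> \<longlongrightarrow> picard_map B \<mu>Y \<Psi> z) (at z within C_paths T)"
      by (rule tendsto_dist_iff[THEN iffD2])
  qed
  obtain C where C: "0 \<le> C" "\<And>y. y \<in> C_paths T \<Longrightarrow> norm (\<Psi> y) \<le> C * (1 + norm y)"
    using \<Psi> by (auto simp: regular_map_def)
  obtain k where k: "growth_rate B k" using B by (auto simp: regular_drift_def)
  define K where "K = (LINT s|lborel. k s)"
  have K: "0 \<le> K" unfolding K_def using k by (intro integral_nonneg_AE) (simp add: growth_rate_def)
  show "\<exists>C\<ge>0. \<forall>y\<in>C_paths T. norm (picard_map B \<mu>Y \<Psi> y) \<le> C * (1 + norm y)"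
  proof (intro exI conjI ballI)
    show "0 \<le> K * (1 + C + m) + 1" using K C m by simp
    fix y :: "'a path" assume y: "y \<in> C_paths T"
    have z: "(0 :: 'a path) \<in> C_paths T" by (simp add: C_paths_def)
    have "dist (picard_map B \<mu>Y \<Psi> y) 0 \<le> K * (1 + C * (1 + norm y) + m) + norm y"
    proof (rule C_paths_dist_bound[OF T picard_map(1)[OF B \<mu>Y \<Psi> y] z])
      fix t assume t: "t \<in> {0..T}"
      have "norm (LBINT s:{0..t}. B s (apply_bcontfun (\<Psi> y) s) (law_at \<mu>Y \<Psi> s)) \<le> K * (1 + norm (\<Psi> y) + m)"
        unfolding K_def m_def by (rule drift_flow_integral_le[OF B k flow t])
      also have "\<dots> \<le> K * (1 + C * (1 + norm y) + m)"
        using C(2)[OF y] K by (intro mult_left_mono) auto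
      finally show "dist (apply_bcontfun (picard_map B \<mu>Y \<Psi> y) t) (apply_bcontfun 0 t)
          \<le> K * (1 + C * (1 + norm y) + m) + norm y"
        unfolding picard_map(2)[OF B \<mu>Y \<Psi> y t] using norm_bounded[of y t]
        by (simp add: norm_triangle_le)
    qed
    also have "\<dots> \<le> (K * (1 + C + m) + 1) * (1 + norm y)"
      using K C m by (simp add: algebra_simps)
    finally show "norm (picard_map B \<mu>Y \<Psi> y) \<le> (K * (1 + C + m) + 1) * (1 + norm y)" by simp
  qed
qed

section \<open>Estimates weighted by the norm of the input\<close>

lemma P1_paths:
  assumes "\<mu>Y \<in> P1 (C_paths T)"
  shows "prob_space \<mu>Y" "sets \<mu>Y = sets (path_borel T)" "space \<mu>Y = C_paths T"
    "ennreal (enn2real (moment1 \<mu>Y)) = moment1 \<mu>Y"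
  using assms sets_eq_imp_space_eq[of \<mu>Y "path_borel T"] space_path_borel[of T]
  by (auto simp: P1_def path_borel_def)

text \<open>Both processes are driven by the same input, which couples their marginals; integrating
  the weight \<open>1 + norm y\<close> against the input law gives one plus its first
  moment.\<close>

lemma weighted_d1_le:
  assumes \<mu>Y: "\<mu>Y \<in> P1 (C_paths T)" and X: "integrable_path T \<mu>Y X" and Y: "integrable_path T \<mu>Y Y"
    and b: "0 \<le> b" and le: "\<And>y. y \<in> C_paths T \<Longrightarrow>
      dist (apply_bcontfun (X y) s) (apply_bcontfun (Y y) s) \<le> (1 + norm y) * b"
  shows "d1 (law_at \<mu>Y X s) (law_at \<mu>Y Y s) \<le> (1 + enn2real (moment1 \<mu>Y)) * b"
proof (rule d1_law_le)
  show "X \<in> \<mu>Y \<rightarrow>\<^sub>M path_borel T" "Y \<in> \<mu>Y \<rightarrow>\<^sub>M path_borel T"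
    using X Y by (auto simp: integrable_path_def)
  interpret prob_space \<mu>Y by (rule P1_paths[OF \<mu>Y])
  have [measurable]: "(\<lambda>y. y) \<in> \<mu>Y \<rightarrow>\<^sub>M borel"
    by (rule path_borel_to_borel[of _ _ T]) (simp add: P1_paths[OF \<mu>Y] measurable_ident_sets)
  have "(\<integral>\<^sup>+ y. ennreal (dist (apply_bcontfun (X y) s) (apply_bcontfun (Y y) s)) \<partial>\<mu>Y)
      \<le> (\<integral>\<^sup>+ y. (1 + ennreal (norm y)) * ennreal b \<partial>\<mu>Y)"
    using le b P1_paths(3)[OF \<mu>Y]
    by (intro nn_integral_mono) (auto simp flip: ennreal_mult ennreal_1 ennreal_plus intro!: ennreal_leI)
  also have "\<dots> = (1 + moment1 \<mu>Y) * ennreal b"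
    by (simp add: nn_integral_multc nn_integral_add moment1_def emeasure_space_1)
  also have "\<dots> = ennreal ((1 + enn2real (moment1 \<mu>Y)) * b)"
    using b by (simp add: ennreal_mult P1_paths(4)[OF \<mu>Y])
  finally show "(\<integral>\<^sup>+ y. ennreal (dist (apply_bcontfun (X y) s) (apply_bcontfun (Y y) s)) \<partial>\<mu>Y)
      \<le> ennreal ((1 + enn2real (moment1 \<mu>Y)) * b)" .
qed (use b in auto)

text \<open>Write \<open>m\<close> for the first moment of the input. The path displacement
  contributes \<open>1 + norm y\<close> and the marginals contribute \<open>1 + m\<close>; their sum
  is at most the product of \<open>1 + norm y\<close> and \<open>2 + m\<close>. That product is at
  least 1, so \<open>J_scale\<close> takes it out of the nonlinear integral.\<close>

lemma weighted_integral_diff: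
  assumes B: "regular_drift B" and \<mu>Y: "\<mu>Y \<in> P1 (C_paths T)"
    and X: "integrable_path T \<mu>Y X" and Y: "integrable_path T \<mu>Y Y"
    and q: "q \<in> borel_measurable borel" "\<And>s. 0 \<le> q s" "\<And>s. q s \<le> R"
    and le: "\<And>y s. y \<in> C_paths T \<Longrightarrow> s \<in> {0..T} \<Longrightarrow>
      dist (apply_bcontfun (X y) s) (apply_bcontfun (Y y) s) \<le> (1 + norm y) * q s"
    and y: "y \<in> C_paths T" and t: "t \<in> {0..T}"
  shows "dist (LBINT s:{0..t}. B s (apply_bcontfun (X y) s) (law_at \<mu>Y X s))
      (LBINT s:{0..t}. B s (apply_bcontfun (Y y) s) (law_at \<mu>Y Y s))
    \<le> (1 + norm y) * ((2 + enn2real (moment1 \<mu>Y)) * J q t)"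
proof -
  define m where "m = enn2real (moment1 \<mu>Y)"
  have m: "0 \<le> m" by (simp add: m_def)
  define c where "c = (1 + norm y) * (2 + m)"
  have c: "1 \<le> c" unfolding c_def using m mult_mono[of 1 "1 + norm y" 1 "2 + m"] by simp
  have [measurable]: "q \<in> borel_measurable borel" by fact
  have "dist (LBINT s:{0..t}. B s (apply_bcontfun (X y) s) (law_at \<mu>Y X s))
      (LBINT s:{0..t}. B s (apply_bcontfun (Y y) s) (law_at \<mu>Y Y s)) \<le> J (\<lambda>s. c * q s) t"
  proof (rule drift_flow_integral_diff[OF B law_at_flow[OF X] law_at_flow[OF Y] t])
    show "c * q s \<le> c * R" for s using q c by (intro mult_left_mono) auto
    fix s assume s: "s \<in> {0..T}"
    have "d1 (law_at \<mu>Y X s) (law_at \<mu>Y Y s) \<le> (1 + m) * q s"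
      unfolding m_def using le s q by (intro weighted_d1_le[OF \<mu>Y X Y]) auto
    then have "dist (apply_bcontfun (X y) s) (apply_bcontfun (Y y) s) + d1 (law_at \<mu>Y X s) (law_at \<mu>Y Y s)
        \<le> (1 + norm y) * q s + (1 + m) * q s"
      using le[OF y s] by (intro add_mono)
    also have "\<dots> = (2 + m + norm y) * q s" by (simp add: algebra_simps)
    also have "\<dots> \<le> c * q s" using m q(2) by (intro mult_right_mono) (auto simp: c_def algebra_simps)
    finally show "dist (apply_bcontfun (X y) s) (apply_bcontfun (Y y) s) + d1 (law_at \<mu>Y X s) (law_at \<mu>Y Y s)
        \<le> c * q s" .
  qed measurable
  also have "\<dots> \<le> c * J q t" by (rule J_scale[OF q c])
  finally show ?thesis by (simp add: c_def m_def mult.assoc)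
qed

text \<open>Constants in front of \<open>J\<close> are absorbed into the kernel, so the scalar
  theory applies verbatim to \<open>(2 + m) * h\<close> in the existence proof and to
  \<open>2 * h\<close> in the stability proof.\<close>

lemma kernel_scale: "0 \<le> c \<Longrightarrow> osgood_kernel f T (\<lambda>s. c * h s)"
  by unfold_locales (use T_pos h_integrable h_nonneg h_support in auto)

lemma J_kernel_scale: "0 \<le> c \<Longrightarrow> osgood_kernel.J f (\<lambda>s. c * h s) r t = c * J r t"
proof -
  assume "0 \<le> c"
  then interpret K: osgood_kernel f T "\<lambda>s. c * h s" by (rule kernel_scale)
  show ?thesis unfolding K.J_def J_def
    by (subst set_integral_mult_right[symmetric]) (simp add: mult.assoc)
qed

text \<open>
  The weight \<open>1 + norm y\<close> matches the linear growth of the drift, and concavity of the modulus lets it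
  pass through \<open>f\<close>; so the iteration converges for every input path, which makes the limit measurable
  without passing to almost everywhere convergent subsequences.
\<close>

lemma strong_solution_exists:
  fixes B :: "('d::finite) drift"
  assumes B: "regular_drift B" and \<mu>Y: "\<mu>Y \<in> P1 (C_paths T)"
  obtains \<Phi> where "strong_solution B \<mu>Y \<Phi>"
proof -
  have T: "0 \<le> T" using T_pos by simp
  define m where "m = enn2real (moment1 \<mu>Y)"
  have m: "0 \<le> m" by (simp add: m_def)
  obtain k where k: "growth_rate B k" using B by (auto simp: regular_drift_def)
  \<comment> \<open>The first Picard step moves a path by at most the integral of \<open>k\<close>
    times \<open>1 + norm y + m\<close>, and \<open>1 + norm y + m\<close> is at most the product of
    \<open>1 + norm y\<close> and \<open>1 + m\<close>.\<close>
  define A where "A = (LINT s|lborel. k s) * (1 + m)"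
  have K: "0 \<le> (LINT s|lborel. k s)" using k by (intro integral_nonneg_AE) (simp add: growth_rate_def)
  interpret K: osgood_kernel f T "\<lambda>s. (2 + m) * h s" using m by (intro kernel_scale) simp
  have KJ: "K.J r t = (2 + m) * J r t" for r t using m by (intro J_kernel_scale) simp
  have "0 \<le> A" using K m by (simp add: A_def)
  then obtain \<sigma> R where \<sigma>: "\<And>n. \<sigma> n \<in> borel_measurable borel" "\<And>n s. 0 \<le> \<sigma> n s" "\<And>n s. \<sigma> n s \<le> R"
    "\<And>t. A + (2 + m) * J (\<sigma> 0) t \<le> \<sigma> 0 t" "\<And>n t. (2 + m) * J (\<sigma> n) t \<le> \<sigma> (Suc n) t"
    "\<And>n t. \<sigma> n t \<le> \<sigma> n T" "(\<lambda>n. \<sigma> n T) \<longlonglongrightarrow> 0"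
    using K.scalar_picard[of A] unfolding KJ by metis
  define \<Psi> where "\<Psi> n = (picard_map B \<mu>Y ^^ n) (\<lambda>y. y)" for n
  have \<Psi>_0: "\<Psi> 0 y = y" and \<Psi>_Suc: "\<Psi> (Suc n) = picard_map B \<mu>Y (\<Psi> n)" for n y
    by (simp_all add: \<Psi>_def)
  have reg: "regular_map (\<Psi> n)" for n
  proof (induction n)
    case 0
    show ?case unfolding regular_map_def by (auto simp: \<Psi>_def intro!: exI[of _ 1])
  qed (use picard_map_regular[OF B \<mu>Y] in \<open>simp add: \<Psi>_Suc\<close>)
  note int = regular_map_integrable[OF reg \<mu>Y]
  have \<Psi>_path: "\<Psi> n y \<in> C_paths T" if "y \<in> C_paths T" for n y
    using reg[of n] that by (auto simp: regular_map_def)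
  have \<Psi>_eq: "apply_bcontfun (\<Psi> (Suc n) y) t =
      (LBINT s:{0..t}. B s (apply_bcontfun (\<Psi> n y) s) (law_at \<mu>Y (\<Psi> n) s)) + apply_bcontfun y t"
    if "y \<in> C_paths T" "t \<in> {0..T}" for n y t
    unfolding \<Psi>_Suc by (rule picard_map(2)[OF B \<mu>Y reg that])
  \<comment> \<open>All iterates stay within the weighted distance \<open>\<sigma> 0\<close> of the
    identity: the first step costs \<open>A\<close>, the difference of the integrals costs
    \<open>(2 + m) * J (\<sigma> 0)\<close>, and \<open>\<sigma> 0\<close> dominates their sum.
    Being uniform in \<open>p\<close>, this starts the Cauchy estimate.\<close>
  have base: "dist (apply_bcontfun (\<Psi> p y) t) (apply_bcontfun (\<Psi> 0 y) t) \<le> (1 + norm y) * \<sigma> 0 t"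
    if "y \<in> C_paths T" "t \<in> {0..T}" for p y t
    using that
  proof (induction p arbitrary: y t)
    case 0
    then show ?case using \<sigma>(2)[of 0 t] by simp
  next
    case (Suc p)
    let ?I = "\<lambda>n. LBINT s:{0..t}. B s (apply_bcontfun (\<Psi> n y) s) (law_at \<mu>Y (\<Psi> n) s)"
    have "mean_norm \<mu>Y (\<Psi> 0) = m" by (simp add: mean_norm_def \<Psi>_0 m_def moment1_def)
    then have "norm (?I 0) \<le> (LINT s|lborel. k s) * (1 + norm y + m)"
      using drift_flow_integral_le[OF B k law_at_flow[OF int[of 0]] Suc.prems(2), of "\<Psi> 0 y"]
      by (simp add: \<Psi>_0)
    also have "\<dots> \<le> (1 + norm y) * A"
      unfolding A_def using K m by (simp add: mult.left_commute[of "1 + norm y"] mult_left_mono algebra_simps)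
    finally have "norm (?I 0) \<le> (1 + norm y) * A" .
    moreover have "dist (?I p) (?I 0) \<le> (1 + norm y) * ((2 + m) * J (\<sigma> 0) t)"
      unfolding m_def using Suc by (intro weighted_integral_diff[OF B \<mu>Y int int \<sigma>(1-3)]) auto
    ultimately have "norm (?I p) \<le> (1 + norm y) * (A + (2 + m) * J (\<sigma> 0) t)"
      using norm_triangle_sub[of "?I p" "?I 0"] by (simp add: dist_norm distrib_left)
    also have "\<dots> \<le> (1 + norm y) * \<sigma> 0 t" using \<sigma>(4)[of t] by (intro mult_left_mono) auto
    finally show ?case using \<Psi>_eq[OF Suc.prems] by (simp add: \<Psi>_0 dist_norm)
  qed
  \<comment> \<open>Induction on \<open>n\<close> with the gap \<open>p\<close> fixed: one Picard
    step on both sides replaces \<open>\<sigma> n\<close> by \<open>\<sigma> (Suc n)\<close>. The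
    input stays arbitrary because the marginals involve all inputs at once.\<close>
  have cauchy_le: "dist (apply_bcontfun (\<Psi> (n + p) y) t) (apply_bcontfun (\<Psi> n y) t) \<le> (1 + norm y) * \<sigma> n t"
    if "y \<in> C_paths T" "t \<in> {0..T}" for n p y t
    using that
  proof (induction n arbitrary: y t)
    case 0
    then show ?case using base by simp
  next
    case (Suc n)
    have "dist (apply_bcontfun (\<Psi> (Suc n + p) y) t) (apply_bcontfun (\<Psi> (Suc n) y) t)
        \<le> (1 + norm y) * ((2 + m) * J (\<sigma> n) t)"
      unfolding m_def add_Suc \<Psi>_eq[OF Suc.prems] dist_add_cancel2
      using Suc by (intro weighted_integral_diff[OF B \<mu>Y int int \<sigma>(1-3)]) auto
    also have "\<dots> \<le> (1 + norm y) * \<sigma> (Suc n) t" using \<sigma>(5)[of n t] by (intro mult_left_mono) auto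
    finally show ?case .
  qed
  have dist_le: "dist (\<Psi> (n + p) y) (\<Psi> n y) \<le> (1 + norm y) * \<sigma> n T" if y: "y \<in> C_paths T" for n p y
  proof (rule C_paths_dist_bound[OF T \<Psi>_path[OF y] \<Psi>_path[OF y]])
    fix t assume "t \<in> {0..T}"
    then show "dist (apply_bcontfun (\<Psi> (n + p) y) t) (apply_bcontfun (\<Psi> n y) t) \<le> (1 + norm y) * \<sigma> n T"
      using cauchy_le[OF y, of t n p] \<sigma>(6)[of n t] by (meson add_increasing mult_left_mono norm_ge_zero order_trans zero_le_one)
  qed
  have \<sigma>_lim: "(\<lambda>n. (1 + norm y) * \<sigma> n T) \<longlonglongrightarrow> 0" for y :: "'d path"
    using tendsto_mult[OF tendsto_const \<sigma>(7), of "1 + norm y"] by simp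
  define \<Phi> where "\<Phi> y = lim (\<lambda>n. \<Psi> n y)" for y
  have \<Phi>_lim: "(\<lambda>n. \<Psi> n y) \<longlonglongrightarrow> \<Phi> y" if y: "y \<in> C_paths T" for y
  proof -
    have "Cauchy (\<lambda>n. \<Psi> n y)"
    proof (rule metric_CauchyI)
      fix e :: real assume "0 < e"
      then have "\<forall>\<^sub>F n in sequentially. (1 + norm y) * \<sigma> n T < e / 2"
        using \<sigma>_lim by (intro order_tendstoD) auto
      then obtain N where N: "(1 + norm y) * \<sigma> N T < e / 2" by (auto simp: eventually_sequentially)
      have "dist (\<Psi> a y) (\<Psi> b y) < e" if "N \<le> a" "N \<le> b" for a b
        using dist_le[OF y, of N "a - N"] dist_le[OF y, of N "b - N"] that N
          dist_triangle2[of "\<Psi> a y" "\<Psi> b y" "\<Psi> N y"] by simp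
      then show "\<exists>M. \<forall>a\<ge>M. \<forall>b\<ge>M. dist (\<Psi> a y) (\<Psi> b y) < e" by blast
    qed
    then show ?thesis unfolding \<Phi>_def by (simp add: Cauchy_convergent convergent_LIMSEQ_iff[symmetric])
  qed
  have \<Phi>_path: "\<Phi> y \<in> C_paths T" if "y \<in> C_paths T" for y
    using C_paths_limit[OF \<Phi>_lim[OF that] \<Psi>_path[OF that]] .
  have \<Phi>_dist: "dist (\<Phi> y) (\<Psi> n y) \<le> (1 + norm y) * \<sigma> n T" if y: "y \<in> C_paths T" for n y
  proof (rule LIMSEQ_le_const2)
    show "(\<lambda>p. dist (\<Psi> (n + p) y) (\<Psi> n y)) \<longlonglongrightarrow> dist (\<Phi> y) (\<Psi> n y)"
      using LIMSEQ_ignore_initial_segment[OF \<Phi>_lim[OF y], of n]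
      by (intro tendsto_intros) (simp add: add.commute)
  qed (use dist_le[OF y] in auto)
  have \<Phi>_meas: "\<Phi> \<in> path_borel T \<rightarrow>\<^sub>M path_borel T"
  proof (rule path_borel_measurableI)
    show "\<Phi> \<in> path_borel T \<rightarrow>\<^sub>M borel"
    proof (rule borel_measurable_LIMSEQ_metric)
      show "\<Psi> n \<in> path_borel T \<rightarrow>\<^sub>M borel" for n
        by (rule path_borel_to_borel[OF regular_map_measurable[OF reg]])
      show "(\<lambda>n. \<Psi> n y) \<longlonglongrightarrow> \<Phi> y" if "y \<in> space (path_borel T)" for y
        using that by (simp add: \<Phi>_lim space_path_borel)
    qed
  qed (simp add: \<Phi>_path space_path_borel)
  have \<Phi>_int: "integrable_path T \<mu>Y \<Phi>"
  proof (rule P1_path_integrable[OF \<mu>Y \<Phi>_meas])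
    show "0 \<le> \<sigma> 0 T + 1" using \<sigma>(2)[of 0 T] by simp
    fix y :: "'d path" assume y: "y \<in> C_paths T"
    show "norm (\<Phi> y) \<le> (\<sigma> 0 T + 1) * (1 + norm y)"
      using \<Phi>_dist[OF y, of 0] norm_triangle_sub[of "\<Phi> y" y]
      by (simp add: \<Psi>_0 dist_norm algebra_simps)
  qed
  have "apply_bcontfun (\<Phi> y) t =
      (LBINT s:{0..t}. B s (apply_bcontfun (\<Phi> y) s) (law_at \<mu>Y \<Phi> s)) + apply_bcontfun y t"
    if y: "y \<in> C_paths T" and t: "t \<in> {0..T}" for y t
  proof (rule LIMSEQ_unique)
    let ?I = "\<lambda>\<Psi>. LBINT s:{0..t}. B s (apply_bcontfun (\<Psi> y) s) (law_at \<mu>Y \<Psi> s)"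
    have "(\<lambda>n. apply_bcontfun (\<Psi> n y) t) \<longlonglongrightarrow> apply_bcontfun (\<Phi> y) t"
      using tendsto_bcontfun_uniform_limit[OF \<Phi>_lim[OF y]] by (rule tendsto_uniform_limitI) simp
    then show "(\<lambda>n. apply_bcontfun (\<Psi> (Suc n) y) t) \<longlonglongrightarrow> apply_bcontfun (\<Phi> y) t"
      by (rule LIMSEQ_Suc)
    \<comment> \<open>The integrals converge by the weighted estimate with the constant majorant
      \<open>\<sigma> n T\<close>, which bounds paths and marginals together; its image under
      \<open>f\<close> tends to \<open>f 0 = 0\<close>.\<close>
    have "dist (?I (\<Psi> n)) (?I \<Phi>) \<le> (1 + norm y) * ((2 + m) * (f (\<sigma> n T) * H))" for n
    proof -
      have "dist (?I \<Phi>) (?I (\<Psi> n)) \<le> (1 + norm y) * ((2 + m) * J (\<lambda>_. \<sigma> n T) t)"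
        unfolding m_def
      proof (rule weighted_integral_diff[OF B \<mu>Y \<Phi>_int int _ _ order_refl _ y t])
        show "dist (apply_bcontfun (\<Phi> z) s) (apply_bcontfun (\<Psi> n z) s) \<le> (1 + norm z) * \<sigma> n T"
          if "z \<in> C_paths T" for z s
          using \<Phi>_dist[OF that, of n] dist_bounded[of "\<Phi> z" s "\<Psi> n z"] by linarith
      qed (use \<sigma>(2) in auto)
      also have "\<dots> \<le> (1 + norm y) * ((2 + m) * (f (\<sigma> n T) * H))"
        using m by (intro mult_left_mono J_le) auto
      finally show ?thesis by (simp add: dist_commute)
    qed
    note le = this
    have "(\<lambda>n. (1 + norm y) * ((2 + m) * (f (\<sigma> n T) * H))) \<longlonglongrightarrow> (1 + norm y) * ((2 + m) * (f 0 * H))"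
      by (intro tendsto_intros continuous_on_tendsto_compose[OF cont \<sigma>(7)]) auto
    then have lim: "(\<lambda>n. (1 + norm y) * ((2 + m) * (f (\<sigma> n T) * H))) \<longlonglongrightarrow> 0"
      unfolding zero by simp
    have "(\<lambda>n. dist (?I (\<Psi> n)) (?I \<Phi>)) \<longlonglongrightarrow> 0"
      by (rule tendsto_sandwich[OF always_eventually always_eventually tendsto_const lim])
        (rule allI, rule zero_le_dist, rule allI, rule le)
    then have "(\<lambda>n. ?I (\<Psi> n)) \<longlonglongrightarrow> ?I \<Phi>" by (rule tendsto_dist_iff[THEN iffD2])
    then show "(\<lambda>n. apply_bcontfun (\<Psi> (Suc n) y) t) \<longlonglongrightarrow> ?I \<Phi> + apply_bcontfun y t"
      unfolding \<Psi>_eq[OF y t] by (intro tendsto_intros)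
  qed
  then have "strong_solution B \<mu>Y \<Phi>"
    using \<Phi>_meas \<Phi>_int by (auto simp: strong_solution_def)
  then show thesis by (rule that)
qed

end

section \<open>Weak solutions as functions of their input\<close>

lemma law_at_distr:
  assumes "X \<in> W \<rightarrow>\<^sub>M path_borel T"
  shows "law_at W X t = distr (distr W (path_borel T) X) borel (\<lambda>w. apply_bcontfun w t)"
  unfolding law_at_def
  using evaluation_measurable[of "\<lambda>w. w" "path_borel T" T "\<lambda>_. t"] assms
  by (subst distr_distr) (auto simp: comp_def)

lemma joint_path_measurable:
  assumes "X \<in> W \<rightarrow>\<^sub>M path_borel T"
  shows "(\<lambda>z. apply_bcontfun (X (fst z)) (snd z)) \<in> borel_measurable (W \<Otimes>\<^sub>M lborel)"
  by (rule evaluation_measurable) (use assms in \<open>auto intro: measurable_compose[OF measurable_fst]\<close>)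

context osgood_kernel
begin

text \<open>The definition of a weak solution bounds only the moments of the marginals. Pathwise,
  the norm of \<open>X\<close> is at most that of \<open>Y\<close> plus the integral over time of
  the growth bound. By Tonelli the mean of that integral involves only the mean of the norm of
  \<open>X\<close> at single times, which is at most \<open>C\<close>; no Gronwall argument is
  required.\<close>

lemma weak_solution_integrable:
  fixes B :: "('d::finite) drift"
  assumes B: "regular_drift B" and \<mu>Y: "\<mu>Y \<in> P1 (C_paths T)" and ws: "weak_solution T B \<mu>Y W X Y"
  shows "integrable_path T W X" and "Y \<in> W \<rightarrow>\<^sub>M path_borel T"
proof -
  interpret prob_space W using ws by (simp add: weak_solution_def)
  have XY: "(\<lambda>\<omega>. (X \<omega>, Y \<omega>)) \<in> W \<rightarrow>\<^sub>M path_borel T \<Otimes>\<^sub>M path_borel T"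
    using ws by (simp add: weak_solution_def)
  have X: "X \<in> W \<rightarrow>\<^sub>M path_borel T" using measurable_compose[OF XY measurable_fst] by simp
  show Y: "Y \<in> W \<rightarrow>\<^sub>M path_borel T" using measurable_compose[OF XY measurable_snd] by simp
  note [measurable] = path_borel_to_borel[OF Y] joint_path_measurable[OF X] evaluation_measurable[OF X]
  obtain k where k: "growth_rate B k" using B by (auto simp: regular_drift_def)
  have [measurable]: "k \<in> borel_measurable borel" and k_nonneg: "0 \<le> k s" for s
    using k borel_measurable_integrable[of lborel k] by (auto simp: growth_rate_def)
  define S where "S = (SUP t\<in>{0..T}. moment1 (law_at W X t))"
  define C where "C = enn2real S"
  have S: "S < \<infinity>" using ws by (simp add: weak_solution_def S_def)
  have C: "0 \<le> C" by (simp add: C_def)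
  have mom: "moment1 (law_at W X t) \<le> ennreal C" if "t \<in> {0..T}" for t
    using SUP_upper[OF that, of "\<lambda>t. moment1 (law_at W X t)"] S by (simp add: C_def S_def[symmetric])
  have P1: "law_at W X t \<in> P1 UNIV" if "t \<in> {0..T}" for t
    using mom[OF that] by (auto simp: P1_def law_at_def sets_restrict_space intro!: prob_space_distr
        intro: order_le_less_trans)
  define g where "g s x = indicator {0..T} s * (k s * (1 + C + norm x))" for s and x :: "real^'d"
  have g_meas [measurable]: "(\<lambda>z. g (snd z) (apply_bcontfun (X (fst z)) (snd z))) \<in> borel_measurable (W \<Otimes>\<^sub>M lborel)"
    unfolding g_def by measurable
  \<comment> \<open>An extended-valued integral, so the pathwise bound can be stated before
    finiteness is known; where \<open>R \<omega>\<close> is infinite it is trivial.\<close>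
  define R where "R \<omega> = (\<integral>\<^sup>+ s. ennreal (g s (apply_bcontfun (X \<omega>) s)) \<partial>lborel)" for \<omega>
  have R_meas [measurable]: "R \<in> borel_measurable W" unfolding R_def[abs_def] by measurable
  have "AE \<omega> in W. ennreal (norm (X \<omega>)) \<le> ennreal (norm (Y \<omega>)) + R \<omega>"
  proof -
    have int: "AE \<omega> in W. set_integrable lborel {0..T} (\<lambda>t. B t (apply_bcontfun (X \<omega>) t) (law_at W X t))"
      and eqn: "AE \<omega> in W. \<forall>t\<in>{0..T}. apply_bcontfun (X \<omega>) t =
          (LBINT s:{0..t}. B s (apply_bcontfun (X \<omega>) s) (law_at W X s)) + apply_bcontfun (Y \<omega>) t"
      using ws by (auto simp: weak_solution_def)
    from int eqn AE_space show ?thesis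
    proof eventually_elim
      case (elim \<omega>)
      show ?case
      proof (cases "R \<omega> = \<infinity>")
        case False
        then have R: "R \<omega> = ennreal (enn2real (R \<omega>))" by (simp add: less_top)
        have z: "(0 :: 'd path) \<in> C_paths T" by (simp add: C_paths_def)
        have Xp: "X \<omega> \<in> C_paths T" using measurable_space[OF X elim(3)] by (simp add: space_path_borel)
        have "dist (X \<omega>) 0 \<le> norm (Y \<omega>) + enn2real (R \<omega>)"
        proof (rule C_paths_dist_bound[OF less_imp_le[OF T_pos] Xp z])
          fix t assume t: "t \<in> {0..T}"
          let ?b = "\<lambda>s. B s (apply_bcontfun (X \<omega>) s) (law_at W X s)"
          have "set_integrable lborel {0..t} ?b"
            by (rule set_integrable_subset[OF elim(1)]) (use t in auto)
          then have "ennreal (norm (LBINT s:{0..t}. ?b s)) \<le> (\<integral>\<^sup>+ s. ennreal (norm (indicator {0..t} s *\<^sub>R ?b s)) \<partial>lborel)"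
            unfolding set_integrable_def set_lebesgue_integral_def by (rule integral_norm_bound_ennreal)
          also have "\<dots> \<le> R \<omega>" unfolding R_def
          proof (rule nn_integral_mono_AE)
            from k have "AE s in lborel. s \<in> {0..T} \<longrightarrow>
              (\<forall>x. \<forall>\<mu>\<in>P1 UNIV. norm (B s x \<mu>) \<le> k s * (1 + norm x + enn2real (moment1 \<mu>)))"
              by (simp add: growth_rate_def)
            then show "AE s in lborel. ennreal (norm (indicator {0..t} s *\<^sub>R ?b s))
                \<le> ennreal (g s (apply_bcontfun (X \<omega>) s))"
            proof eventually_elim
              case (elim s)
              show ?case
              proof (cases "s \<in> {0..t}")
                case True
                then have s: "s \<in> {0..T}" using t by auto
                have "enn2real (moment1 (law_at W X s)) \<le> C" using mom[OF s] C by (rule enn2real_leI[rotated])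
                then have "k s * (1 + norm (apply_bcontfun (X \<omega>) s) + enn2real (moment1 (law_at W X s)))
                    \<le> k s * (1 + C + norm (apply_bcontfun (X \<omega>) s))"
                  by (intro mult_left_mono k_nonneg) simp
                then have "norm (?b s) \<le> k s * (1 + C + norm (apply_bcontfun (X \<omega>) s))"
                  using elim s P1[OF s] by (blast intro: order_trans)
                then show ?thesis using True s by (simp add: g_def ennreal_leI)
              qed simp
            qed
          qed
          also have "\<dots> = ennreal (enn2real (R \<omega>))" by (fact R)
          finally have "norm (LBINT s:{0..t}. ?b s) \<le> enn2real (R \<omega>)" by simp
          then show "dist (apply_bcontfun (X \<omega>) t) (apply_bcontfun 0 t) \<le> norm (Y \<omega>) + enn2real (R \<omega>)"
            using elim(2) t norm_bounded[of "Y \<omega>" t] norm_triangle_ineq[of "LBINT s:{0..t}. ?b s" "apply_bcontfun (Y \<omega>) t"]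
            by (simp add: dist_norm)
        qed
        then have "ennreal (norm (X \<omega>)) \<le> ennreal (norm (Y \<omega>) + enn2real (R \<omega>))"
          by (intro ennreal_leI) simp
        then show ?thesis using R by simp
      qed simp
    qed
  qed
  then have "(\<integral>\<^sup>+ \<omega>. ennreal (norm (X \<omega>)) \<partial>W) \<le> (\<integral>\<^sup>+ \<omega>. ennreal (norm (Y \<omega>)) + R \<omega> \<partial>W)"
    by (rule nn_integral_mono_AE)
  also have "\<dots> = (\<integral>\<^sup>+ \<omega>. ennreal (norm (Y \<omega>)) \<partial>W) + (\<integral>\<^sup>+ \<omega>. R \<omega> \<partial>W)"
    by (rule nn_integral_add) auto
  finally have X_le: "(\<integral>\<^sup>+ \<omega>. ennreal (norm (X \<omega>)) \<partial>W)
      \<le> (\<integral>\<^sup>+ \<omega>. ennreal (norm (Y \<omega>)) \<partial>W) + (\<integral>\<^sup>+ \<omega>. R \<omega> \<partial>W)" .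
  have Y_eq: "(\<integral>\<^sup>+ \<omega>. ennreal (norm (Y \<omega>)) \<partial>W) = moment1 \<mu>Y"
  proof -
    have law: "distr W (path_borel T) Y = \<mu>Y" using ws by (simp add: weak_solution_def)
    have "(\<lambda>y. ennreal (norm y)) \<in> borel_measurable (distr W (path_borel T) Y)"
      unfolding measurable_distr_eq1
      unfolding path_borel_def by (rule measurable_restrict_space1) measurable
    from nn_integral_distr[OF Y this] show ?thesis
      unfolding moment1_def law[symmetric] by (rule sym)
  qed
  have "(\<integral>\<^sup>+ \<omega>. R \<omega> \<partial>W) = (\<integral>\<^sup>+ s. (\<integral>\<^sup>+ \<omega>. ennreal (g s (apply_bcontfun (X \<omega>) s)) \<partial>W) \<partial>lborel)"
  proof -
    interpret pair_sigma_finite W lborel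
      by (intro pair_sigma_finite.intro sigma_finite_measure_axioms lborel.sigma_finite_measure_axioms)
    have "case_prod (\<lambda>\<omega> s. ennreal (g s (apply_bcontfun (X \<omega>) s))) \<in> borel_measurable (W \<Otimes>\<^sub>M lborel)"
      unfolding case_prod_beta by (rule measurable_compose[OF g_meas measurable_ennreal])
    from Fubini'[OF this] show ?thesis unfolding R_def by (rule sym)
  qed
  also have "\<dots> \<le> (\<integral>\<^sup>+ s. ennreal (k s * (1 + C + C)) \<partial>lborel)"
  proof (rule nn_integral_mono)
    fix s
    have g: "ennreal (g s x) = ennreal (indicator {0..T} s * k s) * (ennreal (1 + C) + ennreal (norm x))" for x
    proof -
      have "ennreal (1 + C) + ennreal (norm x) = ennreal (1 + C + norm x)"
        using C by (intro ennreal_plus[symmetric]) auto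
      moreover have "g s x = (indicator {0..T} s * k s) * (1 + C + norm x)" by (simp add: g_def)
      ultimately show ?thesis
        using ennreal_mult[of "indicator {0..T} s * k s" "1 + C + norm x"] k_nonneg[of s] C by simp
    qed
    have "(\<integral>\<^sup>+ \<omega>. ennreal (g s (apply_bcontfun (X \<omega>) s)) \<partial>W)
        = ennreal (indicator {0..T} s * k s) * (ennreal (1 + C) + moment1 (law_at W X s))"
      unfolding g moment1_law_at[OF X]
      by (subst nn_integral_cmult) (auto simp: nn_integral_add emeasure_space_1)
    also have "\<dots> \<le> ennreal (k s * (1 + C + C))"
    proof (cases "s \<in> {0..T}")
      case True
      have "ennreal (k s) * (ennreal (1 + C) + moment1 (law_at W X s))
          \<le> ennreal (k s) * (ennreal (1 + C) + ennreal C)"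
        using mom[OF True] by (intro mult_left_mono add_left_mono) auto
      moreover have "ennreal (1 + C) + ennreal C = ennreal (1 + C + C)"
        using C by (intro ennreal_plus[symmetric]) auto
      moreover have "ennreal (k s * (1 + C + C)) = ennreal (k s) * ennreal (1 + C + C)"
        using k_nonneg[of s] C by (intro ennreal_mult) auto
      moreover have "indicator {0..T} s * k s = k s" using True by simp
      ultimately show ?thesis by (simp only:)
    qed simp
    finally show "(\<integral>\<^sup>+ \<omega>. ennreal (g s (apply_bcontfun (X \<omega>) s)) \<partial>W) \<le> ennreal (k s * (1 + C + C))" .
  qed
  also have "\<dots> = ennreal (LINT s|lborel. k s * (1 + C + C))"
    using k C by (intro nn_integral_eq_integral) (auto simp: growth_rate_def)
  finally have "(\<integral>\<^sup>+ \<omega>. ennreal (norm (X \<omega>)) \<partial>W) \<le> moment1 \<mu>Y + ennreal (LINT s|lborel. k s * (1 + C + C))"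
    using X_le unfolding Y_eq by (meson add_left_mono order_trans)
  also have "\<dots> < \<infinity>" using \<mu>Y by (simp add: P1_def)
  finally show "integrable_path T W X"
    unfolding integrable_path_def using X prob_space_axioms by auto
qed

lemma regular_drift_along_flow:
  fixes B :: "('d::finite) drift"
  assumes B: "regular_drift B" and \<mu>: "P1_flow \<mu> C"
  shows "regular_drift (\<lambda>s x _. B s x (\<mu> s))"
  unfolding regular_drift_def
proof (intro conjI)
  have C: "0 \<le> C" using \<mu> by (auto simp: P1_flow_def intro: order_trans[OF enn2real_nonneg])
  have "\<mu> \<in> restrict_space borel {0..T} \<rightarrow>\<^sub>M P1_borel UNIV"
    using \<mu> by (auto simp: P1_flow_def intro: measurable_restrict_space1)
  then have "(\<lambda>(t, x, \<nu>). (t, x, \<mu> t)) \<in> restrict_space borel {0..T} \<Otimes>\<^sub>M borel \<Otimes>\<^sub>M P1_borel UNIV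
      \<rightarrow>\<^sub>M restrict_space borel {0..T} \<Otimes>\<^sub>M borel \<Otimes>\<^sub>M P1_borel UNIV"
    by measurable
  moreover have "drift_measurable T B" using B by (simp add: regular_drift_def)
  ultimately have "(\<lambda>z. (\<lambda>(t, x, \<nu>). B t x \<nu>) ((\<lambda>(t, x, \<nu>). (t, x, \<mu> t)) z))
      \<in> borel_measurable (restrict_space borel {0..T} \<Otimes>\<^sub>M borel \<Otimes>\<^sub>M P1_borel UNIV)"
    unfolding drift_measurable_def by (rule measurable_compose)
  note comp = this
  have eq: "(\<lambda>z. (\<lambda>(t, x, \<nu>). B t x \<nu>) ((\<lambda>(t, x, \<nu>). (t, x, \<mu> t)) z))
      = (\<lambda>(s, x, _). B s x (\<mu> s))"
    by (rule ext) (simp split: prod.split)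
  show "drift_measurable T (\<lambda>s x _. B s x (\<mu> s))"
    using comp unfolding eq drift_measurable_def .
  obtain k where k: "growth_rate B k" using B by (auto simp: regular_drift_def)
  have "growth_rate (\<lambda>s x _. B s x (\<mu> s)) (\<lambda>s. k s * (1 + C))"
    unfolding growth_rate_def
  proof (intro conjI allI)
    show "integrable lborel (\<lambda>s. k s * (1 + C))" using k by (simp add: growth_rate_def)
    have k_nonneg: "0 \<le> k s" for s using k by (simp add: growth_rate_def)
    then show "0 \<le> k s * (1 + C)" for s using C by simp
    from k have "AE s in lborel. s \<in> {0..T} \<longrightarrow>
        (\<forall>x. \<forall>\<mu>\<in>P1 UNIV. norm (B s x \<mu>) \<le> k s * (1 + norm x + enn2real (moment1 \<mu>)))"
      by (simp add: growth_rate_def)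
    then show "AE s in lborel. s \<in> {0..T} \<longrightarrow> (\<forall>x. \<forall>\<nu>\<in>P1 (UNIV :: (real^'d) set).
        norm (B s x (\<mu> s)) \<le> k s * (1 + C) * (1 + norm x + enn2real (moment1 \<nu>)))"
    proof eventually_elim
      case (elim s)
      have "norm (B s x (\<mu> s)) \<le> k s * (1 + C) * (1 + norm x + enn2real (moment1 \<nu>))"
        if s: "s \<in> {0..T}" for x and \<nu> :: "(real^'d) measure"
      proof -
        have "norm (B s x (\<mu> s)) \<le> k s * (1 + norm x + enn2real (moment1 (\<mu> s)))"
          using elim s P1_flow_P1[OF \<mu>] by blast
        also have "\<dots> \<le> k s * ((1 + C) * (1 + norm x + enn2real (moment1 \<nu>)))"
        proof (rule mult_left_mono[OF _ k_nonneg])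
          have "1 + norm x + enn2real (moment1 (\<mu> s)) \<le> 1 + norm x + C"
            using \<mu> by (simp add: P1_flow_def)
          also have "\<dots> \<le> (1 + C) * (1 + norm x + enn2real (moment1 \<nu>))"
            using C by (simp add: algebra_simps add_increasing)
          finally show "1 + norm x + enn2real (moment1 (\<mu> s)) \<le> (1 + C) * (1 + norm x + enn2real (moment1 \<nu>))" .
        qed
        finally show ?thesis by (simp add: mult.assoc)
      qed
      then show ?case by blast
    qed
  qed
  then show "\<exists>k. growth_rate (\<lambda>s x _. B s x (\<mu> s)) k" by blast
  from B have "AE s in lborel. s \<in> {0..T} \<longrightarrow>
        (\<forall>x y. \<forall>\<mu>\<in>P1 UNIV. \<forall>\<nu>\<in>P1 UNIV.
           norm (B s x \<mu> - B s y \<nu>) \<le> h s * f (norm (x - y) + d1 \<mu> \<nu>))"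
    by (simp add: regular_drift_def)
  then show "AE s in lborel. s \<in> {0..T} \<longrightarrow>
        (\<forall>x y. \<forall>\<kappa>\<in>P1 (UNIV :: (real^'d) set). \<forall>\<nu>\<in>P1 UNIV.
           norm (B s x (\<mu> s) - B s y (\<mu> s)) \<le> h s * f (norm (x - y) + d1 \<kappa> \<nu>))"
  proof eventually_elim
    case (elim s)
    have "norm (B s x (\<mu> s) - B s y (\<mu> s)) \<le> h s * f (norm (x - y) + d1 \<kappa> \<nu>)"
      if s: "s \<in> {0..T}" for x y and \<kappa> \<nu> :: "(real^'d) measure"
    proof -
      have "norm (B s x (\<mu> s) - B s y (\<mu> s)) \<le> h s * f (norm (x - y) + d1 (\<mu> s) (\<mu> s))"
        using elim s P1_flow_P1[OF \<mu>] by blast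
      also have "\<dots> \<le> h s * f (norm (x - y) + d1 \<kappa> \<nu>)"
        using d1_refl[OF P1_flow_P1[OF \<mu>], of s]
        by (intro mult_left_mono monoD[OF mono] h_nonneg) (simp add: d1_def)
      finally show ?thesis .
    qed
    then show ?case by blast
  qed
qed

lemma weak_solution_strong:
  fixes B :: "('d::finite) drift"
  assumes B: "regular_drift B" and \<mu>Y: "\<mu>Y \<in> P1 (C_paths T)" and ws: "weak_solution T B \<mu>Y W X Y"
  obtains \<Phi> where "strong_solution B \<mu>Y \<Phi>" "distr W (path_borel T) X = distr \<mu>Y (path_borel T) \<Phi>"
proof -
  note X_int = weak_solution_integrable(1)[OF B \<mu>Y ws] and Y = weak_solution_integrable(2)[OF B \<mu>Y ws]
  have X: "X \<in> W \<rightarrow>\<^sub>M path_borel T" using X_int by (simp add: integrable_path_def)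
  note flow = law_at_flow[OF X_int]
  have T: "0 \<le> T" using T_pos by simp
  obtain \<Phi> where \<Phi>: "strong_solution (\<lambda>s x _. B s x (law_at W X s)) \<mu>Y \<Phi>"
    using strong_solution_exists[OF regular_drift_along_flow[OF B flow] \<mu>Y] .
  then have \<Phi>_meas: "\<Phi> \<in> path_borel T \<rightarrow>\<^sub>M path_borel T" and \<Phi>_int: "integrable_path T \<mu>Y \<Phi>"
    and \<Phi>_eq: "\<And>y t. y \<in> C_paths T \<Longrightarrow> t \<in> {0..T} \<Longrightarrow> apply_bcontfun (\<Phi> y) t =
        (LBINT s:{0..t}. B s (apply_bcontfun (\<Phi> y) s) (law_at W X s)) + apply_bcontfun y t"
    by (auto simp: strong_solution_def)
  have \<Phi>_path: "\<Phi> y \<in> C_paths T" if "y \<in> C_paths T" for y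
    using measurable_space[OF \<Phi>_meas] that by (simp add: space_path_borel)
  have eqn: "AE \<omega> in W. \<forall>t\<in>{0..T}. apply_bcontfun (X \<omega>) t =
          (LBINT s:{0..t}. B s (apply_bcontfun (X \<omega>) s) (law_at W X s)) + apply_bcontfun (Y \<omega>) t"
    using ws by (auto simp: weak_solution_def)
  have ae: "AE \<omega> in W. X \<omega> = \<Phi> (Y \<omega>)"
    using eqn AE_space
  proof eventually_elim
    case (elim \<omega>)
    have y: "Y \<omega> \<in> C_paths T" using measurable_space[OF Y elim(2)] by (simp add: space_path_borel)
    have x: "X \<omega> \<in> C_paths T" using measurable_space[OF X elim(2)] by (simp add: space_path_borel)
    define e where "e s = dist (apply_bcontfun (X \<omega>) s) (apply_bcontfun (\<Phi> (Y \<omega>)) s)" for s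
    have e_meas: "e \<in> borel_measurable borel" unfolding e_def[abs_def]
      by (intro borel_measurable_continuous_onI continuous_intros continuous_on_apply_bcontfun)
    have e_le: "e s \<le> dist (X \<omega>) (\<Phi> (Y \<omega>))" for s unfolding e_def by (rule dist_bounded)
    have step: "e t \<le> 0 + J e t" if t: "t \<in> {0..T}" for t
    proof -
      have "e t = dist (LBINT s:{0..t}. B s (apply_bcontfun (X \<omega>) s) (law_at W X s))
          (LBINT s:{0..t}. B s (apply_bcontfun (\<Phi> (Y \<omega>)) s) (law_at W X s))"
        using elim(1) t unfolding e_def \<Phi>_eq[OF y t] by simp
      also have "\<dots> \<le> J e t"
        using d1_refl[OF P1_flow_P1[OF flow]]
        by (intro drift_flow_integral_diff[OF B flow flow t e_meas e_le]) (simp add: e_def)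
      finally show ?thesis by simp
    qed
    \<comment> \<open>Equal inputs and equal flows leave no initial term, and
      \<open>M H 0 = 0\<close>.\<close>
    have "0 + J e T \<le> M H 0" by (rule bihari[OF e_meas e_le order_refl step])
    then have "e t \<le> 0" if "t \<in> {0..T}" for t
      using step[OF that] J_le_T[OF e_meas e_le, of t] by simp
    then show ?case by (intro C_paths_eqI[OF T x \<Phi>_path[OF y]]) (simp add: e_def)
  qed
  have law: "distr W (path_borel T) X = distr \<mu>Y (path_borel T) \<Phi>"
  proof -
    have "distr W (path_borel T) X = distr W (path_borel T) (\<Phi> \<circ> Y)"
      using ae X measurable_comp[OF Y \<Phi>_meas] by (intro distr_cong_AE) auto
    also have "\<dots> = distr (distr W (path_borel T) Y) (path_borel T) \<Phi>"
      by (rule distr_distr[OF \<Phi>_meas Y, symmetric])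
    also have "distr W (path_borel T) Y = \<mu>Y" using ws by (simp add: weak_solution_def)
    finally show ?thesis .
  qed
  have "\<Phi> \<in> \<mu>Y \<rightarrow>\<^sub>M path_borel T" using \<Phi>_int by (simp add: integrable_path_def)
  then have "law_at W X t = law_at \<mu>Y \<Phi> t" for t
    using law_at_distr[OF X, of t] law_at_distr[of \<Phi> \<mu>Y T t] law by simp
  then have "strong_solution B \<mu>Y \<Phi>"
    using \<Phi>_meas \<Phi>_int \<Phi>_eq by (simp add: strong_solution_def)
  then show thesis using law by (rule that)
qed

end

section \<open>Stability\<close>

context osgood_kernel
begin

lemma couplings_paths:
  fixes \<mu>1 :: "('d::finite) path measure"
  assumes "\<mu>1 \<in> P1 (C_paths T)" "\<mu>2 \<in> P1 (C_paths T)" "\<pi> \<in> couplings \<mu>1 \<mu>2"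
  shows "space \<pi> = C_paths T \<times> C_paths T"
    and "fst \<in> \<pi> \<rightarrow>\<^sub>M path_borel T" "snd \<in> \<pi> \<rightarrow>\<^sub>M path_borel T"
    and "fst \<in> \<pi> \<rightarrow>\<^sub>M \<mu>1" "snd \<in> \<pi> \<rightarrow>\<^sub>M \<mu>2"
    and "distr \<pi> \<mu>1 fst = \<mu>1" "distr \<pi> \<mu>2 snd = \<mu>2"
proof -
  note s1 = P1_paths[OF assms(1)] and s2 = P1_paths[OF assms(2)]
  have sets_\<pi>: "sets \<pi> = sets (path_borel T \<Otimes>\<^sub>M path_borel T)"
    using assms(3) s1 s2 sets_pair_measure_cong[of \<mu>1 "path_borel T" \<mu>2 "path_borel T"]
    by (simp add: couplings_def)
  show "space \<pi> = C_paths T \<times> C_paths T"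
    using sets_eq_imp_space_eq[OF sets_\<pi>] by (simp add: space_pair_measure space_path_borel)
  show fst\<pi>: "fst \<in> \<pi> \<rightarrow>\<^sub>M path_borel T" and snd\<pi>: "snd \<in> \<pi> \<rightarrow>\<^sub>M path_borel T"
    using measurable_cong_sets[OF sets_\<pi> refl] by auto
  show "fst \<in> \<pi> \<rightarrow>\<^sub>M \<mu>1" "snd \<in> \<pi> \<rightarrow>\<^sub>M \<mu>2"
    using fst\<pi> snd\<pi> measurable_cong_sets[OF refl s1(2), of \<pi>] measurable_cong_sets[OF refl s2(2), of \<pi>]
    by auto
  show "distr \<pi> \<mu>1 fst = \<mu>1" "distr \<pi> \<mu>2 snd = \<mu>2" using assms(3) by (auto simp: couplings_def)
qed

text \<open>
  The factor \<open>2\<close> comes from \<open>f (z + e) \<le> (1 + z / e) f e\<close>, whose right-hand side has expectation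
  \<open>2 f e\<close> when \<open>e\<close> is the mean of \<open>z\<close>; it replaces Jensen's inequality.
\<close>

lemma nn_integral_modulus_le:
  assumes Z [measurable]: "Z \<in> borel_measurable W" and W: "prob_space W" and Z_nonneg: "\<And>x. 0 \<le> Z x"
    and e: "0 \<le> e" "(\<integral>\<^sup>+ x. ennreal (Z x) \<partial>W) = ennreal e"
  shows "(\<integral>\<^sup>+ x. ennreal (f (Z x + e)) \<partial>W) \<le> ennreal (2 * f e)"
proof (cases "e = 0")
  case True
  then have "AE x in W. ennreal (Z x) = 0"
    using nn_integral_0_iff_AE[of "\<lambda>x. ennreal (Z x)" W] e(2) by simp
  then have "AE x in W. ennreal (f (Z x + e)) = 0"
  proof eventually_elim
    case (elim x)
    then have "Z x = 0" using Z_nonneg[of x] by (simp add: ennreal_eq_0_iff)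
    then show ?case using True zero by simp
  qed
  then have "(\<integral>\<^sup>+ x. ennreal (f (Z x + e)) \<partial>W) = 0" by (subst nn_integral_0_iff_AE) auto
  then show ?thesis by simp
next
  case False
  then have e0: "0 < e" using e by simp
  interpret prob_space W by fact
  have "f (Z x + e) \<le> f e / e * Z x + f e" for x
  proof -
    have "f ((Z x + e) / e * e) \<le> (Z x + e) / e * f e"
      using e0 Z_nonneg[of x] by (intro scale) auto
    moreover have "(Z x + e) / e * e = Z x + e" "(Z x + e) / e * f e = f e / e * Z x + f e"
      using e0 by (simp_all add: field_simps)
    ultimately show ?thesis by (simp only:)
  qed
  then have "(\<integral>\<^sup>+ x. ennreal (f (Z x + e)) \<partial>W) \<le> (\<integral>\<^sup>+ x. ennreal (f e / e) * ennreal (Z x) + ennreal (f e) \<partial>W)"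
    using Z_nonneg nonneg e0
    by (intro nn_integral_mono) (auto simp flip: ennreal_mult ennreal_plus intro!: ennreal_leI)
  also have "\<dots> = ennreal (f e / e) * ennreal e + ennreal (f e)"
    using e(2) by (simp add: nn_integral_add nn_integral_cmult emeasure_space_1)
  also have "\<dots> = ennreal (2 * f e)"
    using e0 nonneg[of e] by (simp flip: ennreal_mult ennreal_plus)
  finally show ?thesis .
qed

text \<open>Inserts \<open>B1\<close> evaluated along the second path and flow. Moving the arguments
  under \<open>B1\<close> costs \<open>J r t\<close>; exchanging the drift at fixed arguments costs
  \<open>D\<close> per unit of time.\<close>

lemma drift_flow_integral_dist:
  fixes v w :: "('d::finite) path"
  assumes B1: "regular_drift B1" and B2: "regular_drift B2"
    and D: "drift_dist T B1 B2 \<le> ennreal D" "0 \<le> D"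
    and \<mu>: "P1_flow \<mu> C" and \<nu>: "P1_flow \<nu> C'" and t: "t \<in> {0..T}"
    and r: "r \<in> borel_measurable borel" "\<And>s. r s \<le> R"
    and le: "\<And>s. s \<in> {0..T} \<Longrightarrow>
      dist (apply_bcontfun v s) (apply_bcontfun w s) + d1 (\<mu> s) (\<nu> s) \<le> r s"
  shows "dist (LBINT s:{0..t}. B1 s (apply_bcontfun v s) (\<mu> s))
      (LBINT s:{0..t}. B2 s (apply_bcontfun w s) (\<nu> s)) \<le> J r t + T * D"
proof -
  let ?b1 = "\<lambda>s. B1 s (apply_bcontfun w s) (\<nu> s)" and ?b2 = "\<lambda>s. B2 s (apply_bcontfun w s) (\<nu> s)"
  have int1: "set_integrable lborel {0..t} ?b1"
    using t by (intro drift_flow_integrable[OF B1 \<nu>]) auto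
  have int2: "set_integrable lborel {0..t} ?b2"
    using t by (intro drift_flow_integrable[OF B2 \<nu>]) auto
  note int = set_integral_diff[OF int1 int2]
  have intD: "set_integrable lborel {0..t} (\<lambda>_. D)"
    by (rule borel_integrable_atLeastAtMost') simp
  have "norm (LBINT s:{0..t}. ?b1 s - ?b2 s) \<le> (LBINT s:{0..t}. norm (?b1 s - ?b2 s))"
    by (rule set_integral_norm_bound[OF int(1)])
  also have "\<dots> \<le> (LBINT s:{0..t}. D)"
  proof (rule set_integral_mono[OF set_integrable_norm[OF int(1)] intD])
    fix s assume "s \<in> {0..t}"
    then have "(s, apply_bcontfun w s, \<nu> s) \<in> {0..T} \<times> UNIV \<times> P1 UNIV"
      using t P1_flow_P1[OF \<nu>] by auto
    then have "ennreal (norm (?b1 s - ?b2 s)) \<le> drift_dist T B1 B2"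
      unfolding drift_dist_def by (rule SUP_upper2) simp
    also note D(1)
    finally show "norm (?b1 s - ?b2 s) \<le> D" using D(2) by simp
  qed
  also have "\<dots> = t * D" using t by (simp add: set_lebesgue_integral_def)
  also have "\<dots> \<le> T * D" using t D(2) by (intro mult_right_mono) auto
  finally have "dist (LBINT s:{0..t}. ?b1 s) (LBINT s:{0..t}. ?b2 s) \<le> T * D"
    unfolding int(2) dist_norm .
  then show ?thesis
    using drift_flow_integral_diff[OF B1 \<mu> \<nu> t r le]
    by (intro order_trans[OF dist_triangle add_mono]) auto
qed

text \<open>The supremum over time needs no maximal inequality. The pathwise bound is largest at
  \<open>T\<close>, where it dominates the distance of the whole paths, and its mean there is at
  most \<open>c + T * D + 2 * J e T\<close>, the very quantity that Bihari's inequality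
  controls.\<close>

lemma strong_solution_stability:
  fixes B1 B2 :: "('d::finite) drift"
  assumes B1: "regular_drift B1" and B2: "regular_drift B2"
    and \<mu>1: "\<mu>1 \<in> P1 (C_paths T)" and \<mu>2: "\<mu>2 \<in> P1 (C_paths T)"
    and \<Phi>1: "strong_solution B1 \<mu>1 \<Phi>1" and \<Phi>2: "strong_solution B2 \<mu>2 \<Phi>2"
    and \<pi>: "\<pi> \<in> couplings \<mu>1 \<mu>2"
    and c: "(\<integral>\<^sup>+ z. ennreal (dist (fst z) (snd z)) \<partial>\<pi>) = ennreal c" "0 \<le> c"
    and D: "drift_dist T B1 B2 \<le> ennreal D" "0 \<le> D"
  shows "(\<integral>\<^sup>+ z. ennreal (dist (\<Phi>1 (fst z)) (\<Phi>2 (snd z))) \<partial>\<pi>) \<le> ennreal (M (2 * H) (c + T * D))"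
proof -
  note cp = couplings_paths[OF \<mu>1 \<mu>2 \<pi>]
  note s1 = P1_paths[OF \<mu>1] and m1 = cp(4) and m2 = cp(5) and d1\<pi> = cp(6) and d2\<pi> = cp(7)
    and fst\<pi> = cp(2) and snd\<pi> = cp(3) and space_\<pi> = cp(1)
  have T: "0 \<le> T" using T_pos by simp
  interpret \<pi>: prob_space \<pi>
    using prob_space_distrD[OF m1] s1(1) d1\<pi> by simp
  define X1 where "X1 z = \<Phi>1 (fst z)" for z :: "'d path \<times> 'd path"
  define X2 where "X2 z = \<Phi>2 (snd z)" for z :: "'d path \<times> 'd path"
  have \<Phi>1_meas: "\<Phi>1 \<in> path_borel T \<rightarrow>\<^sub>M path_borel T" and \<Phi>1_int: "integrable_path T \<mu>1 \<Phi>1"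
    using \<Phi>1 by (auto simp: strong_solution_def)
  have \<Phi>2_meas: "\<Phi>2 \<in> path_borel T \<rightarrow>\<^sub>M path_borel T" and \<Phi>2_int: "integrable_path T \<mu>2 \<Phi>2"
    using \<Phi>2 by (auto simp: strong_solution_def)
  have X1: "X1 \<in> \<pi> \<rightarrow>\<^sub>M path_borel T" unfolding X1_def[abs_def] by (rule measurable_compose[OF fst\<pi> \<Phi>1_meas])
  have X2: "X2 \<in> \<pi> \<rightarrow>\<^sub>M path_borel T" unfolding X2_def[abs_def] by (rule measurable_compose[OF snd\<pi> \<Phi>2_meas])
  have \<Phi>1_\<mu>: "\<Phi>1 \<in> \<mu>1 \<rightarrow>\<^sub>M path_borel T" and \<Phi>2_\<mu>: "\<Phi>2 \<in> \<mu>2 \<rightarrow>\<^sub>M path_borel T"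
    using \<Phi>1_int \<Phi>2_int by (auto simp: integrable_path_def)
  \<comment> \<open>Both flows are rewritten as flows of processes on the coupling space, where a
    common sample point lets \<open>d1_law_le\<close> compare them.\<close>
  have law1: "law_at \<mu>1 \<Phi>1 s = law_at \<pi> X1 s" for s
  proof -
    have "distr \<mu>1 (path_borel T) \<Phi>1 = distr \<pi> (path_borel T) (\<Phi>1 \<circ> fst)"
      using distr_distr[OF \<Phi>1_\<mu> m1] d1\<pi> by simp
    then show ?thesis
      using law_at_distr[OF \<Phi>1_\<mu>, of s] law_at_distr[OF X1, of s] by (simp add: X1_def[abs_def] comp_def)
  qed
  have law2: "law_at \<mu>2 \<Phi>2 s = law_at \<pi> X2 s" for s
  proof -
    have "distr \<mu>2 (path_borel T) \<Phi>2 = distr \<pi> (path_borel T) (\<Phi>2 \<circ> snd)"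
      using distr_distr[OF \<Phi>2_\<mu> m2] d2\<pi> by simp
    then show ?thesis
      using law_at_distr[OF \<Phi>2_\<mu>, of s] law_at_distr[OF X2, of s] by (simp add: X2_def[abs_def] comp_def)
  qed
  have flow1: "P1_flow (law_at \<pi> X1) (mean_norm \<mu>1 \<Phi>1)"
    using law_at_flow[OF \<Phi>1_int] unfolding law1[abs_def] .
  have flow2: "P1_flow (law_at \<pi> X2) (mean_norm \<mu>2 \<Phi>2)"
    using law_at_flow[OF \<Phi>2_int] unfolding law2[abs_def] .
  note [measurable] = path_dist_measurable[OF X1 X2] path_dist_measurable[OF fst\<pi> snd\<pi>]
    path_borel_to_borel[OF X1] path_borel_to_borel[OF X2] joint_path_measurable[OF X1] joint_path_measurable[OF X2]
    evaluation_measurable[OF X1] evaluation_measurable[OF X2]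
  define Z where "Z s z = dist (apply_bcontfun (X1 z) s) (apply_bcontfun (X2 z) s)" for s z
  define E where "E s = (\<integral>\<^sup>+ z. ennreal (Z s z) \<partial>\<pi>)" for s
  define e where "e s = enn2real (E s)" for s
  have Z_joint [measurable]: "(\<lambda>x. Z (snd x) (fst x)) \<in> borel_measurable (\<pi> \<Otimes>\<^sub>M lborel)"
    unfolding Z_def by measurable
  have Z_joint' [measurable]: "(\<lambda>x. Z (fst x) (snd x)) \<in> borel_measurable (lborel \<Otimes>\<^sub>M \<pi>)"
    using measurable_compose[OF measurable_pair_swap' Z_joint] by (simp add: case_prod_beta)
  have Z_meas [measurable]: "Z s \<in> borel_measurable \<pi>" for s
    unfolding Z_def[abs_def] by measurable
  have E_meas [measurable]: "E \<in> borel_measurable borel"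
  proof -
    have "(\<lambda>s. \<integral>\<^sup>+ z. ennreal (Z s z) \<partial>\<pi>) \<in> borel_measurable lborel"
      by (intro \<pi>.borel_measurable_nn_integral) (simp add: case_prod_beta)
    then show ?thesis unfolding E_def[abs_def] by simp
  qed
  have e_meas [measurable]: "e \<in> borel_measurable borel" unfolding e_def[abs_def] by measurable
  have e_nonneg: "0 \<le> e s" for s by (simp add: e_def)
  have norm1: "(\<integral>\<^sup>+ z. ennreal (norm (X1 z)) \<partial>\<pi>) < \<infinity>"
  proof -
    have "(\<integral>\<^sup>+ z. ennreal (norm (X1 z)) \<partial>\<pi>) = (\<integral>\<^sup>+ y. ennreal (norm (\<Phi>1 y)) \<partial>distr \<pi> \<mu>1 fst)"
      unfolding X1_def using path_borel_to_borel[OF \<Phi>1_\<mu>]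
      by (intro nn_integral_distr[OF m1, symmetric]) measurable
    then show ?thesis using \<Phi>1_int by (simp add: d1\<pi> integrable_path_def)
  qed
  have norm2: "(\<integral>\<^sup>+ z. ennreal (norm (X2 z)) \<partial>\<pi>) < \<infinity>"
  proof -
    have "(\<integral>\<^sup>+ z. ennreal (norm (X2 z)) \<partial>\<pi>) = (\<integral>\<^sup>+ y. ennreal (norm (\<Phi>2 y)) \<partial>distr \<pi> \<mu>2 snd)"
      unfolding X2_def using path_borel_to_borel[OF \<Phi>2_\<mu>]
      by (intro nn_integral_distr[OF m2, symmetric]) measurable
    then show ?thesis using \<Phi>2_int by (simp add: d2\<pi> integrable_path_def)
  qed
  define R where "R = (\<integral>\<^sup>+ z. ennreal (norm (X1 z)) \<partial>\<pi>) + (\<integral>\<^sup>+ z. ennreal (norm (X2 z)) \<partial>\<pi>)"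
  have R: "R < \<infinity>" using norm1 norm2 by (simp add: R_def)
  have E_le: "E s \<le> R" for s
  proof -
    have "Z s z \<le> norm (X1 z) + norm (X2 z)" for z
      using norm_bounded[of "X1 z" s] norm_bounded[of "X2 z" s]
        norm_triangle_ineq4[of "apply_bcontfun (X1 z) s" "apply_bcontfun (X2 z) s"]
      by (simp add: Z_def dist_norm)
    then have "E s \<le> (\<integral>\<^sup>+ z. ennreal (norm (X1 z)) + ennreal (norm (X2 z)) \<partial>\<pi>)"
      unfolding E_def by (intro nn_integral_mono) (simp flip: ennreal_plus add: ennreal_leI)
    also have "\<dots> = R" unfolding R_def by (rule nn_integral_add) measurable
    finally show ?thesis .
  qed
  have e_le: "e s \<le> enn2real R" for s
    unfolding e_def using E_le R by (intro enn2real_mono) auto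
  have E_e: "E s = ennreal (e s)" for s
    using E_le[of s] R by (simp add: e_def order_le_less_trans)
  have d1_le: "d1 (law_at \<pi> X1 s) (law_at \<pi> X2 s) \<le> e s" for s
    by (rule d1_law_le[OF X1 X2 e_nonneg]) (simp add: E_e[symmetric] E_def Z_def)
  \<comment> \<open>The pathwise displacement plus its mean, the latter standing in for
    \<open>d1\<close> of the marginals.\<close>
  define q where "q z s = Z s z + e s" for z s
  have q_meas [measurable]: "q z \<in> borel_measurable borel" for z
  proof -
    have "Z_z \<in> borel_measurable borel" if "Z_z = (\<lambda>s. Z s z)" for Z_z
      unfolding that Z_def by (intro borel_measurable_continuous_onI continuous_intros continuous_on_apply_bcontfun)
    then have [measurable]: "(\<lambda>s. Z s z) \<in> borel_measurable borel" by blast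
    show ?thesis unfolding q_def[abs_def] by measurable
  qed
  have q_le: "q z s \<le> dist (X1 z) (X2 z) + enn2real R" for z s
    unfolding q_def Z_def by (intro add_mono dist_bounded e_le)
  have diff: "Z t z \<le> dist (fst z) (snd z) + T * D + J (q z) t" if z: "z \<in> space \<pi>" and t: "t \<in> {0..T}" for z t
  proof -
    have y: "fst z \<in> C_paths T" "snd z \<in> C_paths T" using z by (auto simp: space_\<pi>)
    have "apply_bcontfun (X1 z) t =
        (LBINT s:{0..t}. B1 s (apply_bcontfun (X1 z) s) (law_at \<pi> X1 s)) + apply_bcontfun (fst z) t"
      using \<Phi>1 y t unfolding strong_solution_def X1_def law1[symmetric, unfolded X1_def[abs_def]] by blast
    moreover have "apply_bcontfun (X2 z) t =
        (LBINT s:{0..t}. B2 s (apply_bcontfun (X2 z) s) (law_at \<pi> X2 s)) + apply_bcontfun (snd z) t"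
      using \<Phi>2 y t unfolding strong_solution_def X2_def law2[symmetric, unfolded X2_def[abs_def]] by blast
    moreover have "dist (LBINT s:{0..t}. B1 s (apply_bcontfun (X1 z) s) (law_at \<pi> X1 s))
        (LBINT s:{0..t}. B2 s (apply_bcontfun (X2 z) s) (law_at \<pi> X2 s)) \<le> J (q z) t + T * D"
      by (rule drift_flow_integral_dist[OF B1 B2 D flow1 flow2 t q_meas q_le])
        (simp add: q_def Z_def d1_le)
    ultimately have "Z t z \<le> (J (q z) t + T * D) + dist (fst z) (snd z)"
      unfolding Z_def using dist_bounded[of "fst z" t "snd z"]
      by (simp only:) (intro order_trans[OF dist_triangle_add add_mono])
    then show ?thesis by simp
  qed
  \<comment> \<open>The factor 2 that \<open>nn_integral_modulus_le\<close> produces on averaging is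
    put into the kernel; this is the origin of \<open>2 * H\<close> in the final bound.\<close>
  interpret K: osgood_kernel f T "\<lambda>s. 2 * h s" by (intro kernel_scale) simp
  have KJ: "K.J r t = 2 * J r t" for r t by (intro J_kernel_scale) simp
  have KH: "K.H = 2 * H" by (simp add: K.H_def H_def)
  have J_joint [measurable]: "(\<lambda>z. J (q z) t) \<in> borel_measurable \<pi>" for t
    unfolding J_def set_lebesgue_integral_def q_def
    by (intro lborel.borel_measurable_lebesgue_integral) (simp add: case_prod_beta)
  \<comment> \<open>Tonelli brings the expectation inside the time integral, where
    \<open>e s\<close> is exactly the mean of \<open>Z s\<close>, as
    \<open>nn_integral_modulus_le\<close> requires.\<close>
  have mean_J: "(\<integral>\<^sup>+ z. ennreal (J (q z) t) \<partial>\<pi>) \<le> ennreal (2 * J e t)" for t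
  proof -
    have "(\<integral>\<^sup>+ z. ennreal (J (q z) t) \<partial>\<pi>)
        = (\<integral>\<^sup>+ z. (\<integral>\<^sup>+ s. ennreal (indicator {..t} s * (h s * f (Z s z + e s))) \<partial>lborel) \<partial>\<pi>)"
    proof (rule nn_integral_cong)
      fix z
      have "integrable lborel (\<lambda>s. indicator {..t} s * (h s * f (q z s)))"
        using kernel_set_integrable[OF q_meas q_le, of "{..t}"] by (simp add: set_integrable_def)
      then show "ennreal (J (q z) t) = (\<integral>\<^sup>+ s. ennreal (indicator {..t} s * (h s * f (Z s z + e s))) \<partial>lborel)"
        unfolding J_def set_lebesgue_integral_def q_def real_scaleR_def
        by (intro nn_integral_eq_integral[symmetric]) (auto simp: h_nonneg nonneg)
    qed
    also have "\<dots> = (\<integral>\<^sup>+ s. (\<integral>\<^sup>+ z. ennreal (indicator {..t} s * (h s * f (Z s z + e s))) \<partial>\<pi>) \<partial>lborel)"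
    proof -
      interpret pair_sigma_finite \<pi> lborel
        by (intro pair_sigma_finite.intro \<pi>.sigma_finite_measure_axioms lborel.sigma_finite_measure_axioms)
      have "case_prod (\<lambda>z s. ennreal (indicator {..t} s * (h s * f (Z s z + e s)))) \<in> borel_measurable (\<pi> \<Otimes>\<^sub>M lborel)"
        unfolding case_prod_beta by measurable
      from Fubini'[OF this] show ?thesis by (rule sym)
    qed
    also have "\<dots> \<le> (\<integral>\<^sup>+ s. ennreal (2 * (indicator {..t} s * (h s * f (e s)))) \<partial>lborel)"
    proof (rule nn_integral_mono)
      fix s
      have "(\<integral>\<^sup>+ z. ennreal (indicator {..t} s * (h s * f (Z s z + e s))) \<partial>\<pi>)
          = ennreal (indicator {..t} s * h s) * (\<integral>\<^sup>+ z. ennreal (f (Z s z + e s)) \<partial>\<pi>)"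
        using h_nonneg[of s] nonneg
        by (subst nn_integral_cmult[symmetric]) (auto simp: mult.assoc simp flip: ennreal_mult)
      also have "\<dots> \<le> ennreal (indicator {..t} s * h s) * ennreal (2 * f (e s))"
        by (intro mult_left_mono nn_integral_modulus_le \<pi>.prob_space_axioms e_nonneg)
          (auto simp: E_e[symmetric] E_def, simp add: Z_def)
      also have "\<dots> = ennreal (2 * (indicator {..t} s * (h s * f (e s))))"
        using h_nonneg[of s] nonneg by (subst ennreal_mult[symmetric]) (auto simp: ac_simps)
      finally show "(\<integral>\<^sup>+ z. ennreal (indicator {..t} s * (h s * f (Z s z + e s))) \<partial>\<pi>)
          \<le> ennreal (2 * (indicator {..t} s * (h s * f (e s))))" .
    qed
    also have "\<dots> = ennreal (LINT s|lborel. 2 * (indicator {..t} s * (h s * f (e s))))"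
      using kernel_set_integrable[OF e_meas e_le, of "{..t}"]
      by (intro nn_integral_eq_integral) (auto simp: set_integrable_def h_nonneg nonneg)
    also have "(LINT s|lborel. 2 * (indicator {..t} s * (h s * f (e s)))) = 2 * J e t"
      unfolding J_def set_lebesgue_integral_def real_scaleR_def by simp
    finally show ?thesis .
  qed
  have TD: "0 \<le> T * D" using T D(2) by simp
  have total: "(\<integral>\<^sup>+ z. ennreal (dist (fst z) (snd z) + T * D + J (q z) t) \<partial>\<pi>) \<le> ennreal (c + T * D + 2 * J e t)" for t
  proof -
    have "(\<integral>\<^sup>+ z. ennreal (dist (fst z) (snd z) + T * D + J (q z) t) \<partial>\<pi>)
        = (\<integral>\<^sup>+ z. ennreal (dist (fst z) (snd z)) + ennreal (T * D) + ennreal (J (q z) t) \<partial>\<pi>)"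
      using TD J_nonneg by (intro nn_integral_cong) simp
    also have "\<dots> = ennreal c + ennreal (T * D) + (\<integral>\<^sup>+ z. ennreal (J (q z) t) \<partial>\<pi>)"
      by (simp add: nn_integral_add c(1) \<pi>.emeasure_space_1)
    also have "\<dots> \<le> ennreal c + ennreal (T * D) + ennreal (2 * J e t)"
      by (intro add_left_mono mean_J)
    also have "\<dots> = ennreal (c + T * D + 2 * J e t)"
      using c(2) TD J_nonneg[of e t] by simp
    finally show ?thesis .
  qed
  have "e t \<le> (c + T * D) + K.J e t" if t: "t \<in> {0..T}" for t
  proof -
    have "ennreal (e t) \<le> (\<integral>\<^sup>+ z. ennreal (dist (fst z) (snd z) + T * D + J (q z) t) \<partial>\<pi>)"
      unfolding E_e[symmetric] E_def using diff[OF _ t] by (intro nn_integral_mono ennreal_leI)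
    also note total
    finally have "ennreal (e t) \<le> ennreal (c + T * D + 2 * J e t)" .
    then have "e t \<le> c + T * D + 2 * J e t"
      by (subst (asm) ennreal_le_iff) (use c(2) TD J_nonneg[of e t] in auto)
    then show ?thesis by (simp add: KJ)
  qed
  then have bihari: "c + T * D + K.J e T \<le> M (2 * H) (c + T * D)"
    unfolding KH[symmetric] using c(2) TD by (intro K.bihari[OF e_meas e_le]) auto
  \<comment> \<open>\<open>J (q z)\<close> is largest at \<open>T\<close>, so one bound serves all
    times.\<close>
  have "dist (X1 z) (X2 z) \<le> dist (fst z) (snd z) + T * D + J (q z) T" if z: "z \<in> space \<pi>" for z
  proof (rule C_paths_dist_bound[OF T])
    show "X1 z \<in> C_paths T" "X2 z \<in> C_paths T"
      using measurable_space[OF X1 z] measurable_space[OF X2 z] by (auto simp: space_path_borel)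
    show "dist (apply_bcontfun (X1 z) t) (apply_bcontfun (X2 z) t) \<le> dist (fst z) (snd z) + T * D + J (q z) T"
      if "t \<in> {0..T}" for t
      using diff[OF z that] J_le_T[OF q_meas q_le, of z t] by (simp add: Z_def)
  qed
  then have "(\<integral>\<^sup>+ z. ennreal (dist (X1 z) (X2 z)) \<partial>\<pi>) \<le> ennreal (c + T * D + 2 * J e T)"
    using total[of T] by (intro order_trans[OF nn_integral_mono total[of T]] ennreal_leI)
  also have "\<dots> \<le> ennreal (M (2 * H) (c + T * D))"
    using bihari by (intro ennreal_leI) (simp add: KJ)
  finally show ?thesis by (simp add: X1_def X2_def)
qed


section \<open>From solution maps back to laws\<close>

lemma weak_solution_law_exists:
  fixes B :: "('d::finite) drift"
  assumes B: "regular_drift B" and \<mu>Y: "\<mu>Y \<in> P1 (C_paths T)"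
  shows "\<exists>\<mu>X. weak_solution_law T B \<mu>Y \<mu>X"
proof -
  obtain \<Phi> where \<Phi>: "strong_solution B \<mu>Y \<Phi>" using strong_solution_exists[OF B \<mu>Y] .
  then have \<Phi>_meas: "\<Phi> \<in> path_borel T \<rightarrow>\<^sub>M path_borel T" and \<Phi>_int: "integrable_path T \<mu>Y \<Phi>"
    and \<Phi>_eq: "\<And>y t. y \<in> C_paths T \<Longrightarrow> t \<in> {0..T} \<Longrightarrow> apply_bcontfun (\<Phi> y) t =
        (LBINT s:{0..t}. B s (apply_bcontfun (\<Phi> y) s) (law_at \<mu>Y \<Phi> s)) + apply_bcontfun y t"
    by (auto simp: strong_solution_def)
  note s = P1_paths[OF \<mu>Y]
  \<comment> \<open>\<open>weak_solution_law\<close> asks for a sample space of pairs of paths. The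
    input law is placed on the diagonal, and the solution is read off from the first coordinate,
    which is the input.\<close>
  define W where "W = distr \<mu>Y (path_borel T \<Otimes>\<^sub>M path_borel T) (\<lambda>y. (y, y))"
  define X where "X = (\<lambda>\<omega> :: 'd path \<times> 'd path. \<Phi> (fst \<omega>))"
  have id: "(\<lambda>y. y) \<in> \<mu>Y \<rightarrow>\<^sub>M path_borel T" using s(2) by (rule measurable_ident_sets)
  have diag: "(\<lambda>y. (y, y)) \<in> \<mu>Y \<rightarrow>\<^sub>M path_borel T \<Otimes>\<^sub>M path_borel T"
    by (rule measurable_Pair[OF id id])
  have fst_meas: "fst \<in> W \<rightarrow>\<^sub>M path_borel T" by (simp add: W_def)
  have X_meas: "X \<in> W \<rightarrow>\<^sub>M path_borel T"
    unfolding X_def by (rule measurable_compose[OF fst_meas \<Phi>_meas])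
  have fst_law: "distr W (path_borel T) fst = \<mu>Y"
  proof -
    have "distr W (path_borel T) fst = distr \<mu>Y (path_borel T) (\<lambda>y. y)"
      unfolding W_def using diag by (subst distr_distr) (auto simp: comp_def)
    also have "\<dots> = \<mu>Y" using s(2) by (intro distr_id2) simp
    finally show ?thesis .
  qed
  have X_law: "distr W (path_borel T) X = distr \<mu>Y (path_borel T) \<Phi>"
    using distr_distr[OF \<Phi>_meas fst_meas] fst_law by (simp add: X_def comp_def)
  have law: "law_at W X t = law_at \<mu>Y \<Phi> t" for t
    using law_at_distr[OF X_meas, of t] law_at_distr[of \<Phi> \<mu>Y T t] X_law \<Phi>_int
    by (simp add: integrable_path_def)
  have W_space: "fst \<omega> \<in> C_paths T" if "\<omega> \<in> space W" for \<omega>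
    using measurable_space[OF fst_meas that] by (simp add: space_path_borel)
  have "weak_solution T B \<mu>Y W X fst"
    unfolding weak_solution_def law
  proof (intro conjI AE_I2 ballI)
    show "prob_space W" unfolding W_def by (rule prob_space.prob_space_distr[OF s(1) diag])
    show "(\<lambda>\<omega>. (X \<omega>, fst \<omega>)) \<in> W \<rightarrow>\<^sub>M path_borel T \<Otimes>\<^sub>M path_borel T"
      by (rule measurable_Pair[OF X_meas fst_meas])
    show "distr W (path_borel T) fst = \<mu>Y" by (fact fst_law)
    have "(SUP t\<in>{0..T}. moment1 (law_at \<mu>Y \<Phi> t)) \<le> (\<integral>\<^sup>+ y. ennreal (norm (\<Phi> y)) \<partial>\<mu>Y)"
      using \<Phi>_int by (intro SUP_least moment1_law_at_le) (auto simp: integrable_path_def)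
    then show "(SUP t\<in>{0..T}. moment1 (law_at \<mu>Y \<Phi> t)) < \<infinity>"
      using \<Phi>_int by (auto simp: integrable_path_def)
    show "set_integrable lborel {0..T} (\<lambda>t. B t (apply_bcontfun (X \<omega>) t) (law_at \<mu>Y \<Phi> t))" for \<omega>
      by (rule drift_flow_integrable[OF B law_at_flow[OF \<Phi>_int]]) auto
    show "apply_bcontfun (X \<omega>) t =
        (LBINT s:{0..t}. B s (apply_bcontfun (X \<omega>) s) (law_at \<mu>Y \<Phi> s)) + apply_bcontfun (fst \<omega>) t"
      if "\<omega> \<in> space W" "t \<in> {0..T}" for \<omega> t
      unfolding X_def by (rule \<Phi>_eq[OF W_space that(2)]) (fact that(1))
  qed
  then show ?thesis unfolding weak_solution_law_def by blast
qed

text \<open>Stability is applied to the diagonal coupling with equal drifts: the cost is 0, so the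
  two solution maps agree almost everywhere. Working with the maps avoids having to show that laws
  at Wasserstein distance 0 coincide.\<close>

lemma weak_solution_law_unique:
  fixes B :: "('d::finite) drift"
  assumes B: "regular_drift B" and \<mu>Y: "\<mu>Y \<in> P1 (C_paths T)"
    and ws: "weak_solution T B \<mu>Y W X Y" and ws': "weak_solution T B \<mu>Y W' X' Y'"
  shows "distr W (path_borel T) X = distr W' (path_borel T) X'"
proof -
  obtain \<Phi> where \<Phi>: "strong_solution B \<mu>Y \<Phi>" "distr W (path_borel T) X = distr \<mu>Y (path_borel T) \<Phi>"
    using weak_solution_strong[OF B \<mu>Y ws] .
  obtain \<Phi>' where \<Phi>': "strong_solution B \<mu>Y \<Phi>'" "distr W' (path_borel T) X' = distr \<mu>Y (path_borel T) \<Phi>'"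
    using weak_solution_strong[OF B \<mu>Y ws'] .
  have meas: "\<Phi> \<in> \<mu>Y \<rightarrow>\<^sub>M path_borel T" "\<Phi>' \<in> \<mu>Y \<rightarrow>\<^sub>M path_borel T"
    using \<Phi>(1) \<Phi>'(1) by (auto simp: strong_solution_def integrable_path_def)
  have meas': "\<Phi> \<in> path_borel T \<rightarrow>\<^sub>M path_borel T" "\<Phi>' \<in> path_borel T \<rightarrow>\<^sub>M path_borel T"
    using \<Phi>(1) \<Phi>'(1) by (auto simp: strong_solution_def)
  define \<pi> where "\<pi> = distr \<mu>Y (\<mu>Y \<Otimes>\<^sub>M \<mu>Y) (\<lambda>y. (y, y))"
  have diag: "(\<lambda>y. (y, y)) \<in> \<mu>Y \<rightarrow>\<^sub>M \<mu>Y \<Otimes>\<^sub>M \<mu>Y" by simp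
  have \<pi>: "\<pi> \<in> couplings \<mu>Y \<mu>Y"
    unfolding couplings_def \<pi>_def using distr_id2[of \<mu>Y \<mu>Y] by (simp add: distr_distr comp_def)
  note cp = couplings_paths[OF \<mu>Y \<mu>Y \<pi>]
  have push: "(\<integral>\<^sup>+ z. ennreal (g z) \<partial>\<pi>) = (\<integral>\<^sup>+ y. ennreal (g (y, y)) \<partial>\<mu>Y)"
    if "g \<in> borel_measurable \<pi>" for g
    using nn_integral_distr[OF diag, of "\<lambda>z. ennreal (g z)"] that by (simp add: \<pi>_def)
  have "drift_dist T B B \<le> ennreal 0" unfolding drift_dist_def by (intro SUP_least) auto
  moreover have "(\<integral>\<^sup>+ z. ennreal (dist (fst z) (snd z)) \<partial>\<pi>) = ennreal 0"
    using push[OF path_dist_measurable[OF cp(2,3)]] by simp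
  ultimately have "(\<integral>\<^sup>+ z. ennreal (dist (\<Phi> (fst z)) (\<Phi>' (snd z))) \<partial>\<pi>) \<le> ennreal (M (2 * H) (0 + T * 0))"
    by (intro strong_solution_stability[OF B B \<mu>Y \<mu>Y \<Phi>(1) \<Phi>'(1) \<pi>]) auto
  then have "(\<integral>\<^sup>+ y. ennreal (dist (\<Phi> y) (\<Phi>' y)) \<partial>\<mu>Y) = 0"
    using push[OF path_dist_measurable[OF measurable_compose[OF cp(2) meas'(1)] measurable_compose[OF cp(3) meas'(2)]]]
    by simp
  then have "AE y in \<mu>Y. ennreal (dist (\<Phi> y) (\<Phi>' y)) = 0"
    using nn_integral_0_iff_AE[of "\<lambda>y. ennreal (dist (\<Phi> y) (\<Phi>' y))" \<mu>Y] path_dist_measurable[OF meas] by simp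
  then have "AE y in \<mu>Y. \<Phi> y = \<Phi>' y" by eventually_elim (simp add: ennreal_eq_0_iff)
  then have "distr \<mu>Y (path_borel T) \<Phi> = distr \<mu>Y (path_borel T) \<Phi>'"
    using meas by (intro distr_cong_AE) auto
  then show ?thesis using \<Phi>(2) \<Phi>'(2) by simp
qed

text \<open>No optimal coupling is assumed to exist. Couplings within
  \<open>inverse (real (Suc n))\<close> of the infimum give the bound with that slack, and
  continuity of \<open>M\<close> removes it in the limit.\<close>

lemma weak_solution_law_stability:
  fixes B1 B2 :: "('d::finite) drift"
  assumes B1: "regular_drift B1" and B2: "regular_drift B2"
    and \<mu>1: "\<mu>1 \<in> P1 (C_paths T)" and \<mu>2: "\<mu>2 \<in> P1 (C_paths T)"
    and ws1: "weak_solution_law T B1 \<mu>1 \<nu>1" and ws2: "weak_solution_law T B2 \<mu>2 \<nu>2"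
  shows "wasserstein1 \<nu>1 \<nu>2 \<le>
    extend_top (M (2 * H)) (wasserstein1 \<mu>1 \<mu>2 + ennreal T * drift_dist T B1 B2)"
proof (cases "wasserstein1 \<mu>1 \<mu>2 + ennreal T * drift_dist T B1 B2 = \<infinity>")
  case False
  obtain \<Phi>1 where \<Phi>1: "strong_solution B1 \<mu>1 \<Phi>1" "\<nu>1 = distr \<mu>1 (path_borel T) \<Phi>1"
    using ws1 weak_solution_strong[OF B1 \<mu>1] unfolding weak_solution_law_def by metis
  obtain \<Phi>2 where \<Phi>2: "strong_solution B2 \<mu>2 \<Phi>2" "\<nu>2 = distr \<mu>2 (path_borel T) \<Phi>2"
    using ws2 weak_solution_strong[OF B2 \<mu>2] unfolding weak_solution_law_def by metis
  have meas: "\<Phi>1 \<in> \<mu>1 \<rightarrow>\<^sub>M path_borel T" "\<Phi>2 \<in> \<mu>2 \<rightarrow>\<^sub>M path_borel T"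
    using \<Phi>1(1) \<Phi>2(1) by (auto simp: strong_solution_def integrable_path_def)
  define w where "w = enn2real (wasserstein1 \<mu>1 \<mu>2)"
  define D where "D = enn2real (drift_dist T B1 B2)"
  have w: "wasserstein1 \<mu>1 \<mu>2 = ennreal w"
    using False by (simp add: w_def less_top)
  \<comment> \<open>Finiteness of the product yields finiteness of the drift distance because
    \<open>T\<close> is positive; for \<open>T = 0\<close> the product with infinity would be
    0.\<close>
  have D: "drift_dist T B1 B2 = ennreal D"
    using False T_pos by (auto simp: D_def less_top ennreal_mult_eq_top_iff)
  have w0: "0 \<le> w" and D0: "0 \<le> D" by (simp_all add: w_def D_def)
  have TD: "0 \<le> T * D" using T_pos D0 by simp
  have approx: "wasserstein1 \<nu>1 \<nu>2 \<le> ennreal (M (2 * H) (w + T * D + inverse (real (Suc n))))" for n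
  proof -
    have "wasserstein1 \<mu>1 \<mu>2 < ennreal (w + inverse (real (Suc n)))"
      unfolding w using w0 by (intro ennreal_lessI add_nonneg_pos) auto
    then obtain \<pi> where \<pi>: "\<pi> \<in> couplings \<mu>1 \<mu>2"
      and cost: "(\<integral>\<^sup>+ z. ennreal (dist (fst z) (snd z)) \<partial>\<pi>) < ennreal (w + inverse (real (Suc n)))"
      unfolding wasserstein1_def INF_less_iff by blast
    define c where "c = enn2real (\<integral>\<^sup>+ z. ennreal (dist (fst z) (snd z)) \<partial>\<pi>)"
    have c: "(\<integral>\<^sup>+ z. ennreal (dist (fst z) (snd z)) \<partial>\<pi>) = ennreal c" "0 \<le> c"
      using less_trans[OF cost ennreal_less_top] by (simp_all add: c_def)
    have c_le: "c \<le> w + inverse (real (Suc n))"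
      using cost unfolding c(1) using c(2) by (simp add: ennreal_less_iff)
    note cp = couplings_paths[OF \<mu>1 \<mu>2 \<pi>]
    have \<nu>1: "\<nu>1 = distr \<pi> (path_borel T) (\<Phi>1 \<circ> fst)"
      using distr_distr[OF meas(1) cp(4)] cp(6) \<Phi>1(2) by simp
    have \<nu>2: "\<nu>2 = distr \<pi> (path_borel T) (\<Phi>2 \<circ> snd)"
      using distr_distr[OF meas(2) cp(5)] cp(7) \<Phi>2(2) by simp
    have "wasserstein1 \<nu>1 \<nu>2 \<le> (\<integral>\<^sup>+ z. ennreal (dist ((\<Phi>1 \<circ> fst) z) ((\<Phi>2 \<circ> snd) z)) \<partial>\<pi>)"
      unfolding \<nu>1 \<nu>2
      by (intro wasserstein1_le measurable_comp[OF cp(4) meas(1)] measurable_comp[OF cp(5) meas(2)]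
          path_dist_measurable[OF measurable_fst measurable_snd])
    also have "\<dots> \<le> ennreal (M (2 * H) (c + T * D))"
      using strong_solution_stability[OF B1 B2 \<mu>1 \<mu>2 \<Phi>1(1) \<Phi>2(1) \<pi> c, of D] D D0 by (simp add: comp_def)
    also have "\<dots> \<le> ennreal (M (2 * H) (w + T * D + inverse (real (Suc n))))"
    proof (intro ennreal_leI)
      have "c + T * D \<le> w + T * D + inverse (real (Suc n))" using c_le by simp
      then show "M (2 * H) (c + T * D) \<le> M (2 * H) (w + T * D + inverse (real (Suc n)))"
        by (rule strict_mono_on_leD[OF M_strict_mono, rotated 2]) (use c(2) TD c_le in auto)
    qed
    finally show ?thesis .
  qed
  have "(\<lambda>n. M (2 * H) (w + T * D + inverse (real (Suc n)))) \<longlonglongrightarrow> M (2 * H) (w + T * D + 0)"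
  proof (rule continuous_on_tendsto_compose[OF M_continuous])
    show "(\<lambda>n. w + T * D + inverse (real (Suc n))) \<longlonglongrightarrow> w + T * D + 0"
      by (intro tendsto_intros LIMSEQ_inverse_real_of_nat)
    show "w + T * D + 0 \<in> {0..}" using w0 TD by simp
    show "\<forall>\<^sub>F n in sequentially. w + T * D + inverse (real (Suc n)) \<in> {0..}"
      using w0 TD by (intro always_eventually) (auto intro!: add_nonneg_nonneg)
  qed
  then have "(\<lambda>n. ennreal (M (2 * H) (w + T * D + inverse (real (Suc n))))) \<longlonglongrightarrow> ennreal (M (2 * H) (w + T * D + 0))"
    by (rule tendsto_ennrealI)
  then have "wasserstein1 \<nu>1 \<nu>2 \<le> ennreal (M (2 * H) (w + T * D + 0))"
    by (rule LIMSEQ_le_const) (use approx in blast)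
  moreover have "enn2real (wasserstein1 \<mu>1 \<mu>2 + ennreal T * drift_dist T B1 B2) = w + T * D"
  proof -
    have eq: "wasserstein1 \<mu>1 \<mu>2 + ennreal T * drift_dist T B1 B2 = ennreal (w + T * D)"
      unfolding w D using w0 D0 T_pos by (simp add: ennreal_mult[symmetric])
    show ?thesis unfolding eq by (rule enn2real_ennreal) (use w0 TD in simp)
  qed
  ultimately show ?thesis using False by (simp add: extend_top_def)
qed (simp add: extend_top_def)

end

text \<open>An absolutely integrable function is only Lebesgue measurable, whereas the kernel must
  be Borel. Taking a Borel version, its absolute value and its restriction to \<open>{0..T}\<close>
  costs a null set of times.\<close>

lemma absolutely_integrable_borel_majorant:
  fixes k :: "real \<Rightarrow> real"
  assumes "k absolutely_integrable_on {0..T}"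
  obtains k' where "integrable lborel k'" "\<And>s. 0 \<le> k' s" "\<And>s. s \<notin> {0..T} \<Longrightarrow> k' s = 0"
    "AE s in lborel. s \<in> {0..T} \<longrightarrow> k s \<le> k' s"
proof -
  define g where "g s = indicator {0..T} s * k s" for s
  have int: "integrable lebesgue g"
    using assms by (simp add: set_integrable_def g_def[abs_def])
  then obtain g' where g': "g' \<in> borel_measurable lborel" and ae: "AE s in lborel. g s = g' s"
    using completion_ex_borel_measurable_real[of g lborel] by (auto dest: borel_measurable_integrable)
  have "integrable lebesgue g'"
    using integrable_cong_AE[OF borel_measurable_integrable[OF int] measurable_completion[OF g']
        AE_completion[OF ae]] int by blast
  then have g'_int: "integrable lborel g'" using integrable_completion[OF g'] by simp
  show thesis
  proof (rule that[of "\<lambda>s. indicator {0..T} s * \<bar>g' s\<bar>"])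
    show "integrable lborel (\<lambda>s. indicator {0..T} s * \<bar>g' s\<bar>)"
      using integrable_mult_indicator[of "{0..T}" lborel "\<lambda>s. \<bar>g' s\<bar>"] g'_int by simp
    show "AE s in lborel. s \<in> {0..T} \<longrightarrow> k s \<le> indicator {0..T} s * \<bar>g' s\<bar>"
      using ae by eventually_elim (auto simp: g_def)
  qed auto
qed

text \<open>Composition with \<open>max 0\<close> extends \<open>f\<close> to negative arguments, on
  which the hypotheses say nothing, while keeping it continuous and monotone on the whole
  line.\<close>

lemma concave_modulus_osgood:
  assumes mod: "modulus_of_continuity f" and conc: "concave_on {0..} f"
    and div: "\<forall>\<epsilon>>0. (\<integral>\<^sup>+ u\<in>{0<..<\<epsilon>}. ennreal (1 / f u) \<partial>lborel) = \<infinity>"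
  shows "osgood (\<lambda>u. f (max 0 u))"
proof
  have cont: "continuous_on {0..} f" and mono: "mono_on {0..} f" and zero: "f 0 = 0"
    and pos: "\<And>u. 0 < u \<Longrightarrow> 0 < f u"
    using mod by (auto simp: modulus_of_continuity_def)
  show "continuous_on UNIV (\<lambda>u. f (max 0 u))"
    by (rule continuous_on_compose2[OF cont]) (auto intro!: continuous_intros)
  show "mono (\<lambda>u. f (max 0 u))"
    by (intro monoI mono_onD[OF mono]) auto
  show "f (max 0 0) = 0" using zero by simp
  show "0 \<le> f (max 0 u)" for u
    using zero pos[of u] by (cases "0 < u") (auto simp: max_def)
  show "0 < f (max 0 u)" if "0 < u" for u using pos[OF that] that by simp
  show "f (max 0 (c * u)) \<le> c * f (max 0 u)" if u: "0 \<le> u" and c: "1 \<le> c" for u c :: real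
  proof -
    \<comment> \<open>\<open>u\<close> is the convex combination of 0 and \<open>c * u\<close> with
      weight \<open>1 / c\<close> on the latter, and \<open>f 0 = 0\<close>.\<close>
    have "(1 - 1 / c) * f 0 + (1 / c) * f (c * u) \<le> f ((1 - 1 / c) *\<^sub>R 0 + (1 / c) *\<^sub>R (c * u))"
      using u c by (intro concave_onD[OF conc]) auto
    then have "(1 / c) * f (c * u) \<le> f u" using c zero by simp
    then have "f (c * u) \<le> c * f u" using c by (simp add: field_simps)
    then show ?thesis using u c by simp
  qed
  have "(\<integral>\<^sup>+ u\<in>{0<..<1}. ennreal (1 / f (max 0 u)) \<partial>lborel) = (\<integral>\<^sup>+ u\<in>{0<..<1}. ennreal (1 / f u) \<partial>lborel)"
    by (intro nn_integral_cong) (auto simp: indicator_def)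
  then show "(\<integral>\<^sup>+ u\<in>{0<..<1}. ennreal (1 / f (max 0 u)) \<partial>lborel) = \<infinity>" using div by simp
qed

theorem theorem3p18:
  fixes T :: real and h f :: "real \<Rightarrow> real"
  assumes "0 < T"
    and "h absolutely_integrable_on {0..T}" and "\<forall>t\<in>{0..T}. 0 \<le> h t"
    and "modulus_of_continuity f" and "concave_on {0..} f"
    and "\<forall>\<epsilon>>0. (\<integral>\<^sup>+ u\<in>{0<..<\<epsilon>}. ennreal (1 / f u) \<partial>lborel) = \<infinity>"
  shows
    "(\<forall>(B :: 'd::finite drift) \<mu>Y. admissible_drift T h f B \<and> \<mu>Y \<in> P1 (C_paths T) \<longrightarrow>
        (\<exists>\<mu>X. weak_solution_law T B \<mu>Y \<mu>X) \<and>
        (\<forall>(W :: 'w measure) X Y (W' :: 'v measure) X' Y'.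
           weak_solution T B \<mu>Y W X Y \<and> weak_solution T B \<mu>Y W' X' Y' \<longrightarrow>
           distr W (path_borel T) X = distr W' (path_borel T) X')) \<and>
     (\<exists>M. M \<in> {0..} \<rightarrow> {0..} \<and> continuous_on {0..} M \<and> strict_mono_on {0..} M \<and> M 0 = 0 \<and>
        (\<forall>(B1 :: 'd drift) (B2 :: 'd drift) \<mu>Y1 \<mu>Y2 \<mu>X1 \<mu>X2.
           admissible_drift T h f B1 \<and> admissible_drift T h f B2 \<and>
           \<mu>Y1 \<in> P1 (C_paths T) \<and> \<mu>Y2 \<in> P1 (C_paths T) \<and>
           weak_solution_law T B1 \<mu>Y1 \<mu>X1 \<and> weak_solution_law T B2 \<mu>Y2 \<mu>X2 \<longrightarrow>
           wasserstein1 \<mu>X1 \<mu>X2 \<le>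
             extend_top M (wasserstein1 \<mu>Y1 \<mu>Y2 + ennreal T * drift_dist T B1 B2)))"
proof -
  \<comment> \<open>The majorant of \<open>h\<close> is fixed before any drift appears, so that
    \<open>M (2 * H)\<close> is determined by \<open>f\<close> and this majorant and serves all
    drifts and inputs.\<close>
  obtain h' where h': "integrable lborel h'" "\<And>s. 0 \<le> h' s" "\<And>s. s \<notin> {0..T} \<Longrightarrow> h' s = 0"
    "AE s in lborel. s \<in> {0..T} \<longrightarrow> h s \<le> h' s"
    using absolutely_integrable_borel_majorant[OF assms(2)] by blast
  interpret osgood "\<lambda>u. f (max 0 u)" by (rule concave_modulus_osgood[OF assms(4-6)])
  interpret osgood_kernel "\<lambda>u. f (max 0 u)" T h'
    by unfold_locales (use assms(1) h' in auto)
  have regular: "regular_drift B" if B: "admissible_drift T h f B" for B :: "'d drift"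
    unfolding regular_drift_def
  proof (intro conjI)
    show "drift_measurable T B" using B by (simp add: admissible_drift_def)
    obtain k where k: "k absolutely_integrable_on {0..T}" "linear_growth T k B"
      using B by (auto simp: admissible_drift_def)
    obtain k' where k': "integrable lborel k'" "\<And>s. 0 \<le> k' s"
      "AE s in lborel. s \<in> {0..T} \<longrightarrow> k s \<le> k' s"
      using absolutely_integrable_borel_majorant[OF k(1)] by metis
    have "AE s in lborel. s \<in> {0..T} \<longrightarrow>
        (\<forall>x. \<forall>\<mu>\<in>P1 UNIV. norm (B s x \<mu>) \<le> k' s * (1 + norm x + enn2real (moment1 \<mu>)))"
      using k'(3)
    proof eventually_elim
      case (elim s)
      have "norm (B s x \<mu>) \<le> k' s * (1 + norm x + enn2real (moment1 \<mu>))"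
        if s: "s \<in> {0..T}" and \<mu>: "\<mu> \<in> P1 UNIV" for x \<mu>
      proof -
        have "norm (B s x \<mu>) \<le> k s * (1 + norm x + enn2real (moment1 \<mu>))"
          using k(2) s \<mu> by (auto simp: linear_growth_def)
        also have "\<dots> \<le> k' s * (1 + norm x + enn2real (moment1 \<mu>))"
          using elim s by (intro mult_right_mono) (auto intro!: add_nonneg_nonneg)
        finally show ?thesis .
      qed
      then show ?case by blast
    qed
    then show "\<exists>k. growth_rate B k" using k'(1,2) unfolding growth_rate_def by blast
    show "AE s in lborel. s \<in> {0..T} \<longrightarrow> (\<forall>x y. \<forall>\<mu>\<in>P1 UNIV. \<forall>\<nu>\<in>P1 UNIV.
        norm (B s x \<mu> - B s y \<nu>) \<le> h' s * f (max 0 (norm (x - y) + d1 \<mu> \<nu>)))"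
      using h'(4)
    proof eventually_elim
      case (elim s)
      have "norm (B s x \<mu> - B s y \<nu>) \<le> h' s * f (max 0 (norm (x - y) + d1 \<mu> \<nu>))"
        if s: "s \<in> {0..T}" and \<mu>: "\<mu> \<in> P1 UNIV" and \<nu>: "\<nu> \<in> P1 UNIV" for x y \<mu> \<nu>
      proof -
        \<comment> \<open>\<open>d1\<close> is a value of \<open>enn2real\<close>, hence
          nonnegative, so the extension of \<open>f\<close> is evaluated where it agrees with
          \<open>f\<close>.\<close>
        have u: "max 0 (norm (x - y) + d1 \<mu> \<nu>) = norm (x - y) + d1 \<mu> \<nu>" by (simp add: d1_def)
        have "norm (B s x \<mu> - B s y \<nu>) \<le> h s * f (norm (x - y) + d1 \<mu> \<nu>)"
          using B s \<mu> \<nu> by (auto simp: admissible_drift_def)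
        also have "\<dots> \<le> h' s * f (norm (x - y) + d1 \<mu> \<nu>)"
          using elim s nonneg[of "norm (x - y) + d1 \<mu> \<nu>"] unfolding u by (intro mult_right_mono) auto
        finally show ?thesis unfolding u .
      qed
      then show ?case by blast
    qed
  qed
  show ?thesis
  proof (intro conjI allI impI exI[of _ "M (2 * H)"])
    fix B :: "'d drift" and \<mu>Y :: "'d path measure" assume "admissible_drift T h f B \<and> \<mu>Y \<in> P1 (C_paths T)"
    then have B: "regular_drift B" and \<mu>Y: "\<mu>Y \<in> P1 (C_paths T)" using regular by auto
    show "\<exists>\<mu>X. weak_solution_law T B \<mu>Y \<mu>X" by (rule weak_solution_law_exists[OF B \<mu>Y])
    fix W :: "'w measure" and X Y :: "'w \<Rightarrow> 'd path"
      and W' :: "'v measure" and X' Y' :: "'v \<Rightarrow> 'd path"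
    assume "weak_solution T B \<mu>Y W X Y \<and> weak_solution T B \<mu>Y W' X' Y'"
    then show "distr W (path_borel T) X = distr W' (path_borel T) X'"
      using weak_solution_law_unique[OF B \<mu>Y] by blast
  next
    show "M (2 * H) \<in> {0..} \<rightarrow> {0..}" by (simp add: M_nonneg)
    show "continuous_on {0..} (M (2 * H))" by (rule M_continuous)
    show "strict_mono_on {0..} (M (2 * H))" by (rule M_strict_mono)
    show "M (2 * H) 0 = 0" by simp
  next
    fix B1 B2 :: "'d drift" and \<mu>Y1 \<mu>Y2 \<mu>X1 \<mu>X2 :: "'d path measure"
    assume "admissible_drift T h f B1 \<and> admissible_drift T h f B2 \<and>
      \<mu>Y1 \<in> P1 (C_paths T) \<and> \<mu>Y2 \<in> P1 (C_paths T) \<and>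
      weak_solution_law T B1 \<mu>Y1 \<mu>X1 \<and> weak_solution_law T B2 \<mu>Y2 \<mu>X2"
    then show "wasserstein1 \<mu>X1 \<mu>X2 \<le>
        extend_top (M (2 * H)) (wasserstein1 \<mu>Y1 \<mu>Y2 + ennreal T * drift_dist T B1 B2)"
      using regular by (intro weak_solution_law_stability) auto
  qed
qed

end
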